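(* Let $y:M\to Q^n_r$ be a spacelike isothermic surface and let $y^{\tilde c}$ be a spectral transform of $y$ with parameter $\tilde c\in\mathbb{R}$, both being spacelike isothermic surfaces. Denote their canonical lifts by $Y,Y^{\tilde c}$ with respect to the same adapted coordinate $z$. If a $c$-polar surface $\psi$ of $y$ is non-degenerate, then there exists a $c$-polar surface $\psi^{\tilde c}$ of $y^{\tilde c}$ such that $\psi^{\tilde c}$ is also a spectral transform of $\psi$ with parameter $\tilde c$.
   Context: **Ambient spaces.** $\mathbb{R}^m_s$ is $\mathbb{R}^m$ with $\langle x,x\rangle=\sum_{i=1}^{m-s}x_i^2-\sum_{i=m-s+1}^m x_i^2$, extended complex bilinearly. Let $n-r\ge2$, $r\ge0$. $Q^n_r\subset\mathbb{R}P^{n+1}$ is the set of null lines in $\mathbb{R}^{n+2}_{r+1}$, with its standard conformal structure of signature $(n-r,r)$. **Conformal invariants.** Let $y:M\to Q^n_r$ be a spacelike surface (conformal immersion inducing a positive definite conformal class) with local complex coordinate $z$. The canonical lift $Y$ is the local lift of $y$ into the light cone minus $0$ with $|dY|^2=|dz|^2$. Put $V=\mathrm{Span}\{Y,\mathrm{Re}\,Y_z,\mathrm{Im}\,Y_z,Y_{z\bar z}\}$. The conformal normal bundle $V^\perp$ is its orthogonal complement, with induced connection $D$. The Schwarzian $s$ and the conformal Hopf differential $\kappa\in\Gamma(V^\perp\otimes\mathbb{C})$ are defined by $Y_{zz}=-\frac s2Y+\kappa$. The surface is isothermic if around each point there is a complex coordinate $z$ (adapted coordinate) for which $\kappa$ is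 real-valued. **$c$-polar transforms.** Let $y$ be spacelike isothermic, and let $\psi\in\Gamma(V^\perp)$ be a real, nonzero section with $D_z\psi=0$ and $\langle\psi,\psi\rangle=c$ constant. If $c\ne0$, $\psi:M\to N_c=\{x\in\mathbb{R}^{n+2}_{r+1}\mid\langle x,x\rangle=c\}$ is a $c$-polar transform (or $c$-polar surface) of $y$. If $c=0$, $[\psi]:M\to Q^n_r$ is a $0$-polar transform of $y$. It is non-degenerate if $\psi$ is an immersion with positive definite induced metric; equivalently, $\langle\psi,\kappa\rangle\neq0$ everywhere. **Conformal invariants of polar transforms.** When $c\neq0$, the conformal invariants of $\psi:M\to N_c$ are those of the surface $[(\psi,\sqrt{|c|})]$ in the projectivized light cone of $\mathbb{R}^{n+2}_{r+1}\oplus\mathbb{R}$ with inner product $\langle x,x\rangle-\mathrm{sgn}(c)\,t^2$ (the conformal embedding of $N_c$ into its conformal compactification). When $c=0$, they are those of $[\psi]$ in $Q^n_r$. **Spectral transform.** Let $y$ be a spacelike isothermic surface with adapted coordinate $z$ and invariants $s,\kappa,D$. A spectral transform of $y$ with parameter $\tilde c\in\mathbb{R}$ is a spacelike isothermic surface $y^{\tilde c}$ in the same quadric, with the same adapted coordinate $z$, whose Schwarzian is $s^{\tilde c}=s+\tilde c$ and for which there is a bundle isomorphism $\phi\mapsto\phi^{\tilde c}$ from the conformal normal bundle of $y$ to that of $y^{\tilde c}$ that preserves the inner product, intertwines the normal connections ($D_z^{\tilde c}=D_z$), and maps conformal Hopf differential to conformal Hopf differential, i.e. $\langle\kappa^{\tilde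 c},\phi^{\tilde c}\rangle=\langle\kappa,\phi\rangle$ for all normal sections $\phi$. *)

theory Defs
  imports "HOL-Analysis.Analysis"
begin

text \<open>
  Coordinates of \<open>real ^ 'm\<close> are indexed by an arbitrary finite type, so \<open>\<real>\<^sup>m\<^sub>s\<close> is given by a sign
  function with \<open>s\<close> negative entries rather than by making the last \<open>s\<close> coordinates negative.
  \<open>sprod\<close> is used at \<open>real\<close> and at \<open>complex\<close>, where it is the complex bilinear (not Hermitian) extension.
\<close>

definition signature :: "('m::finite \<Rightarrow> real) \<Rightarrow> nat \<Rightarrow> nat \<Rightarrow> bool" where
  "signature \<epsilon> m s \<longleftrightarrow>
     CARD('m) = m \<and> (\<forall>i. \<epsilon> i = 1 \<or> \<epsilon> i = -1) \<and> card {i. \<epsilon> i = -1} = s"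

definition sprod :: "('m::finite \<Rightarrow> real) \<Rightarrow> 'a::real_algebra_1 ^ 'm \<Rightarrow> 'a ^ 'm \<Rightarrow> 'a" where
  "sprod \<epsilon> u v = (\<Sum>i\<in>UNIV. of_real (\<epsilon> i) * u $ i * v $ i)"

definition quadric :: "('m::finite \<Rightarrow> real) \<Rightarrow> (real ^ 'm) set set" where
  "quadric \<epsilon> = {span {x} | x. x \<noteq> 0 \<and> sprod \<epsilon> x x = 0}"

definition cvec :: "real ^ 'm \<Rightarrow> complex ^ 'm" where
  "cvec x = (\<chi> i. complex_of_real (x $ i))"

definition re_vec :: "complex ^ 'm \<Rightarrow> real ^ 'm" where
  "re_vec u = (\<chi> i. Re (u $ i))"

definition im_vec :: "complex ^ 'm \<Rightarrow> real ^ 'm" where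
  "im_vec u = (\<chi> i. Im (u $ i))"

definition cextend :: "(real ^ 'm \<Rightarrow> real ^ 'n) \<Rightarrow> complex ^ 'm \<Rightarrow> complex ^ 'n" where
  "cextend f u = cvec (f (re_vec u)) + \<i> *s cvec (f (im_vec u))"

text \<open>Smoothness is meant on open sets; all derivatives of maps on \<open>complex\<close> are real (Frechet).\<close>

primrec Ck_on :: "nat \<Rightarrow> complex set \<Rightarrow> (complex \<Rightarrow> 'a::real_normed_vector) \<Rightarrow> bool" where
  "Ck_on 0 U f \<longleftrightarrow> continuous_on U f"
| "Ck_on (Suc k) U f \<longleftrightarrow> (\<forall>p\<in>U. f differentiable (at p)) \<and>
     (\<forall>v. Ck_on k U (\<lambda>p. frechet_derivative f (at p) v))"

definition smooth_on :: "complex set \<Rightarrow> (complex \<Rightarrow> 'a::real_normed_vector) \<Rightarrow> bool" where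
  "smooth_on U f \<longleftrightarrow> (\<forall>k. Ck_on k U f)"

definition dz :: "(complex \<Rightarrow> complex ^ 'm::finite) \<Rightarrow> complex \<Rightarrow> complex ^ 'm" where
  "dz F p = (1/2) *s (frechet_derivative F (at p) 1 - \<i> *s frechet_derivative F (at p) \<i>)"

definition dzbar :: "(complex \<Rightarrow> complex ^ 'm::finite) \<Rightarrow> complex \<Rightarrow> complex ^ 'm" where
  "dzbar F p = (1/2) *s (frechet_derivative F (at p) 1 + \<i> *s frechet_derivative F (at p) \<i>)"

text \<open>
  A surface is a map from an open set \<open>U\<close> of \<open>complex\<close> to the null lines: \<open>M\<close> is identified with
  the image of the coordinate \<open>z\<close>, which becomes the identity.
  The metric of a lift \<open>F\<close> represents the conformal class induced by \<open>y\<close>; \<open>\<mu>\<close> is its conformal factor.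
\<close>

definition spacelike_surface ::
  "('m::finite \<Rightarrow> real) \<Rightarrow> complex set \<Rightarrow> (complex \<Rightarrow> (real ^ 'm) set) \<Rightarrow> bool" where
  "spacelike_surface \<epsilon> U y \<longleftrightarrow> open U \<and> (\<forall>p\<in>U. y p \<in> quadric \<epsilon>) \<and>
     (\<forall>p\<in>U. \<exists>W F \<mu>. open W \<and> p \<in> W \<and> W \<subseteq> U \<and> smooth_on W F \<and>
        (\<forall>q\<in>W. F q \<noteq> 0 \<and> y q = span {F q} \<and> \<mu> q > 0 \<and>
           (\<forall>v. sprod \<epsilon> (frechet_derivative F (at q) v) (frechet_derivative F (at q) v)
                = \<mu> q * (norm v)\<^sup>2)))"

text \<open>
  Canonical lifts exist only locally in general, and are unique up to a locally constant sign.
  Under \<open>Y \<mapsto> -Y\<close> everything below is unchanged except \<open>hopf\<close>, which changes sign.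
\<close>

definition canonical_lift ::
  "('m::finite \<Rightarrow> real) \<Rightarrow> complex set \<Rightarrow> (complex \<Rightarrow> (real ^ 'm) set)
     \<Rightarrow> (complex \<Rightarrow> real ^ 'm) \<Rightarrow> bool" where
  "canonical_lift \<epsilon> W y Y \<longleftrightarrow> open W \<and> smooth_on W Y \<and>
     (\<forall>p\<in>W. Y p \<noteq> 0 \<and> sprod \<epsilon> (Y p) (Y p) = 0 \<and> y p = span {Y p} \<and>
        (\<forall>v. sprod \<epsilon> (frechet_derivative Y (at p) v) (frechet_derivative Y (at p) v)
             = (norm v)\<^sup>2))"

text \<open>\<open>Y\<^bsub>z zbar\<^esub>\<close> is a quarter of the Laplacian of \<open>Y\<close>, hence real.\<close>

definition tangent_space :: "(complex \<Rightarrow> real ^ 'm::finite) \<Rightarrow> complex \<Rightarrow> (real ^ 'm) set" where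
  "tangent_space Y p =
     (let Yc = (\<lambda>q. cvec (Y q)) in
      span {Y p, re_vec (dz Yc p), im_vec (dz Yc p), re_vec (dzbar (dz Yc) p)})"

definition normal_space ::
  "('m::finite \<Rightarrow> real) \<Rightarrow> (complex \<Rightarrow> real ^ 'm) \<Rightarrow> complex \<Rightarrow> (real ^ 'm) set" where
  "normal_space \<epsilon> Y p = {v. \<forall>u\<in>tangent_space Y p. sprod \<epsilon> v u = 0}"

definition normal_proj ::
  "('m::finite \<Rightarrow> real) \<Rightarrow> (complex \<Rightarrow> real ^ 'm) \<Rightarrow> complex \<Rightarrow> real ^ 'm \<Rightarrow> real ^ 'm" where
  "normal_proj \<epsilon> Y p v = (THE w. w \<in> normal_space \<epsilon> Y p \<and> v - w \<in> tangent_space Y p)"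

definition Dz ::
  "('m::finite \<Rightarrow> real) \<Rightarrow> (complex \<Rightarrow> real ^ 'm) \<Rightarrow> (complex \<Rightarrow> real ^ 'm)
     \<Rightarrow> complex \<Rightarrow> complex ^ 'm" where
  "Dz \<epsilon> Y \<phi> p = cextend (normal_proj \<epsilon> Y p) (dz (\<lambda>q. cvec (\<phi> q)) p)"

definition cnormal_space ::
  "('m::finite \<Rightarrow> real) \<Rightarrow> (complex \<Rightarrow> real ^ 'm) \<Rightarrow> complex \<Rightarrow> (complex ^ 'm) set" where
  "cnormal_space \<epsilon> Y p = {u. re_vec u \<in> normal_space \<epsilon> Y p \<and> im_vec u \<in> normal_space \<epsilon> Y p}"

definition schwarzian ::
  "('m::finite \<Rightarrow> real) \<Rightarrow> (complex \<Rightarrow> real ^ 'm) \<Rightarrow> complex \<Rightarrow> complex" where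
  "schwarzian \<epsilon> Y p =
     (THE s. \<exists>\<kappa>\<in>cnormal_space \<epsilon> Y p.
        dz (dz (\<lambda>q. cvec (Y q))) p = (- s / 2) *s cvec (Y p) + \<kappa>)"

definition hopf ::
  "('m::finite \<Rightarrow> real) \<Rightarrow> (complex \<Rightarrow> real ^ 'm) \<Rightarrow> complex \<Rightarrow> complex ^ 'm" where
  "hopf \<epsilon> Y p =
     dz (dz (\<lambda>q. cvec (Y q))) p - (- schwarzian \<epsilon> Y p / 2) *s cvec (Y p)"

text \<open>Isothermic, with the identity as adapted coordinate.\<close>

definition isothermic_adapted ::
  "('m::finite \<Rightarrow> real) \<Rightarrow> complex set \<Rightarrow> (complex \<Rightarrow> (real ^ 'm) set) \<Rightarrow> bool" where
  "isothermic_adapted \<epsilon> U y \<longleftrightarrow> spacelike_surface \<epsilon> U y \<and>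
     (\<forall>W Y. W \<subseteq> U \<and> canonical_lift \<epsilon> W y Y \<longrightarrow> (\<forall>p\<in>W. im_vec (hopf \<epsilon> Y p) = 0))"

definition normal_section ::
  "('m::finite \<Rightarrow> real) \<Rightarrow> (complex \<Rightarrow> real ^ 'm) \<Rightarrow> complex set \<Rightarrow> (complex \<Rightarrow> real ^ 'm) \<Rightarrow> bool" where
  "normal_section \<epsilon> Y W \<phi> \<longleftrightarrow> smooth_on W \<phi> \<and> (\<forall>p\<in>W. \<phi> p \<in> normal_space \<epsilon> Y p)"

definition polar_transform ::
  "('m::finite \<Rightarrow> real) \<Rightarrow> complex set \<Rightarrow> (complex \<Rightarrow> (real ^ 'm) set) \<Rightarrow> real
     \<Rightarrow> (complex \<Rightarrow> real ^ 'm) \<Rightarrow> bool" where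
  "polar_transform \<epsilon> U y c \<psi> \<longleftrightarrow> isothermic_adapted \<epsilon> U y \<and>
     (\<forall>p\<in>U. \<psi> p \<noteq> 0 \<and> sprod \<epsilon> (\<psi> p) (\<psi> p) = c) \<and>
     (\<forall>W Y. W \<subseteq> U \<and> canonical_lift \<epsilon> W y Y \<longrightarrow>
        normal_section \<epsilon> Y W \<psi> \<and> (\<forall>p\<in>W. Dz \<epsilon> Y \<psi> p = 0))"

text \<open>For \<open>c = 0\<close> this says that \<open>[\<psi>]\<close> is an immersion inducing a positive definite conformal class.\<close>

definition nondegenerate ::
  "('m::finite \<Rightarrow> real) \<Rightarrow> complex set \<Rightarrow> (complex \<Rightarrow> real ^ 'm) \<Rightarrow> bool" where
  "nondegenerate \<epsilon> U \<psi> \<longleftrightarrow>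
     (\<forall>p\<in>U. \<forall>v. v \<noteq> 0 \<longrightarrow>
        sprod \<epsilon> (frechet_derivative \<psi> (at p) v) (frechet_derivative \<psi> (at p) v) > 0)"

text \<open>
  \<open>\<Phi> p\<close> is the fibre over \<open>p\<close> of the bundle isomorphism. \<open>\<Phi>\<close> is defined over all of \<open>U\<close>, while the
  conditions on it are local and so may be expressed through local canonical lifts; the choice of
  these accounts for the sign ambiguity of the conformal Hopf differentials.
\<close>

definition spectral_transform ::
  "('m::finite \<Rightarrow> real) \<Rightarrow> complex set \<Rightarrow> real
     \<Rightarrow> (complex \<Rightarrow> (real ^ 'm) set) \<Rightarrow> (complex \<Rightarrow> (real ^ 'm) set) \<Rightarrow> bool" where
  "spectral_transform \<epsilon> U c' y y' \<longleftrightarrow> isothermic_adapted \<epsilon> U y \<and> isothermic_adapted \<epsilon> U y' \<and>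
     (\<exists>\<Phi> :: complex \<Rightarrow> real ^ 'm \<Rightarrow> real ^ 'm. \<forall>p\<in>U. \<exists>W Y Y'.
        p \<in> W \<and> W \<subseteq> U \<and> canonical_lift \<epsilon> W y Y \<and> canonical_lift \<epsilon> W y' Y' \<and>
        (\<forall>q\<in>W. schwarzian \<epsilon> Y' q = schwarzian \<epsilon> Y q + of_real c' \<and>
           bij_betw (\<Phi> q) (normal_space \<epsilon> Y q) (normal_space \<epsilon> Y' q) \<and>
           (\<forall>u\<in>normal_space \<epsilon> Y q. \<forall>v\<in>normal_space \<epsilon> Y q.
              (\<forall>a b. \<Phi> q (a *\<^sub>R u + b *\<^sub>R v) = a *\<^sub>R \<Phi> q u + b *\<^sub>R \<Phi> q v) \<and>
              sprod \<epsilon> (\<Phi> q u) (\<Phi> q v) = sprod \<epsilon> u v) \<and>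
           (\<forall>u\<in>normal_space \<epsilon> Y q.
              sprod \<epsilon> (hopf \<epsilon> Y' q) (cvec (\<Phi> q u)) = sprod \<epsilon> (hopf \<epsilon> Y q) (cvec u))) \<and>
        (\<forall>W' \<phi>. open W' \<and> W' \<subseteq> W \<and> normal_section \<epsilon> Y W' \<phi> \<longrightarrow>
           smooth_on W' (\<lambda>q. \<Phi> q (\<phi> q)) \<and>
           (\<forall>q\<in>W'. Dz \<epsilon> Y' (\<lambda>q. \<Phi> q (\<phi> q)) q = cextend (\<Phi> q) (Dz \<epsilon> Y \<phi> q))))"

text \<open>
  The conformal compactification of \<open>N\<^sub>c\<close> for \<open>c \<noteq> 0\<close>; the index \<open>None\<close> is the extra coordinate.
\<close>

definition ext_sign :: "real \<Rightarrow> ('m \<Rightarrow> real) \<Rightarrow> 'm option \<Rightarrow> real" where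
  "ext_sign c \<epsilon> j = (case j of None \<Rightarrow> - sgn c | Some i \<Rightarrow> \<epsilon> i)"

definition ext_vec :: "real \<Rightarrow> real ^ 'm::finite \<Rightarrow> real ^ 'm option" where
  "ext_vec c x = (\<chi> j. case j of None \<Rightarrow> sqrt \<bar>c\<bar> | Some i \<Rightarrow> x $ i)"

definition polar_spectral_transform ::
  "('m::finite \<Rightarrow> real) \<Rightarrow> complex set \<Rightarrow> real \<Rightarrow> real
     \<Rightarrow> (complex \<Rightarrow> real ^ 'm) \<Rightarrow> (complex \<Rightarrow> real ^ 'm) \<Rightarrow> bool" where
  "polar_spectral_transform \<epsilon> U c c' \<psi> \<psi>' \<longleftrightarrow>
     (if c = 0
      then spectral_transform \<epsilon> U c' (\<lambda>p. span {\<psi> p}) (\<lambda>p. span {\<psi>' p})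
      else spectral_transform (ext_sign c \<epsilon>) U c'
             (\<lambda>p. span {ext_vec c (\<psi> p)}) (\<lambda>p. span {ext_vec c (\<psi>' p)}))"

end

theory Submission
  imports Defs
begin

text \<open>
  A spectral transform extends its bundle isometry to an isometry \<open>T\<close> of the whole space that maps
  the conformal frame of \<open>Y\<close> to that of \<open>Y'\<close>. The structure equations then read
  \<open>dT T\<^sup>-\<^sup>1 = c' (Y' \<and> \<omega>)\<close>, where \<open>\<omega>\<close> is \<open>Y'\<^sub>1 dx - Y'\<^sub>2 dy\<close>, the indices denote derivatives in the
  directions \<open>1\<close> and \<open>\<i>\<close>, and \<open>(a \<and> b) x\<close> is \<open>\<langle>a, x\<rangle> b - \<langle>b, x\<rangle> a\<close>; conversely this
  equation together with \<open>T Y = Y'\<close> yields a spectral transform. For a polar surface \<open>\<psi>\<close> with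
  \<open>h = \<langle>\<psi>, \<kappa>\<rangle> > 0\<close> one has \<open>\<psi>\<^sub>1 = 2 (h\<^sub>1 Y - h Y\<^sub>1)\<close> and
  \<open>\<psi>\<^sub>2 = -2 (h\<^sub>2 Y - h Y\<^sub>2)\<close>, so that \<open>\<Psi> = \<psi> / 2h\<close> is its canonical lift; the transformed
  polar surface is \<open>T \<psi>\<close> with lift \<open>\<Psi>' = T \<Psi>\<close>. As \<open>Y'\<close> and \<open>\<Psi>'\<close> span a null plane,
  \<open>x \<mapsto> x - c' (\<langle>x, \<Psi>'\<rangle> Y' - \<langle>x, Y'\<rangle> \<Psi>')\<close> is an isometry, and its composition \<open>S\<close> with \<open>T\<close>
  solves the same equation with \<open>\<Psi>, \<Psi>', S\<close> for \<open>Y, Y', T\<close>. If \<open>c \<noteq> 0\<close>, the same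
  computation takes place in the space with the extra coordinate.
\<close>

section \<open>Smooth maps on open subsets of the plane\<close>

text \<open>The map \<open>S\<close> has a conceptual origin. For
  \<open>B = Y' \<and> \<Psi>'\<close> the connection forms of \<open>\<Psi>'\<close> and of
  \<open>Y'\<close> differ by the exact form \<open>c' dB\<close>; as \<open>B\<close> squares to
  zero, \<open>S\<close> is \<open>exp (c' B)\<close> composed with \<open>T\<close>. Two obstacles
  shape the rest. The derivative of \<open>T\<close> on \<open>N\<close> would involve third
  derivatives of the lift. It is never computed: \<open>dT\<close> is skew because \<open>T\<close>
  is an isometry, so its values on \<open>Y\<close>, its two derivatives and the normal vectors
  determine it. These values rest on the Gauss and Codazzi equations, which are drawn from the
  symmetry of mixed derivatives. The other obstacle is the sign. Canonical lifts are given only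
  locally, and the lifts of \<open>y\<close> and \<open>y'\<close> have to change sign together for
  the Hopf condition to survive. Positivity of \<open>h\<close> singles out one lift of each surface
  on all of \<open>U\<close>, and the two choices turn out to be compatible.\<close>

definition pd :: "complex \<Rightarrow> (complex \<Rightarrow> 'a::real_normed_vector) \<Rightarrow> complex \<Rightarrow> 'a" where
  "pd v f p = frechet_derivative f (at p) v"

lemma pd_eqI: "(f has_derivative f') (at p) \<Longrightarrow> pd v f p = f' v"
  unfolding pd_def by (metis frechet_derivative_at)

lemma pd_has_derivative: "f differentiable (at p) \<Longrightarrow> (f has_derivative (\<lambda>v. pd v f p)) (at p)"
  unfolding pd_def using frechet_derivative_works[of f "at p"] by (metis eta_contract_eq)

lemma has_derivative_cong_open:
  assumes "open U" "p \<in> U" "\<And>q. q \<in> U \<Longrightarrow> f q = g q"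
  shows "(f has_derivative D) (at p) \<longleftrightarrow> (g has_derivative D) (at p)"
  using has_derivative_transform_within_open[of f D p UNIV U g]
    has_derivative_transform_within_open[of g D p UNIV U f] assms by auto

lemma pd_cong_open:
  assumes "open U" "p \<in> U" "\<And>q. q \<in> U \<Longrightarrow> f q = g q"
  shows "pd v f p = pd v g p"
  unfolding pd_def frechet_derivative_def using has_derivative_cong_open[OF assms] by simp

lemma differentiable_cong_open:
  assumes "open U" "p \<in> U" "\<And>q. q \<in> U \<Longrightarrow> f q = g q"
  shows "f differentiable (at p) \<longleftrightarrow> g differentiable (at p)"
  unfolding differentiable_def using has_derivative_cong_open[OF assms] by simp

lemma Ck_on_cong:
  assumes "open U" "\<And>q. q \<in> U \<Longrightarrow> f q = g q"
  shows "Ck_on k U f \<longleftrightarrow> Ck_on k U g"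
  using assms(2)
proof (induction k arbitrary: f g)
  case 0 then show ?case by (simp cong: continuous_on_cong)
next
  case (Suc k)
  have "Ck_on k U (\<lambda>p. frechet_derivative f (at p) v) \<longleftrightarrow> Ck_on k U (\<lambda>p. frechet_derivative g (at p) v)" for v
    by (rule Suc.IH) (metis pd_cong_open[OF assms(1)] pd_def Suc.prems)
  moreover have "(\<forall>p\<in>U. f differentiable (at p)) \<longleftrightarrow> (\<forall>p\<in>U. g differentiable (at p))"
    using differentiable_cong_open[OF assms(1)] Suc.prems by metis
  ultimately show ?case by simp
qed

lemma Ck_on_Suc_pd:
  "Ck_on (Suc k) U f \<longleftrightarrow> (\<forall>p\<in>U. f differentiable (at p)) \<and> (\<forall>v. Ck_on k U (pd v f))"
  by (simp add: pd_def[abs_def])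

declare Ck_on.simps(2) [simp del]

lemma Ck_on_Suc_imp: "Ck_on (Suc k) U f \<Longrightarrow> Ck_on k U f"
proof (induction k arbitrary: f)
  case 0 then show ?case
    by (auto simp: Ck_on_Suc_pd intro!: differentiable_imp_continuous_on differentiable_at_imp_differentiable_on)
next
  case (Suc k) then show ?case by (subst Ck_on_Suc_pd) (auto simp: Ck_on_Suc_pd[of "Suc k"])
qed

lemma Ck_on_local:
  assumes "\<And>p. p \<in> U \<Longrightarrow> \<exists>W. open W \<and> p \<in> W \<and> Ck_on k W f"
  shows "Ck_on k U f"
  using assms
proof (induction k arbitrary: f)
  case 0
  have "isCont f p" if "p \<in> U" for p
    using 0[OF that] by (auto simp: continuous_on_eq_continuous_at)
  then show ?case by (simp add: continuous_at_imp_continuous_on)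
next
  case (Suc k) 
  show ?case unfolding Ck_on_Suc_pd
  proof safe
    show "f differentiable (at p)" if "p \<in> U" for p
      using Suc.prems[OF that] by (auto simp: Ck_on_Suc_pd)
    show "Ck_on k U (pd v f)" for v
      by (rule Suc.IH) (use Suc.prems in \<open>unfold Ck_on_Suc_pd, blast\<close>)
  qed
qed

lemma Ck_on_subset: "Ck_on k U f \<Longrightarrow> W \<subseteq> U \<Longrightarrow> Ck_on k W f"
  by (induction k arbitrary: f) (auto simp: Ck_on_Suc_pd intro: continuous_on_subset)

lemma pd_const [simp]: "pd v (\<lambda>q. c) p = 0"
  by (simp add: pd_def)

lemma Ck_on_const: "Ck_on k U (\<lambda>q. c)"
  by (induction k arbitrary: c) (auto simp: Ck_on_Suc_pd pd_def[abs_def])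

lemma pd_add: "f differentiable (at p) \<Longrightarrow> g differentiable (at p) \<Longrightarrow>
    pd v (\<lambda>q. f q + g q) p = pd v f p + pd v g p"
  by (rule pd_eqI) (auto intro!: derivative_eq_intros pd_has_derivative)

lemma pd_diff: "f differentiable (at p) \<Longrightarrow> g differentiable (at p) \<Longrightarrow>
    pd v (\<lambda>q. f q - g q) p = pd v f p - pd v g p"
  by (rule pd_eqI) (auto intro!: derivative_eq_intros pd_has_derivative)

lemma pd_linear:
  assumes "bounded_linear L" "f differentiable (at p)"
  shows "pd v (\<lambda>q. L (f q)) p = L (pd v f p)"
  by (rule pd_eqI) (rule bounded_linear.has_derivative[OF assms(1) pd_has_derivative[OF assms(2)]])

lemma differentiable_linear:
  fixes f :: "complex \<Rightarrow> 'a::real_normed_vector"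
  assumes "bounded_linear L" "f differentiable (at p)"
  shows "(\<lambda>q. L (f q)) differentiable (at p)"
  using bounded_linear.has_derivative[OF assms(1) pd_has_derivative[OF assms(2)]] differentiableI by blast

lemma pd_bilinear:
  assumes "bounded_bilinear B" "f differentiable (at p)" "g differentiable (at p)"
  shows "pd v (\<lambda>q. B (f q) (g q)) p = B (f p) (pd v g p) + B (pd v f p) (g p)"
  by (rule pd_eqI)
    (rule bounded_bilinear.FDERIV[OF assms(1) pd_has_derivative[OF assms(2)] pd_has_derivative[OF assms(3)]])

lemma differentiable_bilinear:
  fixes f :: "complex \<Rightarrow> 'a::real_normed_vector" and g :: "complex \<Rightarrow> 'b::real_normed_vector"
  assumes "bounded_bilinear B" "f differentiable (at p)" "g differentiable (at p)"
  shows "(\<lambda>q. B (f q) (g q)) differentiable (at p)"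
  using bounded_bilinear.FDERIV[OF assms(1) pd_has_derivative[OF assms(2)] pd_has_derivative[OF assms(3)]]
    differentiableI by blast

lemma pd_inverse:
  fixes f :: "complex \<Rightarrow> real"
  assumes "f differentiable (at p)" "f p \<noteq> 0"
  shows "pd v (\<lambda>q. inverse (f q)) p = - (pd v f p * (inverse (f p) * inverse (f p)))"
  by (rule pd_eqI) (auto intro!: derivative_eq_intros pd_has_derivative assms simp: assms)

lemma Ck_on_add:
  assumes "open U" shows "Ck_on k U f \<Longrightarrow> Ck_on k U g \<Longrightarrow> Ck_on k U (\<lambda>q. f q + g q)"
proof (induction k arbitrary: f g)
  case 0 then show ?case by (auto intro: continuous_intros)
next
  case (Suc k)
  have "Ck_on k U (pd v (\<lambda>q. f q + g q)) = Ck_on k U (\<lambda>q. pd v f q + pd v g q)" for v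
    by (rule Ck_on_cong[OF assms]) (use Suc.prems in \<open>auto simp: pd_add Ck_on_Suc_pd\<close>)
  then show ?case using Suc by (auto simp: Ck_on_Suc_pd)
qed

lemma Ck_on_linear:
  assumes "open U" "bounded_linear L" shows "Ck_on k U f \<Longrightarrow> Ck_on k U (\<lambda>q. L (f q))"
proof (induction k arbitrary: f)
  case 0 then show ?case
    using bounded_linear.continuous_on[OF assms(2)] by auto
next
  case (Suc k)
  have "Ck_on k U (pd v (\<lambda>q. L (f q))) = Ck_on k U (\<lambda>q. L (pd v f q))" for v
    by (rule Ck_on_cong[OF assms(1)]) (use Suc.prems in \<open>auto simp: pd_linear[OF assms(2)] Ck_on_Suc_pd\<close>)
  then show ?case using Suc differentiable_linear[OF assms(2)] by (auto simp: Ck_on_Suc_pd)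
qed

lemma Ck_on_bilinear:
  assumes "open U" "bounded_bilinear B"
  shows "Ck_on k U f \<Longrightarrow> Ck_on k U g \<Longrightarrow> Ck_on k U (\<lambda>q. B (f q) (g q))"
proof (induction k arbitrary: f g)
  case 0 then show ?case
    using bounded_bilinear.continuous_on[OF assms(2)] by auto
next
  case (Suc k)
  have "Ck_on k U (pd v (\<lambda>q. B (f q) (g q))) = Ck_on k U (\<lambda>q. B (f q) (pd v g q) + B (pd v f q) (g q))" for v
    by (rule Ck_on_cong[OF assms(1)]) (use Suc.prems in \<open>auto simp: pd_bilinear[OF assms(2)] Ck_on_Suc_pd\<close>)
  moreover have "Ck_on k U (\<lambda>q. B (f q) (pd v g q) + B (pd v f q) (g q))" for v
    using Suc.prems Suc.prems[THEN Ck_on_Suc_imp]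
    by (intro Ck_on_add[OF assms(1)] Suc.IH) (simp_all add: Ck_on_Suc_pd)
  ultimately show ?case using Suc.prems differentiable_bilinear[OF assms(2)] by (auto simp: Ck_on_Suc_pd)
qed

lemma Ck_on_inverse:
  fixes f :: "complex \<Rightarrow> real"
  assumes "open U" "\<And>q. q \<in> U \<Longrightarrow> f q \<noteq> 0"
  shows "Ck_on k U f \<Longrightarrow> Ck_on k U (\<lambda>q. inverse (f q))"
proof (induction k)
  case 0 then show ?case using assms by (auto intro: continuous_intros)
next
  case (Suc k)
  have inv: "Ck_on k U (\<lambda>q. inverse (f q))" using Suc Ck_on_Suc_imp by blast
  have "Ck_on k U (pd v (\<lambda>q. inverse (f q))) = Ck_on k U (\<lambda>q. - (pd v f q * (inverse (f q) * inverse (f q))))" for v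
    by (rule Ck_on_cong[OF assms(1)]) (use Suc.prems assms in \<open>auto simp: pd_inverse Ck_on_Suc_pd\<close>)
  moreover have "Ck_on k U (\<lambda>q. - (pd v f q * (inverse (f q) * inverse (f q))))" for v
    using Suc.prems inv
    by (intro Ck_on_linear[OF assms(1) bounded_linear_minus[OF bounded_linear_ident]]
          Ck_on_bilinear[OF assms(1) bounded_bilinear_mult]) (auto simp: Ck_on_Suc_pd)
  ultimately show ?case using Suc.prems assms by (auto simp: Ck_on_Suc_pd)
qed

lemma smooth_on_cong: "open U \<Longrightarrow> (\<And>q. q \<in> U \<Longrightarrow> f q = g q) \<Longrightarrow> smooth_on U f \<longleftrightarrow> smooth_on U g"
  unfolding smooth_on_def using Ck_on_cong by blast

lemma smooth_on_subset: "smooth_on U f \<Longrightarrow> W \<subseteq> U \<Longrightarrow> smooth_on W f"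
  unfolding smooth_on_def using Ck_on_subset by blast

lemma smooth_on_local:
  assumes "\<And>p. p \<in> U \<Longrightarrow> \<exists>W. open W \<and> p \<in> W \<and> smooth_on W f"
  shows "smooth_on U f"
  unfolding smooth_on_def using assms by (meson Ck_on_local smooth_on_def)

lemma smooth_on_differentiable: "smooth_on U f \<Longrightarrow> p \<in> U \<Longrightarrow> f differentiable (at p)"
  unfolding smooth_on_def by (metis Ck_on_Suc_pd)

lemma smooth_on_pd: "smooth_on U f \<Longrightarrow> smooth_on U (pd v f)"
  unfolding smooth_on_def by (metis Ck_on_Suc_pd)

lemma smooth_on_isCont: "smooth_on U f \<Longrightarrow> p \<in> U \<Longrightarrow> isCont f p"
  using smooth_on_differentiable differentiable_imp_continuous_within by blast

lemma smooth_on_const: "smooth_on U (\<lambda>q. c)"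
  unfolding smooth_on_def using Ck_on_const by blast

lemma smooth_on_add: "open U \<Longrightarrow> smooth_on U f \<Longrightarrow> smooth_on U g \<Longrightarrow> smooth_on U (\<lambda>q. f q + g q)"
  unfolding smooth_on_def using Ck_on_add by blast

lemma smooth_on_linear:
  "open U \<Longrightarrow> bounded_linear L \<Longrightarrow> smooth_on U f \<Longrightarrow> smooth_on U (\<lambda>q. L (f q))"
  unfolding smooth_on_def using Ck_on_linear by blast

lemma smooth_on_bilinear:
  "open U \<Longrightarrow> bounded_bilinear B \<Longrightarrow> smooth_on U f \<Longrightarrow> smooth_on U g \<Longrightarrow> smooth_on U (\<lambda>q. B (f q) (g q))"
  unfolding smooth_on_def using Ck_on_bilinear by blast

lemma smooth_on_minus: "open U \<Longrightarrow> smooth_on U f \<Longrightarrow> smooth_on U (\<lambda>q. - f q)"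
  by (rule smooth_on_linear[OF _ bounded_linear_minus[OF bounded_linear_ident]])

lemma smooth_on_diff: "open U \<Longrightarrow> smooth_on U f \<Longrightarrow> smooth_on U g \<Longrightarrow> smooth_on U (\<lambda>q. f q - g q)"
  using smooth_on_add[of U f "\<lambda>q. - g q"] smooth_on_minus[of U g] by simp

lemma smooth_on_scaleR:
  "open U \<Longrightarrow> smooth_on U f \<Longrightarrow> smooth_on U g \<Longrightarrow> smooth_on U (\<lambda>q. f q *\<^sub>R g q)"
  by (rule smooth_on_bilinear[OF _ bounded_bilinear_scaleR])

lemma smooth_on_mult:
  fixes f :: "complex \<Rightarrow> real"
  shows "open U \<Longrightarrow> smooth_on U f \<Longrightarrow> smooth_on U g \<Longrightarrow> smooth_on U (\<lambda>q. f q * g q)"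
  by (rule smooth_on_bilinear[OF _ bounded_bilinear_mult])

lemma smooth_on_inverse:
  fixes f :: "complex \<Rightarrow> real"
  shows "open U \<Longrightarrow> (\<And>q. q \<in> U \<Longrightarrow> f q \<noteq> 0) \<Longrightarrow> smooth_on U f \<Longrightarrow> smooth_on U (\<lambda>q. inverse (f q))"
  unfolding smooth_on_def using Ck_on_inverse by blast

lemma smooth_on_sum:
  "open U \<Longrightarrow> (\<And>i. i \<in> I \<Longrightarrow> smooth_on U (f i)) \<Longrightarrow> smooth_on U (\<lambda>q. \<Sum>i\<in>I. f i q)"
  by (induction I rule: infinite_finite_induct) (auto intro: smooth_on_const smooth_on_add)

text \<open>The double difference is an increment of \<open>G\<close>, itself a difference of two
  translates of \<open>f\<close> along \<open>u\<close>. One mean value step in direction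
  \<open>u\<close> and one in direction \<open>v\<close> turn it into a mixed derivative. Its left
  side is symmetric in \<open>u\<close> and \<open>v\<close>, which is what the symmetry of second
  derivatives exploits.\<close>

lemma double_difference_mvt:
  fixes f :: "complex \<Rightarrow> real"
  assumes "t > 0"
    and in_U: "\<And>a b. a \<in> {0..t} \<Longrightarrow> b \<in> {0..t} \<Longrightarrow> p + of_real a * u + of_real b * v \<in> U"
    and df: "\<And>q. q \<in> U \<Longrightarrow> f differentiable (at q)"
    and df': "\<And>q. q \<in> U \<Longrightarrow> pd u f differentiable (at q)"
  obtains a b where "a \<in> {0..t}" "b \<in> {0..t}"
    "f (p + of_real t * u + of_real t * v) - f (p + of_real t * u) - f (p + of_real t * v) + f p
      = t * t * pd v (pd u f) (p + of_real a * u + of_real b * v)"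
proof -
  have lin: "pd (of_real c * w) g q = c * pd w g q"
    if "g differentiable (at q)" for g :: "complex \<Rightarrow> real" and q w c
    using linear_scale[OF linear_frechet_derivative[OF that], of c w]
    by (simp add: pd_def scaleR_conv_of_real)
  have line: "((\<lambda>x. g (q + of_real x * w)) has_real_derivative pd w g (q + of_real x * w)) (at x)"
    if g: "g differentiable (at (q + of_real x * w))" for g :: "complex \<Rightarrow> real" and q w x
  proof -
    have "((\<lambda>x. q + of_real x * w) has_derivative (\<lambda>h. of_real h * w)) (at x)"
      by (auto intro!: derivative_eq_intros)
    from has_derivative_compose[OF this pd_has_derivative[OF g]]
    have "((\<lambda>x. g (q + of_real x * w)) has_derivative (\<lambda>h. pd (of_real h * w) g (q + of_real x * w))) (at x)"
      by simp
    moreover have "(\<lambda>h. pd (of_real h * w) g (q + of_real x * w)) = (*) (pd w g (q + of_real x * w))"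
      using lin[OF g] by (simp add: fun_eq_iff mult.commute)
    ultimately show ?thesis unfolding has_field_derivative_def by simp
  qed
  define G where "G x = f (p + of_real t * v + of_real x * u) - f (p + of_real x * u)" for x
  have "\<exists>a. 0 < a \<and> a < t \<and> G t - G 0 = (t - 0) * (pd u f (p + of_real t * v + of_real a * u) - pd u f (p + of_real a * u))"
  proof (rule MVT2[OF \<open>t > 0\<close>])
    fix x assume x: "0 \<le> x" "x \<le> t"
    have "p + of_real t * v + of_real x * u \<in> U" "p + of_real x * u \<in> U"
      using in_U[of x t] in_U[of x 0] x by (auto simp: algebra_simps)
    then show "(G has_real_derivative pd u f (p + of_real t * v + of_real x * u) - pd u f (p + of_real x * u)) (at x)"
      unfolding G_def by (intro DERIV_diff line df)
  qed
  then obtain a where a: "0 < a" "a < t"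
    and Ga: "G t - G 0 = t * (pd u f (p + of_real t * v + of_real a * u) - pd u f (p + of_real a * u))" by auto
  define H where "H x = pd u f (p + of_real a * u + of_real x * v)" for x
  have "\<exists>b. 0 < b \<and> b < t \<and> H t - H 0 = (t - 0) * pd v (pd u f) (p + of_real a * u + of_real b * v)"
  proof (rule MVT2[OF \<open>t > 0\<close>])
    fix x assume x: "0 \<le> x" "x \<le> t"
    show "(H has_real_derivative pd v (pd u f) (p + of_real a * u + of_real x * v)) (at x)"
      unfolding H_def by (rule line, rule df', rule in_U) (use a x in auto)
  qed
  then obtain b where b: "0 < b" "b < t"
    and Hb: "H t - H 0 = t * pd v (pd u f) (p + of_real a * u + of_real b * v)" by auto
  have "G t - G 0 = t * (H t - H 0)"
    unfolding Ga H_def by (simp add: algebra_simps)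
  then have "G t - G 0 = t * t * pd v (pd u f) (p + of_real a * u + of_real b * v)"
    using Hb by simp
  then show ?thesis using that[of a b] a b by (simp add: G_def algebra_simps)
qed

text \<open>The symmetric double difference makes the two mixed derivatives equal at two points
  arbitrarily close to \<open>p\<close>; by continuity they cannot then differ at
  \<open>p\<close>.\<close>

lemma pd_commute_real:
  fixes f :: "complex \<Rightarrow> real"
  assumes "open U" "p \<in> U" and f: "smooth_on U f"
  shows "pd v (pd u f) p = pd u (pd v f) p"
proof (rule ccontr)
  let ?g = "pd v (pd u f)" and ?h = "pd u (pd v f)"
  assume ne: "?g p \<noteq> ?h p"
  define e where "e = \<bar>?g p - ?h p\<bar> / 2"
  have e: "e > 0" using ne by (simp add: e_def)
  have sm: "smooth_on U ?g" "smooth_on U ?h" using f by (auto intro: smooth_on_pd)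
  obtain d1 where d1: "d1 > 0" "\<And>q. dist q p < d1 \<Longrightarrow> dist (?g q) (?g p) < e"
    using smooth_on_isCont[OF sm(1) \<open>p \<in> U\<close>] e unfolding continuous_at_eps_delta by blast
  obtain d2 where d2: "d2 > 0" "\<And>q. dist q p < d2 \<Longrightarrow> dist (?h q) (?h p) < e"
    using smooth_on_isCont[OF sm(2) \<open>p \<in> U\<close>] e unfolding continuous_at_eps_delta by blast
  obtain d3 where d3: "d3 > 0" "\<And>q. dist q p < d3 \<Longrightarrow> q \<in> U"
    using assms(1,2) unfolding open_dist by blast
  define d where "d = min d1 (min d2 d3)"
  \<comment> \<open>With this \<open>N\<close> the parallelogram spanned by \<open>t * u\<close> and
    \<open>t * v\<close> stays within distance \<open>d\<close> of \<open>p\<close>; the summand 1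
    keeps the divisor positive when both directions vanish.\<close>
  define N where "N = norm u + norm v + 1"
  define t where "t = d / (2 * N)"
  have N: "N \<ge> 1" by (simp add: N_def)
  have d: "d > 0" using d1 d2 d3 by (simp add: d_def)
  have t: "t > 0" using N d by (simp add: t_def)
  have near: "dist (p + of_real a * u + of_real b * v) p < d"
    if "a \<in> {0..t}" "b \<in> {0..t}" for a b
  proof -
    have "dist (p + of_real a * u + of_real b * v) p = norm (of_real a * u + of_real b * v)"
      by (simp add: dist_norm algebra_simps)
    also have "\<dots> \<le> a * norm u + b * norm v"
      using norm_triangle_ineq[of "of_real a * u" "of_real b * v"] that by (simp add: norm_mult)
    also have "\<dots> \<le> t * norm u + t * norm v"
      using that by (intro add_mono mult_right_mono) auto
    also have "\<dots> \<le> t * N" using t by (simp add: N_def algebra_simps)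
    also have "\<dots> < d" using N d by (simp add: t_def)
    finally show ?thesis .
  qed
  obtain a b where ab: "a \<in> {0..t}" "b \<in> {0..t}"
    "f (p + of_real t * u + of_real t * v) - f (p + of_real t * u) - f (p + of_real t * v) + f p
      = t * t * ?g (p + of_real a * u + of_real b * v)"
    by (rule double_difference_mvt[OF t, of p u v U f])
      (use near d3 smooth_on_differentiable[OF f] smooth_on_differentiable[OF smooth_on_pd[OF f]]
        in \<open>auto simp: d_def\<close>)
  have near': "p + of_real a * v + of_real b * u \<in> U" if "a \<in> {0..t}" "b \<in> {0..t}" for a b
    using near[OF that(2,1)] d3(2)[of "p + of_real a * v + of_real b * u"]
    by (simp add: d_def add.commute add.left_commute add.assoc)
  obtain a' b' where ab': "a' \<in> {0..t}" "b' \<in> {0..t}"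
    "f (p + of_real t * v + of_real t * u) - f (p + of_real t * v) - f (p + of_real t * u) + f p
      = t * t * ?h (p + of_real a' * v + of_real b' * u)"
    by (rule double_difference_mvt[OF t, of p v u U f])
      (use near' smooth_on_differentiable[OF f] smooth_on_differentiable[OF smooth_on_pd[OF f]] in blast)+
  have "t * t * ?g (p + of_real a * u + of_real b * v) = t * t * ?h (p + of_real a' * v + of_real b' * u)"
    using ab(3) ab'(3) by (simp add: algebra_simps)
  then have eq: "?g (p + of_real a * u + of_real b * v) = ?h (p + of_real b' * u + of_real a' * v)"
    using t by (simp add: algebra_simps)
  have "dist (?g (p + of_real a * u + of_real b * v)) (?g p) < e"
    using near[OF ab(1,2)] d1(2) by (simp add: d_def)
  moreover have "dist (?h (p + of_real b' * u + of_real a' * v)) (?h p) < e"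
    using near[OF ab'(2,1)] d2(2) by (simp add: d_def)
  ultimately have "\<bar>?g p - ?h p\<bar> < 2 * e"
    using eq by (simp add: dist_real_def)
  then show False by (simp add: e_def)
qed

lemma pd_commute:
  fixes f :: "complex \<Rightarrow> real ^ 'm::finite"
  assumes "open U" "p \<in> U" and f: "smooth_on U f"
  shows "pd v (pd u f) p = pd u (pd v f) p"
proof -
  have "pd v (pd u f) p $ i = pd u (pd v f) p $ i" for i
  proof -
    have bl: "bounded_linear (\<lambda>x::real^'m. x $ i)" by (rule bounded_linear_vec_nth)
    have two: "pd w (pd w' (\<lambda>q. f q $ i)) p = pd w (pd w' f) p $ i" for w w'
    proof -
      have "pd w (pd w' (\<lambda>q. f q $ i)) p = pd w (\<lambda>q. pd w' f q $ i) p"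
        by (rule pd_cong_open[OF assms(1,2)]) (rule pd_linear[OF bl smooth_on_differentiable[OF f]])
      also have "\<dots> = pd w (pd w' f) p $ i"
        by (rule pd_linear[OF bl smooth_on_differentiable[OF smooth_on_pd[OF f] assms(2)]])
      finally show ?thesis .
    qed
    show ?thesis using pd_commute_real[OF assms(1,2) smooth_on_linear[OF assms(1) bl f], of v u]
      by (simp add: two)
  qed
  then show ?thesis by (simp add: vec_eq_iff)
qed

section \<open>Lifts of spacelike surfaces in real coordinates\<close>

lemma sprod_real: "sprod \<epsilon> (u::real^'m::finite) v = (\<Sum>i\<in>UNIV. \<epsilon> i * u $ i * v $ i)"
  by (simp add: sprod_def)

lemma bounded_bilinear_sprod: "bounded_bilinear (sprod \<epsilon> :: real^'m::finite \<Rightarrow> real^'m \<Rightarrow> real)"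
proof -
  have "linear (\<lambda>u::real^'m. (\<chi> i. \<epsilon> i * u $ i) :: real^'m)"
    by (auto intro!: linearI simp: vec_eq_iff algebra_simps)
  then have "bounded_linear (\<lambda>u::real^'m. (\<chi> i. \<epsilon> i * u $ i) :: real^'m)"
    by (simp add: linear_conv_bounded_linear)
  from bounded_bilinear.comp1[OF bounded_bilinear_inner this]
  have "bounded_bilinear (\<lambda>u v::real^'m. (\<chi> i. \<epsilon> i * u $ i) \<bullet> v)" .
  moreover have "(\<lambda>u v::real^'m. (\<chi> i. \<epsilon> i * u $ i) \<bullet> v) = sprod \<epsilon>"
    by (simp add: fun_eq_iff inner_vec_def sprod_real)
  ultimately show ?thesis by simp
qed

lemma sprod_commute: "sprod \<epsilon> (u::real^'m::finite) v = sprod \<epsilon> v u"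
  by (simp add: sprod_real mult_ac)

lemma sprod_simps [simp]:
  fixes u v w :: "real^'m::finite"
  shows "sprod \<epsilon> (u + v) w = sprod \<epsilon> u w + sprod \<epsilon> v w"
    and "sprod \<epsilon> u (v + w) = sprod \<epsilon> u v + sprod \<epsilon> u w"
    and "sprod \<epsilon> (u - v) w = sprod \<epsilon> u w - sprod \<epsilon> v w"
    and "sprod \<epsilon> u (v - w) = sprod \<epsilon> u v - sprod \<epsilon> u w"
    and "sprod \<epsilon> (- u) w = - sprod \<epsilon> u w"
    and "sprod \<epsilon> u (- w) = - sprod \<epsilon> u w"
    and "sprod \<epsilon> (a *\<^sub>R u) w = a * sprod \<epsilon> u w"
    and "sprod \<epsilon> u (a *\<^sub>R w) = a * sprod \<epsilon> u w"
    and "sprod \<epsilon> 0 w = 0"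
    and "sprod \<epsilon> u 0 = 0"
  by (simp_all add: sprod_real sum.distrib sum_subtractf sum_distrib_left sum_negf algebra_simps)

lemma sprod_nondegenerate:
  fixes u :: "real^'m::finite"
  assumes "\<And>i. \<epsilon> i \<noteq> 0" "\<And>v. sprod \<epsilon> u v = 0"
  shows "u = 0"
proof -
  have "u $ i = 0" for i
  proof -
    have "sprod \<epsilon> u (axis i 1) = \<epsilon> i * u $ i"
      unfolding sprod_real by (subst sum.remove[of _ i]) (auto simp: axis_def)
    then show ?thesis using assms by simp
  qed
  then show ?thesis by (simp add: vec_eq_iff)
qed

lemma pd_sprod:
  fixes f g :: "complex \<Rightarrow> real^'m::finite"
  assumes "smooth_on U f" "smooth_on U g" "p \<in> U"
  shows "pd v (\<lambda>q. sprod \<epsilon> (f q) (g q)) p = sprod \<epsilon> (f p) (pd v g p) + sprod \<epsilon> (pd v f p) (g p)"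
  using pd_bilinear[OF bounded_bilinear_sprod] smooth_on_differentiable assms by blast

lemma smooth_on_sprod:
  fixes f g :: "complex \<Rightarrow> real^'m::finite"
  shows "open U \<Longrightarrow> smooth_on U f \<Longrightarrow> smooth_on U g \<Longrightarrow> smooth_on U (\<lambda>q. sprod \<epsilon> (f q) (g q))"
  by (rule smooth_on_bilinear[OF _ bounded_bilinear_sprod])

lemma sprod_const_pd:
  fixes f g :: "complex \<Rightarrow> real^'m::finite"
  assumes "open U" "smooth_on U f" "smooth_on U g" "p \<in> U" "\<And>q. q \<in> U \<Longrightarrow> sprod \<epsilon> (f q) (g q) = c"
  shows "sprod \<epsilon> (f p) (pd v g p) = - sprod \<epsilon> (pd v f p) (g p)"
proof -
  have "pd v (\<lambda>q. sprod \<epsilon> (f q) (g q)) p = pd v (\<lambda>q. c) p"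
    by (rule pd_cong_open[OF assms(1,4,5)])
  then show ?thesis using pd_sprod[OF assms(2-4)] by (simp add: add_eq_0_iff)
qed

lemmas smooth_intros = smooth_on_pd smooth_on_const smooth_on_add smooth_on_diff smooth_on_minus
  smooth_on_scaleR smooth_on_mult smooth_on_sprod

section \<open>Complex vectors and Wirtinger derivatives in real and imaginary parts\<close>

lemma re_vec_simps [simp]:
  "re_vec (cvec x) = x" "im_vec (cvec x) = 0"
  "re_vec (c *s u) = Re c *\<^sub>R re_vec u - Im c *\<^sub>R im_vec u"
  "im_vec (c *s u) = Re c *\<^sub>R im_vec u + Im c *\<^sub>R re_vec u"
  "re_vec (u + v) = re_vec u + re_vec v" "im_vec (u + v) = im_vec u + im_vec v"
  "re_vec (u - v) = re_vec u - re_vec v" "im_vec (u - v) = im_vec u - im_vec v"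
  "re_vec 0 = 0" "im_vec 0 = 0"
  by (simp_all add: re_vec_def im_vec_def cvec_def vec_eq_iff)

lemma cvec_simps [simp]: "cvec (x + y) = cvec x + cvec y" "cvec (x - y) = cvec x - cvec y" "cvec 0 = 0"
  "cvec (- x) = - cvec x"
  by (simp_all add: cvec_def vec_eq_iff)

lemma complex_vec_eq_iff: "u = v \<longleftrightarrow> re_vec u = re_vec v \<and> im_vec u = im_vec v"
  by (auto simp: re_vec_def im_vec_def vec_eq_iff complex_eq_iff)

lemma complex_vec_decompose: "u = cvec (re_vec u) + \<i> *s cvec (im_vec u)"
  by (simp add: complex_vec_eq_iff)

lemma bounded_linear_cvec: "bounded_linear (cvec :: real^'m::finite \<Rightarrow> complex^'m)"
  unfolding linear_conv_bounded_linear[symmetric]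
  by (auto intro!: linearI simp: cvec_def vec_eq_iff complex_eq_iff)

lemma bounded_linear_re_vec: "bounded_linear (re_vec :: complex^'m::finite \<Rightarrow> real^'m)"
  unfolding linear_conv_bounded_linear[symmetric]
  by (auto intro!: linearI simp: re_vec_def vec_eq_iff)

lemma bounded_linear_im_vec: "bounded_linear (im_vec :: complex^'m::finite \<Rightarrow> real^'m)"
  unfolding linear_conv_bounded_linear[symmetric]
  by (auto intro!: linearI simp: im_vec_def vec_eq_iff)

lemma bounded_linear_ii: "bounded_linear (\<lambda>u::complex^'m::finite. \<i> *s u)"
  unfolding linear_conv_bounded_linear[symmetric]
  by (auto intro!: linearI simp: vec_eq_iff algebra_simps)

lemma sprod_cvec:
  "sprod \<epsilon> u (cvec v) = complex_of_real (sprod \<epsilon> (re_vec u) v) + \<i> * complex_of_real (sprod \<epsilon> (im_vec u) v)"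
  by (simp add: complex_eq_iff sprod_def re_vec_def im_vec_def cvec_def)

lemma dz_parts:
  assumes "F differentiable (at p)"
  shows "re_vec (dz F p) = (1/2) *\<^sub>R (pd 1 (\<lambda>q. re_vec (F q)) p + pd \<i> (\<lambda>q. im_vec (F q)) p)"
    and "im_vec (dz F p) = (1/2) *\<^sub>R (pd 1 (\<lambda>q. im_vec (F q)) p - pd \<i> (\<lambda>q. re_vec (F q)) p)"
    and "re_vec (dzbar F p) = (1/2) *\<^sub>R (pd 1 (\<lambda>q. re_vec (F q)) p - pd \<i> (\<lambda>q. im_vec (F q)) p)"
    and "im_vec (dzbar F p) = (1/2) *\<^sub>R (pd 1 (\<lambda>q. im_vec (F q)) p + pd \<i> (\<lambda>q. re_vec (F q)) p)"
  using assms
  by (simp_all add: dz_def dzbar_def pd_linear[OF bounded_linear_re_vec] pd_linear[OF bounded_linear_im_vec] 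
      pd_def[symmetric] scaleR_add_right scaleR_diff_right)

lemma dz_cvec:
  assumes "f differentiable (at p)"
  shows "re_vec (dz (\<lambda>q. cvec (f q)) p) = (1/2) *\<^sub>R pd 1 f p"
    and "im_vec (dz (\<lambda>q. cvec (f q)) p) = - (1/2) *\<^sub>R pd \<i> f p"
  using dz_parts[OF differentiable_linear[OF bounded_linear_cvec assms]] by simp_all

lemma pd_scaleR_const:
  assumes "f differentiable (at p)"
  shows "pd v (\<lambda>q. c *\<^sub>R f q) p = c *\<^sub>R pd v f p"
  by (rule pd_linear[OF bounded_linear_scaleR_right assms])

text \<open>Symmetry of the mixed derivatives merges the two mixed terms of the second
  \<open>dz\<close> into one.\<close>

lemma dz_dz_cvec:
  fixes f :: "complex \<Rightarrow> real^'m::finite"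
  assumes U: "open U" "p \<in> U" and f: "smooth_on U f"
  shows "re_vec (dz (dz (\<lambda>q. cvec (f q))) p) = (1/4) *\<^sub>R (pd 1 (pd 1 f) p - pd \<i> (pd \<i> f) p)"
    and "im_vec (dz (dz (\<lambda>q. cvec (f q))) p) = - (1/2) *\<^sub>R pd \<i> (pd 1 f) p"
    and "re_vec (dzbar (dz (\<lambda>q. cvec (f q))) p) = (1/4) *\<^sub>R (pd 1 (pd 1 f) p + pd \<i> (pd \<i> f) p)"
proof -
  let ?F = "dz (\<lambda>q. cvec (f q))"
  have re: "re_vec (?F q) = (1/2) *\<^sub>R pd 1 f q" and im: "im_vec (?F q) = (-(1/2)) *\<^sub>R pd \<i> f q" if "q \<in> U" for q
    using dz_cvec smooth_on_differentiable[OF f that] by auto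
  have d: "pd v f differentiable (at p)" for v
    using smooth_on_differentiable smooth_on_pd f U by blast
  \<comment> \<open>Differentiability of \<open>dz\<close> is read off from its expression through
    the smooth maps \<open>pd 1 f\<close> and \<open>pd \<i> f\<close>, valid on all of
    \<open>U\<close>.\<close>
  have "(\<lambda>q. cvec ((1/2) *\<^sub>R pd 1 f q) + \<i> *s cvec ((-(1/2)) *\<^sub>R pd \<i> f q)) differentiable (at p)"
    using d by (intro differentiable_add differentiable_linear[OF bounded_linear_ii]
      differentiable_linear[OF bounded_linear_cvec] differentiable_linear[OF bounded_linear_scaleR_right])
  moreover have "?F q = cvec ((1/2) *\<^sub>R pd 1 f q) + \<i> *s cvec ((-(1/2)) *\<^sub>R pd \<i> f q)" if "q \<in> U" for q
    using complex_vec_decompose[of "?F q"] re im that by simp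
  ultimately have dF: "?F differentiable (at p)"
    using differentiable_cong_open[OF U, of ?F "\<lambda>q. cvec ((1/2) *\<^sub>R pd 1 f q) + \<i> *s cvec ((-(1/2)) *\<^sub>R pd \<i> f q)"]
    by blast
  have pre: "pd v (\<lambda>q. re_vec (?F q)) p = (1/2) *\<^sub>R pd v (pd 1 f) p" for v
    by (rule trans[OF pd_cong_open[OF U re] pd_scaleR_const[OF d]])
  have pim: "pd v (\<lambda>q. im_vec (?F q)) p = (-(1/2)) *\<^sub>R pd v (pd \<i> f) p" for v
    by (rule trans[OF pd_cong_open[OF U im] pd_scaleR_const[OF d]])
  have comm: "pd 1 (pd \<i> f) p = pd \<i> (pd 1 f) p" by (rule pd_commute[OF U f])
  show "re_vec (dz ?F p) = (1/4) *\<^sub>R (pd 1 (pd 1 f) p - pd \<i> (pd \<i> f) p)"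
    "im_vec (dz ?F p) = - (1/2) *\<^sub>R pd \<i> (pd 1 f) p"
    "re_vec (dzbar ?F p) = (1/4) *\<^sub>R (pd 1 (pd 1 f) p + pd \<i> (pd \<i> f) p)"
    unfolding dz_parts[OF dF] pre pim comm by (simp_all add: vec_eq_iff)
qed

lemma pd_add_direction:
  assumes "f differentiable (at p)"
  shows "pd (v + w) f p = pd v f p + pd w f p"
  unfolding pd_def by (rule linear_add[OF linear_frechet_derivative[OF assms]])

lemma pd_scaleR_direction:
  assumes "f differentiable (at p)"
  shows "pd (c *\<^sub>R v) f p = c *\<^sub>R pd v f p"
  unfolding pd_def by (rule linear_scale[OF linear_frechet_derivative[OF assms]])

text \<open>A canonical lift detached from the surface that it lifts, so that the same frame
  computations serve \<open>Y\<close>, \<open>Y'\<close>, the lift \<open>\<Psi>\<close> of a polar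
  surface, and the lifts embedded into a larger space.\<close>

locale conformal_lift =
  fixes \<epsilon> :: "'m::finite \<Rightarrow> real" and U :: "complex set" and Y :: "complex \<Rightarrow> real^'m"
  assumes open_U [intro, simp]: "open U"
    and smooth_Y [intro, simp]: "smooth_on U Y"
    and Y_nonzero: "p \<in> U \<Longrightarrow> Y p \<noteq> 0"
    and Y_null: "p \<in> U \<Longrightarrow> sprod \<epsilon> (Y p) (Y p) = 0"
    and Y_conformal: "p \<in> U \<Longrightarrow> sprod \<epsilon> (pd v Y p) (pd v Y p) = (norm v)\<^sup>2"
begin

text \<open>
  \<open>L\<close> is the (real) vector \<open>Y\<^bsub>z zbar\<^esub>\<close>, \<open>N\<close> the null vector with \<open>\<langle>N, Y\<rangle> = -1\<close> that completes the
  frame, \<open>\<kappa>\<close> the real part of the Hopf differential and \<open>s1 + \<i> s2\<close> the Schwarzian.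
\<close>

definition L :: "complex \<Rightarrow> real^'m" where
  "L p = (1/4) *\<^sub>R (pd 1 (pd 1 Y) p + pd \<i> (pd \<i> Y) p)"

definition \<kappa> :: "complex \<Rightarrow> real^'m" where
  "\<kappa> p = (1/4) *\<^sub>R (pd 1 (pd 1 Y) p - pd \<i> (pd \<i> Y) p)
     + (sprod \<epsilon> (pd 1 (pd 1 Y) p - pd \<i> (pd \<i> Y) p) (L p) / 2) *\<^sub>R Y p"

definition N :: "complex \<Rightarrow> real^'m" where
  "N p = 2 *\<^sub>R (L p + sprod \<epsilon> (L p) (L p) *\<^sub>R Y p)"

text \<open>The pair \<open>Y\<close>, \<open>N\<close> is null with product -1, so its components
  are removed crosswise and with a plus sign; the two derivatives of \<open>Y\<close> form an
  orthonormal pair. The closed formula replaces a definite description and makes smoothness in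
  \<open>p\<close> evident.\<close>

definition nproj :: "complex \<Rightarrow> real^'m \<Rightarrow> real^'m" where
  "nproj p x = x + sprod \<epsilon> x (N p) *\<^sub>R Y p + sprod \<epsilon> x (Y p) *\<^sub>R N p
     - sprod \<epsilon> x (pd 1 Y p) *\<^sub>R pd 1 Y p - sprod \<epsilon> x (pd \<i> Y p) *\<^sub>R pd \<i> Y p"

lemma smooth_frame [intro, simp]: "smooth_on U (pd v Y)" "smooth_on U (pd w (pd v Y))" 
   "smooth_on U L" "smooth_on U N" "smooth_on U \<kappa>"
  unfolding N_def[abs_def] L_def[abs_def] \<kappa>_def[abs_def] divide_inverse by (intro smooth_intros open_U smooth_Y)+

lemma smooth_nproj: "W \<subseteq> U \<Longrightarrow> open W \<Longrightarrow> smooth_on W x \<Longrightarrow> smooth_on W (\<lambda>p. nproj p (x p))"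
  unfolding nproj_def by (intro smooth_intros smooth_on_subset[OF smooth_frame(1)]
     smooth_on_subset[OF smooth_frame(4)] smooth_on_subset[OF smooth_Y]) auto

lemma sprod_const_pdU:
  fixes f g :: "complex \<Rightarrow> real^'m"
  assumes "smooth_on U f" "smooth_on U g" "\<And>q. q \<in> U \<Longrightarrow> sprod \<epsilon> (f q) (g q) = c" "p \<in> U"
  shows "sprod \<epsilon> (f p) (pd v g p) = - sprod \<epsilon> (pd v f p) (g p)"
  using sprod_const_pd[OF open_U assms(1,2,4,3)] .

lemma Y_pd: "p \<in> U \<Longrightarrow> sprod \<epsilon> (Y p) (pd v Y p) = 0"
  using sprod_const_pdU[OF smooth_Y smooth_Y Y_null, of p v] by (simp add: sprod_commute)

text \<open>Polarisation: the squared norms of \<open>1\<close>, \<open>\<i>\<close> and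
  \<open>1 + \<i>\<close> are 1, 1 and 2.\<close>

lemma Y1_Y2: assumes "p \<in> U" shows "sprod \<epsilon> (pd 1 Y p) (pd \<i> Y p) = 0"
proof -
  have "pd (1 + \<i>) Y p = pd 1 Y p + pd \<i> Y p"
    using pd_add_direction smooth_on_differentiable[OF smooth_Y assms] by blast
  then show ?thesis
    using Y_conformal[OF assms, of 1] Y_conformal[OF assms, of \<i>] Y_conformal[OF assms, of "1 + \<i>"]
      sprod_commute[of \<epsilon> "pd 1 Y p" "pd \<i> Y p"]
    by (simp add: cmod_power2)
qed

lemma Y12_commute: "p \<in> U \<Longrightarrow> pd 1 (pd \<i> Y) p = pd \<i> (pd 1 Y) p"
  by (rule pd_commute[OF open_U _ smooth_Y])

lemma gram:
  assumes p: "p \<in> U"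
  shows "sprod \<epsilon> (Y p) (Y p) = 0" "sprod \<epsilon> (Y p) (pd 1 Y p) = 0" "sprod \<epsilon> (Y p) (pd \<i> Y p) = 0"
    "sprod \<epsilon> (pd 1 Y p) (Y p) = 0" "sprod \<epsilon> (pd \<i> Y p) (Y p) = 0"
    "sprod \<epsilon> (pd 1 Y p) (pd 1 Y p) = 1" "sprod \<epsilon> (pd \<i> Y p) (pd \<i> Y p) = 1"
    "sprod \<epsilon> (pd 1 Y p) (pd \<i> Y p) = 0" "sprod \<epsilon> (pd \<i> Y p) (pd 1 Y p) = 0"
  using p Y_null[OF p] Y_pd[OF p] Y_conformal[OF p, of 1] Y_conformal[OF p, of \<i>] Y1_Y2[OF p]
  by (simp_all add: sprod_commute)

text \<open>Each entry comes from differentiating a constant entry of \<open>gram\<close>; the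
  symmetry of the mixed derivative carries values from one entry to the next.\<close>

lemma gram2:
  assumes p: "p \<in> U"
  shows "sprod \<epsilon> (Y p) (pd 1 (pd 1 Y) p) = -1" "sprod \<epsilon> (Y p) (pd \<i> (pd \<i> Y) p) = -1"
    "sprod \<epsilon> (Y p) (pd \<i> (pd 1 Y) p) = 0"
    "sprod \<epsilon> (pd 1 Y p) (pd 1 (pd 1 Y) p) = 0" "sprod \<epsilon> (pd \<i> Y p) (pd 1 (pd 1 Y) p) = 0"
    "sprod \<epsilon> (pd 1 Y p) (pd \<i> (pd \<i> Y) p) = 0" "sprod \<epsilon> (pd \<i> Y p) (pd \<i> (pd \<i> Y) p) = 0"
    "sprod \<epsilon> (pd 1 Y p) (pd \<i> (pd 1 Y) p) = 0" "sprod \<epsilon> (pd \<i> Y p) (pd \<i> (pd 1 Y) p) = 0"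
proof -
  note G = gram
  show "sprod \<epsilon> (Y p) (pd 1 (pd 1 Y) p) = -1" "sprod \<epsilon> (Y p) (pd \<i> (pd \<i> Y) p) = -1"
    "sprod \<epsilon> (Y p) (pd \<i> (pd 1 Y) p) = 0"
    using sprod_const_pdU[OF smooth_Y smooth_frame(1)[of 1] G(2) p, of 1]
      sprod_const_pdU[OF smooth_Y smooth_frame(1)[of \<i>] G(3) p, of \<i>]
      sprod_const_pdU[OF smooth_Y smooth_frame(1)[of 1] G(2) p, of \<i>] G[OF p] by auto
  show a: "sprod \<epsilon> (pd 1 Y p) (pd 1 (pd 1 Y) p) = 0" and b: "sprod \<epsilon> (pd \<i> Y p) (pd \<i> (pd \<i> Y) p) = 0"
    and c: "sprod \<epsilon> (pd 1 Y p) (pd \<i> (pd 1 Y) p) = 0"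
    using sprod_const_pdU[OF smooth_frame(1)[of 1] smooth_frame(1)[of 1] G(6) p, of 1]
       sprod_const_pdU[OF smooth_frame(1)[of 1] smooth_frame(1)[of 1] G(6) p, of \<i>]
       sprod_const_pdU[OF smooth_frame(1)[of \<i>] smooth_frame(1)[of \<i>] G(7) p, of \<i>]
       sprod_commute[of \<epsilon> "pd 1 (pd 1 Y) p" "pd 1 Y p"]
       sprod_commute[of \<epsilon> "pd \<i> (pd 1 Y) p" "pd 1 Y p"]
       sprod_commute[of \<epsilon> "pd \<i> (pd \<i> Y) p" "pd \<i> Y p"] by simp_all
  show d: "sprod \<epsilon> (pd \<i> Y p) (pd \<i> (pd 1 Y) p) = 0"
    using sprod_const_pdU[OF smooth_frame(1)[of \<i>] smooth_frame(1)[of \<i>] G(7) p, of 1]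
      sprod_commute[of \<epsilon> "pd \<i> (pd 1 Y) p" "pd \<i> Y p"] Y12_commute[OF p] by simp
  show "sprod \<epsilon> (pd \<i> Y p) (pd 1 (pd 1 Y) p) = 0"
    using sprod_const_pdU[OF smooth_frame(1)[of 1] smooth_frame(1)[of \<i>] G(8) p, of 1] c Y12_commute[OF p]
      sprod_commute[of \<epsilon> "pd 1 (pd 1 Y) p" "pd \<i> Y p"] by simp
  show "sprod \<epsilon> (pd 1 Y p) (pd \<i> (pd \<i> Y) p) = 0"
    using sprod_const_pdU[OF smooth_frame(1)[of 1] smooth_frame(1)[of \<i>] G(8) p, of \<i>] d 
      sprod_commute[of \<epsilon> "pd \<i> (pd 1 Y) p" "pd \<i> Y p"] by simp
qed

lemma gram_L:
  assumes p: "p \<in> U"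
  shows "sprod \<epsilon> (Y p) (L p) = -(1/2)" "sprod \<epsilon> (pd 1 Y p) (L p) = 0" "sprod \<epsilon> (pd \<i> Y p) (L p) = 0"
    "sprod \<epsilon> (L p) (Y p) = -(1/2)" "sprod \<epsilon> (L p) (pd 1 Y p) = 0" "sprod \<epsilon> (L p) (pd \<i> Y p) = 0"
  using gram2[OF p] by (simp_all add: L_def sprod_commute)

text \<open>As \<open>L\<close> has product -1/2 with \<open>Y\<close>, the multiple of
  \<open>Y\<close> inside \<open>N\<close> cancels the square of \<open>L\<close>, and the factor 2
  brings the product with \<open>Y\<close> to -1.\<close>

lemma gram_N:
  assumes p: "p \<in> U"
  shows "sprod \<epsilon> (Y p) (N p) = -1" "sprod \<epsilon> (pd 1 Y p) (N p) = 0" "sprod \<epsilon> (pd \<i> Y p) (N p) = 0"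
    "sprod \<epsilon> (N p) (Y p) = -1" "sprod \<epsilon> (N p) (pd 1 Y p) = 0" "sprod \<epsilon> (N p) (pd \<i> Y p) = 0"
    "sprod \<epsilon> (N p) (N p) = 0"
  using gram_L[OF p] gram[OF p] by (simp_all add: N_def algebra_simps)

lemma tangent_space_eq: assumes p: "p \<in> U"
  shows "tangent_space Y p = span {Y p, pd 1 Y p, pd \<i> Y p, L p}"
proof -
  have "tangent_space Y p = span {Y p, (1/2) *\<^sub>R pd 1 Y p, (-(1/2)) *\<^sub>R pd \<i> Y p, L p}"
    unfolding tangent_space_def Let_def dz_dz_cvec[OF open_U p smooth_Y]
      dz_cvec[OF smooth_on_differentiable[OF smooth_Y p]] L_def by simp
  also have "\<dots> = span {Y p, pd 1 Y p, pd \<i> Y p, L p}" (is "span ?A = span ?B")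
  proof (rule span_eq[THEN iffD2], safe)
    have "2 *\<^sub>R ((1/2) *\<^sub>R pd 1 Y p) \<in> span ?A" "(-2) *\<^sub>R ((-(1/2)) *\<^sub>R pd \<i> Y p) \<in> span ?A"
      by (intro span_mul span_base; simp)+
    then show "pd 1 Y p \<in> span ?A" "pd \<i> Y p \<in> span ?A" by simp_all
  qed (auto intro: span_base span_mul span_neg)
  finally show ?thesis .
qed

lemma normal_space_iff: assumes p: "p \<in> U"
  shows "v \<in> normal_space \<epsilon> Y p \<longleftrightarrow>
    sprod \<epsilon> v (Y p) = 0 \<and> sprod \<epsilon> v (pd 1 Y p) = 0 \<and> sprod \<epsilon> v (pd \<i> Y p) = 0 \<and> sprod \<epsilon> v (L p) = 0"
proof -
  have sub: "subspace {u. sprod \<epsilon> v u = 0}"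
    by (auto intro!: subspaceI)
  have "v \<in> normal_space \<epsilon> Y p \<longleftrightarrow> span {Y p, pd 1 Y p, pd \<i> Y p, L p} \<subseteq> {u. sprod \<epsilon> v u = 0}"
    by (auto simp: normal_space_def tangent_space_eq[OF p])
  also have "\<dots> \<longleftrightarrow> {Y p, pd 1 Y p, pd \<i> Y p, L p} \<subseteq> {u. sprod \<epsilon> v u = 0}"
    using span_minimal[OF _ sub, of "{Y p, pd 1 Y p, pd \<i> Y p, L p}"]
      span_superset[of "{Y p, pd 1 Y p, pd \<i> Y p, L p}"] by (meson order_trans)
  finally show ?thesis by simp
qed

lemma normal_space_N: "p \<in> U \<Longrightarrow> v \<in> normal_space \<epsilon> Y p \<Longrightarrow> sprod \<epsilon> v (N p) = 0"
  by (simp add: normal_space_iff N_def)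

lemma N_in_tangent: "p \<in> U \<Longrightarrow> N p \<in> tangent_space Y p"
  unfolding N_def tangent_space_eq by (intro span_mul span_add span_base) auto

lemma nproj_normal: "p \<in> U \<Longrightarrow> nproj p x \<in> normal_space \<epsilon> Y p"
proof -
  assume p: "p \<in> U"
  have L: "L p = (1/2) *\<^sub>R N p - sprod \<epsilon> (L p) (L p) *\<^sub>R Y p" by (simp add: N_def)
  have 1: "sprod \<epsilon> (nproj p x) (Y p) = 0" "sprod \<epsilon> (nproj p x) (pd 1 Y p) = 0"
    "sprod \<epsilon> (nproj p x) (pd \<i> Y p) = 0" "sprod \<epsilon> (nproj p x) (N p) = 0"
    by (simp_all add: nproj_def gram[OF p] gram_N[OF p])
  then have "sprod \<epsilon> (nproj p x) (L p) = 0" by (subst L) simp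
  with 1 show ?thesis by (simp add: normal_space_iff[OF p])
qed

lemma nproj_tangent: "p \<in> U \<Longrightarrow> x - nproj p x \<in> tangent_space Y p"
proof -
  assume p: "p \<in> U"
  have "x - nproj p x = - (sprod \<epsilon> x (N p) *\<^sub>R Y p) - sprod \<epsilon> x (Y p) *\<^sub>R N p
     + sprod \<epsilon> x (pd 1 Y p) *\<^sub>R pd 1 Y p + sprod \<epsilon> x (pd \<i> Y p) *\<^sub>R pd \<i> Y p"
    by (simp add: nproj_def)
  also have "\<dots> \<in> tangent_space Y p"
    using N_in_tangent[OF p] unfolding tangent_space_eq[OF p]
    by (intro span_add span_diff span_neg span_mul) (auto intro: span_base)
  finally show ?thesis .
qed

lemma nproj_id: "p \<in> U \<Longrightarrow> v \<in> normal_space \<epsilon> Y p \<Longrightarrow> nproj p v = v"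
  by (simp add: nproj_def normal_space_iff normal_space_N)

lemma nproj_frame: "p \<in> U \<Longrightarrow> nproj p (Y p) = 0" "p \<in> U \<Longrightarrow> nproj p (pd 1 Y p) = 0"
   "p \<in> U \<Longrightarrow> nproj p (pd \<i> Y p) = 0" "p \<in> U \<Longrightarrow> nproj p (N p) = 0"
  by (simp_all add: nproj_def gram gram_N)

lemma linear_nproj: "linear (nproj p)"
  by (auto intro!: linearI simp: nproj_def algebra_simps)

lemma nproj_L: "p \<in> U \<Longrightarrow> nproj p (L p) = 0"
proof -
  assume p: "p \<in> U"
  have L: "L p = (1/2) *\<^sub>R N p - sprod \<epsilon> (L p) (L p) *\<^sub>R Y p" by (simp add: N_def)
  show ?thesis
    by (subst L) (simp add: linear_diff[OF linear_nproj] linear_scale[OF linear_nproj] nproj_frame[OF p])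
qed

lemma nproj_tangent_zero: assumes p: "p \<in> U" and x: "x \<in> tangent_space Y p" shows "nproj p x = 0"
proof -
  have "subspace {x. nproj p x = 0}" by (rule linear_subspace_kernel[OF linear_nproj])
  then have "span {Y p, pd 1 Y p, pd \<i> Y p, L p} \<subseteq> {x. nproj p x = 0}"
    by (intro span_minimal) (auto simp: nproj_frame nproj_L p)
  then show ?thesis using x by (auto simp: tangent_space_eq[OF p])
qed

text \<open>The description has a unique solution because \<open>nproj\<close> fixes normal vectors
  and annihilates tangent ones.\<close>

lemma normal_proj_eq: assumes p: "p \<in> U" shows "normal_proj \<epsilon> Y p x = nproj p x"
  unfolding normal_proj_def
proof (rule the_equality)
  show "nproj p x \<in> normal_space \<epsilon> Y p \<and> x - nproj p x \<in> tangent_space Y p"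
    using nproj_normal nproj_tangent p by blast
  fix w assume "w \<in> normal_space \<epsilon> Y p \<and> x - w \<in> tangent_space Y p"
  then have "nproj p w = w" "nproj p (x - w) = 0" using nproj_id nproj_tangent_zero p by auto
  then show "w = nproj p x" by (simp add: linear_diff[OF linear_nproj])
qed

text \<open>For a real section the complex connection splits: \<open>Dz\<close> vanishes exactly
  when the normal parts of both real directional derivatives vanish.\<close>

lemma Dz_parts: assumes p: "p \<in> U" and f: "\<phi> differentiable (at p)"
  shows "re_vec (Dz \<epsilon> Y \<phi> p) = (1/2) *\<^sub>R nproj p (pd 1 \<phi> p)"
    "im_vec (Dz \<epsilon> Y \<phi> p) = - (1/2) *\<^sub>R nproj p (pd \<i> \<phi> p)"
  unfolding Dz_def cextend_def 
  by (simp_all add: normal_proj_eq[OF p] dz_cvec[OF f] linear_scale[OF linear_nproj] linear_neg[OF linear_nproj])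

section \<open>Schwarzian and Hopf differential in the real frame\<close>

definition s1 :: "complex \<Rightarrow> real" where
  "s1 p = sprod \<epsilon> (pd 1 (pd 1 Y) p - pd \<i> (pd \<i> Y) p) (L p)"

definition s2 :: "complex \<Rightarrow> real" where
  "s2 p = -2 * sprod \<epsilon> (pd \<i> (pd 1 Y) p) (L p)"

lemma \<kappa>_normal: assumes p: "p \<in> U" shows "\<kappa> p \<in> normal_space \<epsilon> Y p"
  using gram[OF p] gram2[OF p] gram_L[OF p]
  by (simp add: normal_space_iff[OF p] \<kappa>_def sprod_commute[of \<epsilon> "pd _ (pd _ Y) p" "Y p"]
      sprod_commute[of \<epsilon> "pd _ (pd _ Y) p" "pd _ Y p"])

lemma hopf_im_normal: assumes p: "p \<in> U"
  shows "- (1/2) *\<^sub>R pd \<i> (pd 1 Y) p + (s2 p / 2) *\<^sub>R Y p \<in> normal_space \<epsilon> Y p"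
  using gram[OF p] gram2[OF p] gram_L[OF p]
  by (simp add: normal_space_iff[OF p] s2_def sprod_commute[of \<epsilon> "pd _ (pd _ Y) p" "Y p"]
      sprod_commute[of \<epsilon> "pd _ (pd _ Y) p" "pd _ Y p"])

text \<open>Pairing the second \<open>dz\<close> with \<open>L\<close> isolates the coefficient of
  \<open>Y\<close>: normal vectors drop out and \<open>Y\<close> contributes -1/2.\<close>

lemma schwarzian_eq: assumes p: "p \<in> U" shows "schwarzian \<epsilon> Y p = Complex (s1 p) (s2 p)"
  unfolding schwarzian_def
proof (rule the_equality)
  let ?Z = "dz (dz (\<lambda>q. cvec (Y q))) p"
  note parts = dz_dz_cvec[OF open_U p smooth_Y]
  show "\<exists>k\<in>cnormal_space \<epsilon> Y p. ?Z = (- Complex (s1 p) (s2 p) / 2) *s cvec (Y p) + k"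
  proof
    let ?k = "?Z - (- Complex (s1 p) (s2 p) / 2) *s cvec (Y p)"
    show "?Z = (- Complex (s1 p) (s2 p) / 2) *s cvec (Y p) + ?k" by simp
    have "re_vec ?k = \<kappa> p" by (simp add: parts \<kappa>_def s1_def)
    moreover have "im_vec ?k = - (1/2) *\<^sub>R pd \<i> (pd 1 Y) p + (s2 p / 2) *\<^sub>R Y p"
      by (simp add: parts)
    ultimately show "?k \<in> cnormal_space \<epsilon> Y p"
      unfolding cnormal_space_def using \<kappa>_normal[OF p] hopf_im_normal[OF p] by simp
  qed
  fix s assume "\<exists>k\<in>cnormal_space \<epsilon> Y p. ?Z = (- s / 2) *s cvec (Y p) + k"
  then obtain k where k: "k \<in> cnormal_space \<epsilon> Y p" "k = ?Z - (- s / 2) *s cvec (Y p)" by auto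
  have "sprod \<epsilon> (re_vec k) (L p) = 0" "sprod \<epsilon> (im_vec k) (L p) = 0"
    using k(1) by (auto simp: cnormal_space_def normal_space_iff[OF p])
  then show "s = Complex (s1 p) (s2 p)"
    unfolding k(2) by (simp add: parts gram_L[OF p] s1_def s2_def complex_eq_iff)
qed

lemma hopf_parts: assumes p: "p \<in> U"
  shows "re_vec (hopf \<epsilon> Y p) = \<kappa> p"
    "im_vec (hopf \<epsilon> Y p) = - (1/2) *\<^sub>R pd \<i> (pd 1 Y) p + (s2 p / 2) *\<^sub>R Y p"
  unfolding hopf_def schwarzian_eq[OF p]
  by (simp_all add: dz_dz_cvec[OF open_U p smooth_Y] \<kappa>_def s1_def)

end

section \<open>Gauge transformations between lifts\<close>

lemma linear_axis_expansion:
  assumes "linear (T :: real^'m::finite \<Rightarrow> 'b::real_vector)"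
  shows "T x = (\<Sum>i\<in>UNIV. (x $ i) *\<^sub>R T (axis i 1))"
proof -
  have "T x = T (\<Sum>i\<in>UNIV. (x $ i) *\<^sub>R axis i 1)"
    using basis_expansion[of x] by (simp add: scalar_mult_eq_scaleR)
  also have "\<dots> = (\<Sum>i\<in>UNIV. (x $ i) *\<^sub>R T (axis i 1))"
    by (simp add: linear_sum[OF assms] linear_scale[OF assms])
  finally show ?thesis .
qed

lemma pd_sum:
  assumes "\<And>i. i \<in> I \<Longrightarrow> f i differentiable (at p)"
  shows "pd v (\<lambda>q. \<Sum>i\<in>I. f i q) p = (\<Sum>i\<in>I. pd v (f i) p)"
  by (rule pd_eqI) (auto intro!: has_derivative_sum pd_has_derivative assms)

text \<open>Smoothness of \<open>T\<close> is only known on fixed vectors. Expanding the section in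
  the standard basis reduces the Leibniz rule to scalar multiples of such fields.\<close>

lemma linear_field:
  fixes T :: "complex \<Rightarrow> real^'m::finite \<Rightarrow> real^'k::finite"
  assumes U: "open U" and lin: "\<And>q. q \<in> U \<Longrightarrow> linear (T q)" and sm: "\<And>x. smooth_on U (\<lambda>q. T q x)"
    and W: "open W" "W \<subseteq> U" and x: "smooth_on W x"
  shows smooth_on_linear_field: "smooth_on W (\<lambda>q. T q (x q))"
    and pd_linear_field: "p \<in> W \<Longrightarrow> pd v (\<lambda>q. T q (x q)) p = pd v (\<lambda>q. T q (x p)) p + T p (pd v x p)"
proof -
  have ex: "T q y = (\<Sum>i\<in>UNIV. (y $ i) *\<^sub>R T q (axis i 1))" if "q \<in> W" for q y
    using linear_axis_expansion[OF lin] that W by blast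
  have smT: "smooth_on W (\<lambda>q. T q y)" for y using sm smooth_on_subset W(2) by blast
  have smx: "smooth_on W (\<lambda>q. x q $ i)" for i
    by (rule smooth_on_linear[OF W(1) bounded_linear_vec_nth x])
  have "smooth_on W (\<lambda>q. \<Sum>i\<in>UNIV. (x q $ i) *\<^sub>R T q (axis i 1))"
    by (intro smooth_on_sum smooth_on_scaleR smx smT W)
  then show "smooth_on W (\<lambda>q. T q (x q))"
    using smooth_on_cong[OF W(1) ex] by simp
  assume p: "p \<in> W"
  have dT: "(\<lambda>q. T q y) differentiable (at p)" for y using smooth_on_differentiable[OF smT p] .
  have dx: "(\<lambda>q. x q $ i) differentiable (at p)" for i using smooth_on_differentiable[OF smx p] .
  have "pd v (\<lambda>q. T q (x q)) p = pd v (\<lambda>q. \<Sum>i\<in>UNIV. (x q $ i) *\<^sub>R T q (axis i 1)) p"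
    by (rule pd_cong_open[OF W(1) p ex])
  also have "\<dots> = (\<Sum>i\<in>UNIV. (x p $ i) *\<^sub>R pd v (\<lambda>q. T q (axis i 1)) p + pd v (\<lambda>q. x q $ i) p *\<^sub>R T p (axis i 1))"
    by (subst pd_sum) (auto simp: pd_bilinear[OF bounded_bilinear_scaleR dx dT]
        intro!: differentiable_bilinear[OF bounded_bilinear_scaleR] dx dT)
  also have "\<dots> = (\<Sum>i\<in>UNIV. (x p $ i) *\<^sub>R pd v (\<lambda>q. T q (axis i 1)) p) + (\<Sum>i\<in>UNIV. (pd v x p $ i) *\<^sub>R T p (axis i 1))"
    using pd_linear[OF bounded_linear_vec_nth smooth_on_differentiable[OF x p]] by (simp add: sum.distrib)
  also have "(\<Sum>i\<in>UNIV. (pd v x p $ i) *\<^sub>R T p (axis i 1)) = T p (pd v x p)" using ex[OF p] by metis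
  also have "(\<Sum>i\<in>UNIV. (x p $ i) *\<^sub>R pd v (\<lambda>q. T q (axis i 1)) p) = pd v (\<lambda>q. \<Sum>i\<in>UNIV. (x p $ i) *\<^sub>R T q (axis i 1)) p"
    by (subst pd_sum) (auto simp: pd_scaleR_const[OF dT] intro!: differentiable_linear[OF bounded_linear_scaleR_right] dT)
  also have "\<dots> = pd v (\<lambda>q. T q (x p)) p"
    by (rule pd_cong_open[OF W(1) p ex[symmetric]])
  finally show "pd v (\<lambda>q. T q (x q)) p = pd v (\<lambda>q. T q (x p)) p + T p (pd v x p)" .
qed

text \<open>The differential equation is tested on fixed vectors \<open>x\<close>, which avoids
  derivatives of operator-valued maps. The opposite signs in the two directions are those of the
  form \<open>\<omega>\<close>.\<close>

locale gauge_pair = A: conformal_lift \<epsilon> U Y + B: conformal_lift \<epsilon> U Y'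
  for \<epsilon> :: "'m::finite \<Rightarrow> real" and U Y Y' +
  fixes T :: "complex \<Rightarrow> real^'m \<Rightarrow> real^'m" and c' :: real
  assumes sign_nonzero: "\<epsilon> i \<noteq> 0"
    and T_linear: "p \<in> U \<Longrightarrow> linear (T p)"
    and T_smooth: "smooth_on U (\<lambda>p. T p x)"
    and T_isometry: "p \<in> U \<Longrightarrow> sprod \<epsilon> (T p u) (T p v) = sprod \<epsilon> u v"
    and T_Y: "p \<in> U \<Longrightarrow> T p (Y p) = Y' p"
    and T_pd1: "p \<in> U \<Longrightarrow> pd 1 (\<lambda>q. T q x) p =
      c' *\<^sub>R (sprod \<epsilon> (T p x) (Y' p) *\<^sub>R pd 1 Y' p - sprod \<epsilon> (T p x) (pd 1 Y' p) *\<^sub>R Y' p)"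
    and T_pd2: "p \<in> U \<Longrightarrow> pd \<i> (\<lambda>q. T q x) p =
      - c' *\<^sub>R (sprod \<epsilon> (T p x) (Y' p) *\<^sub>R pd \<i> Y' p - sprod \<epsilon> (T p x) (pd \<i> Y' p) *\<^sub>R Y' p)"
begin

lemma smooth_T: "open W \<Longrightarrow> W \<subseteq> U \<Longrightarrow> smooth_on W x \<Longrightarrow> smooth_on W (\<lambda>q. T q (x q))"
  by (rule smooth_on_linear_field[OF A.open_U T_linear T_smooth])

lemma pd_T: "open W \<Longrightarrow> W \<subseteq> U \<Longrightarrow> smooth_on W x \<Longrightarrow> p \<in> W \<Longrightarrow>
    pd v (\<lambda>q. T q (x q)) p = pd v (\<lambda>q. T q (x p)) p + T p (pd v x p)"
  by (rule pd_linear_field[OF A.open_U T_linear T_smooth])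

lemma T_inj: "p \<in> U \<Longrightarrow> inj (T p)"
proof -
  assume p: "p \<in> U"
  have "x = 0" if "T p x = 0" for x
    by (rule sprod_nondegenerate[OF sign_nonzero]) (use T_isometry[OF p, of x] that in simp)
  then show ?thesis using linear_injective_0[OF T_linear[OF p]] by blast
qed

lemma T_surj: "p \<in> U \<Longrightarrow> surj (T p)"
  using linear_injective_imp_surjective T_linear T_inj by blast

text \<open>The connection form annihilates \<open>Y'\<close>, which is null and orthogonal to its
  derivatives, so the Leibniz rule leaves only \<open>T\<close> applied to the derivative.\<close>

lemma T_Y1: assumes p: "p \<in> U" shows "pd 1 Y' p = T p (pd 1 Y p)"
proof -
  have "pd 1 Y' p = pd 1 (\<lambda>q. T q (Y q)) p"
    by (rule pd_cong_open[OF A.open_U p]) (simp add: T_Y)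
  also have "\<dots> = T p (pd 1 Y p)"
    by (simp add: pd_T[OF A.open_U order_refl A.smooth_Y p] T_pd1[OF p] T_Y[OF p] B.gram[OF p])
  finally show ?thesis .
qed

lemma T_Y2: assumes p: "p \<in> U" shows "pd \<i> Y' p = T p (pd \<i> Y p)"
proof -
  have "pd \<i> Y' p = pd \<i> (\<lambda>q. T q (Y q)) p"
    by (rule pd_cong_open[OF A.open_U p]) (simp add: T_Y)
  also have "\<dots> = T p (pd \<i> Y p)"
    by (simp add: pd_T[OF A.open_U order_refl A.smooth_Y p] T_pd2[OF p] T_Y[OF p] B.gram[OF p])
  finally show ?thesis .
qed

text \<open>On the unit vector \<open>pd 1 Y'\<close> the form in direction \<open>1\<close> takes
  the value \<open>- c' *\<^sub>R Y'\<close>. Direction \<open>\<i>\<close> gives the opposite sign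
  on \<open>pd \<i> Y'\<close>, and the mixed case gives zero. Hence the Laplacian, and with it
  \<open>L\<close>, is carried over by \<open>T\<close>, while the difference of the two second
  derivatives is shifted.\<close>

lemma T_Y11: assumes p: "p \<in> U"
  shows "pd 1 (pd 1 Y') p = T p (pd 1 (pd 1 Y) p) - c' *\<^sub>R Y' p"
proof -
  have "pd 1 (pd 1 Y') p = pd 1 (\<lambda>q. T q (pd 1 Y q)) p"
    by (rule pd_cong_open[OF A.open_U p]) (simp add: T_Y1)
  also have "\<dots> = T p (pd 1 (pd 1 Y) p) - c' *\<^sub>R Y' p"
    by (simp add: pd_T[OF A.open_U order_refl A.smooth_frame(1) p] T_pd1[OF p] T_Y1[OF p, symmetric] B.gram[OF p])
  finally show ?thesis .
qed

lemma T_Y22: assumes p: "p \<in> U"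
  shows "pd \<i> (pd \<i> Y') p = T p (pd \<i> (pd \<i> Y) p) + c' *\<^sub>R Y' p"
proof -
  have "pd \<i> (pd \<i> Y') p = pd \<i> (\<lambda>q. T q (pd \<i> Y q)) p"
    by (rule pd_cong_open[OF A.open_U p]) (simp add: T_Y2)
  also have "\<dots> = T p (pd \<i> (pd \<i> Y) p) + c' *\<^sub>R Y' p"
    by (simp add: pd_T[OF A.open_U order_refl A.smooth_frame(1) p] T_pd2[OF p] T_Y2[OF p, symmetric] B.gram[OF p])
  finally show ?thesis .
qed

lemma T_Y12: assumes p: "p \<in> U"
  shows "pd \<i> (pd 1 Y') p = T p (pd \<i> (pd 1 Y) p)"
proof -
  have "pd \<i> (pd 1 Y') p = pd \<i> (\<lambda>q. T q (pd 1 Y q)) p"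
    by (rule pd_cong_open[OF A.open_U p]) (simp add: T_Y1)
  also have "\<dots> = T p (pd \<i> (pd 1 Y) p)"
    by (simp add: pd_T[OF A.open_U order_refl A.smooth_frame(1) p] T_pd2[OF p] T_Y1[OF p, symmetric] B.gram[OF p])
  finally show ?thesis .
qed

lemma T_L: assumes p: "p \<in> U" shows "B.L p = T p (A.L p)"
  by (simp add: A.L_def B.L_def T_Y11[OF p] T_Y22[OF p] linear_add[OF T_linear[OF p]] linear_scale[OF T_linear[OF p]])

lemma T_second_difference: assumes p: "p \<in> U"
  shows "pd 1 (pd 1 Y') p - pd \<i> (pd \<i> Y') p
    = T p (pd 1 (pd 1 Y) p - pd \<i> (pd \<i> Y) p) - (2 * c') *\<^sub>R Y' p"
  by (simp add: T_Y11[OF p] T_Y22[OF p] linear_diff[OF T_linear[OF p]] vec_eq_iff)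

text \<open>The shift \<open>- 2 * c'\<close> of the second difference meets the product -1/2 of
  \<open>Y'\<close> with \<open>L\<close>.\<close>

lemma s1_shift: assumes p: "p \<in> U" shows "B.s1 p = A.s1 p + c'"
proof -
  have "B.s1 p = sprod \<epsilon> (T p (pd 1 (pd 1 Y) p - pd \<i> (pd \<i> Y) p)) (T p (A.L p)) - 2 * c' * sprod \<epsilon> (Y' p) (B.L p)"
    unfolding B.s1_def T_second_difference[OF p] using T_L[OF p] by (metis sprod_simps(3,7))
  then show ?thesis using B.gram_L(1)[OF p] by (simp only: T_isometry[OF p] A.s1_def)
qed

lemma s2_same: assumes p: "p \<in> U" shows "B.s2 p = A.s2 p"
  by (simp add: A.s2_def B.s2_def T_Y12[OF p] T_L[OF p] T_isometry[OF p])

text \<open>The shift of the second derivatives, divided by 4, and the shift of the Schwarzian,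
  divided by 2, cancel along \<open>Y'\<close>.\<close>

lemma T_\<kappa>: assumes p: "p \<in> U" shows "B.\<kappa> p = T p (A.\<kappa> p)"
proof -
  have "B.\<kappa> p = (1/4) *\<^sub>R (pd 1 (pd 1 Y') p - pd \<i> (pd \<i> Y') p) + (B.s1 p / 2) *\<^sub>R Y' p"
    by (simp add: B.\<kappa>_def B.s1_def)
  also have "\<dots> = (1/4) *\<^sub>R T p (pd 1 (pd 1 Y) p - pd \<i> (pd \<i> Y) p) + (A.s1 p / 2) *\<^sub>R Y' p"
    unfolding T_second_difference[OF p] s1_shift[OF p] by (simp add: algebra_simps add_divide_distrib)
  also have "\<dots> = T p (A.\<kappa> p)"
    unfolding A.\<kappa>_def A.s1_def[symmetric]
    by (simp only: linear_add[OF T_linear[OF p]] linear_scale[OF T_linear[OF p]] T_Y[OF p])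
  finally show ?thesis .
qed

lemma T_normal_iff: assumes p: "p \<in> U"
  shows "T p v \<in> normal_space \<epsilon> Y' p \<longleftrightarrow> v \<in> normal_space \<epsilon> Y p"
  by (simp add: A.normal_space_iff[OF p] B.normal_space_iff[OF p] T_Y1[OF p] T_Y2[OF p] T_L[OF p]
      T_Y[OF p, symmetric] T_isometry[OF p])

lemma T_bij_normal: assumes p: "p \<in> U"
  shows "bij_betw (T p) (normal_space \<epsilon> Y p) (normal_space \<epsilon> Y' p)"
proof -
  have "T p ` normal_space \<epsilon> Y p = normal_space \<epsilon> Y' p"
    using T_normal_iff[OF p] T_surj[OF p] by (auto simp: image_iff) (metis surjD)
  then show ?thesis using T_inj[OF p] using inj_on_subset[OF T_inj[OF p] subset_UNIV] by (simp add: bij_betw_def)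
qed

lemma T_N: assumes p: "p \<in> U" shows "B.N p = T p (A.N p)"
  by (simp add: A.N_def B.N_def T_L[OF p] T_isometry[OF p] linear_add[OF T_linear[OF p]]
      linear_scale[OF T_linear[OF p]] T_Y[OF p])

lemma T_nproj: assumes p: "p \<in> U" shows "B.nproj p (T p x) = T p (A.nproj p x)"
  by (simp add: A.nproj_def B.nproj_def T_N[OF p] T_Y1[OF p] T_Y2[OF p] T_isometry[OF p]
      linear_add[OF T_linear[OF p]] linear_diff[OF T_linear[OF p]] linear_scale[OF T_linear[OF p]] T_Y[OF p, symmetric])

text \<open>The connection form vanishes on vectors orthogonal to \<open>Y'\<close> and its
  derivatives, in particular on normal ones; so \<open>T\<close> commutes with differentiation of
  normal sections and with the projection.\<close>

lemma Dz_T: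
  assumes W: "open W" "W \<subseteq> U" and \<phi>: "normal_section \<epsilon> Y W \<phi>" and p: "p \<in> W"
  shows "Dz \<epsilon> Y' (\<lambda>q. T q (\<phi> q)) p = cextend (T p) (Dz \<epsilon> Y \<phi> p)"
proof -
  have pU: "p \<in> U" using p W by auto
  have sm: "smooth_on W \<phi>" and n: "\<phi> p \<in> normal_space \<epsilon> Y p" using \<phi> p by (auto simp: normal_section_def)
  have "T p (\<phi> p) \<in> normal_space \<epsilon> Y' p" using n T_normal_iff[OF pU] by simp
  then have z: "sprod \<epsilon> (T p (\<phi> p)) (Y' p) = 0" "sprod \<epsilon> (T p (\<phi> p)) (pd 1 Y' p) = 0"
    "sprod \<epsilon> (T p (\<phi> p)) (pd \<i> Y' p) = 0" by (auto simp: B.normal_space_iff[OF pU])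
  have 1: "pd 1 (\<lambda>q. T q (\<phi> q)) p = T p (pd 1 \<phi> p)" "pd \<i> (\<lambda>q. T q (\<phi> q)) p = T p (pd \<i> \<phi> p)"
    using pd_T[OF W sm p] T_pd1[OF pU] T_pd2[OF pU] z by simp_all
  have d: "\<phi> differentiable (at p)" "(\<lambda>q. T q (\<phi> q)) differentiable (at p)"
    using smooth_on_differentiable[OF sm p] smooth_on_differentiable[OF smooth_T[OF W sm] p] by auto
  show ?thesis
    unfolding complex_vec_eq_iff cextend_def
    by (simp add: A.Dz_parts[OF pU d(1)] B.Dz_parts[OF pU d(2)] 1 T_nproj[OF pU] linear_scale[OF T_linear[OF pU]] linear_neg[OF T_linear[OF pU]])
qed

end

lemma canonical_liftD:
  assumes "canonical_lift \<epsilon> U y Y" shows "conformal_lift \<epsilon> U Y"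
  using assms by unfold_locales (auto simp: canonical_lift_def pd_def)

lemma (in conformal_lift) canonical_liftI:
  assumes "\<And>p. p \<in> U \<Longrightarrow> y p = span {Y p}" shows "canonical_lift \<epsilon> U y Y"
  using assms Y_nonzero Y_null Y_conformal by (auto simp: canonical_lift_def pd_def)

lemma (in conformal_lift) isothermic_hopf:
  assumes "p \<in> U" "im_vec (hopf \<epsilon> Y p) = 0"
  shows "hopf \<epsilon> Y p = cvec (\<kappa> p)"
  using assms hopf_parts by (simp add: complex_vec_eq_iff)

text \<open>\<open>T\<close> serves as the bundle map, and the given lifts on all of
  \<open>U\<close> serve as local lifts at every point.\<close>

theorem (in gauge_pair) spectral_transformI:
  assumes iso: "isothermic_adapted \<epsilon> U y" "isothermic_adapted \<epsilon> U y'"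
    and lift: "\<And>p. p \<in> U \<Longrightarrow> y p = span {Y p}" "\<And>p. p \<in> U \<Longrightarrow> y' p = span {Y' p}"
  shows "spectral_transform \<epsilon> U c' y y'"
  unfolding spectral_transform_def
proof (intro conjI iso exI[of _ T] ballI)
  fix p assume p: "p \<in> U"
  have cl: "canonical_lift \<epsilon> U y Y" "canonical_lift \<epsilon> U y' Y'"
    using A.canonical_liftI B.canonical_liftI lift by auto
  have hopf: "hopf \<epsilon> Y q = cvec (A.\<kappa> q)" "hopf \<epsilon> Y' q = cvec (B.\<kappa> q)" if "q \<in> U" for q
    using iso cl that A.isothermic_hopf B.isothermic_hopf unfolding isothermic_adapted_def by blast+
  have "p \<in> U \<and> U \<subseteq> U \<and> canonical_lift \<epsilon> U y Y \<and> canonical_lift \<epsilon> U y' Y' \<and>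
        (\<forall>q\<in>U. schwarzian \<epsilon> Y' q = schwarzian \<epsilon> Y q + of_real c' \<and>
           bij_betw (T q) (normal_space \<epsilon> Y q) (normal_space \<epsilon> Y' q) \<and>
           (\<forall>u\<in>normal_space \<epsilon> Y q. \<forall>v\<in>normal_space \<epsilon> Y q.
              (\<forall>a b. T q (a *\<^sub>R u + b *\<^sub>R v) = a *\<^sub>R T q u + b *\<^sub>R T q v) \<and>
              sprod \<epsilon> (T q u) (T q v) = sprod \<epsilon> u v) \<and>
           (\<forall>u\<in>normal_space \<epsilon> Y q.
              sprod \<epsilon> (hopf \<epsilon> Y' q) (cvec (T q u)) = sprod \<epsilon> (hopf \<epsilon> Y q) (cvec u))) \<and>
        (\<forall>W' \<phi>. open W' \<and> W' \<subseteq> U \<and> normal_section \<epsilon> Y W' \<phi> \<longrightarrow>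
           smooth_on W' (\<lambda>q. T q (\<phi> q)) \<and>
           (\<forall>q\<in>W'. Dz \<epsilon> Y' (\<lambda>q. T q (\<phi> q)) q = cextend (T q) (Dz \<epsilon> Y \<phi> q)))"
    using p cl
    by (auto simp: A.schwarzian_eq B.schwarzian_eq s1_shift s2_same complex_eq_iff T_bij_normal
        linear_add[OF T_linear] linear_scale[OF T_linear] T_isometry hopf T_\<kappa> sprod_cvec
        normal_section_def intro!: smooth_T Dz_T)
  then show "\<exists>W Z Z'.
        p \<in> W \<and> W \<subseteq> U \<and> canonical_lift \<epsilon> W y Z \<and> canonical_lift \<epsilon> W y' Z' \<and>
        (\<forall>q\<in>W. schwarzian \<epsilon> Z' q = schwarzian \<epsilon> Z q + of_real c' \<and>
           bij_betw (T q) (normal_space \<epsilon> Z q) (normal_space \<epsilon> Z' q) \<and>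
           (\<forall>u\<in>normal_space \<epsilon> Z q. \<forall>v\<in>normal_space \<epsilon> Z q.
              (\<forall>a b. T q (a *\<^sub>R u + b *\<^sub>R v) = a *\<^sub>R T q u + b *\<^sub>R T q v) \<and>
              sprod \<epsilon> (T q u) (T q v) = sprod \<epsilon> u v) \<and>
           (\<forall>u\<in>normal_space \<epsilon> Z q.
              sprod \<epsilon> (hopf \<epsilon> Z' q) (cvec (T q u)) = sprod \<epsilon> (hopf \<epsilon> Z q) (cvec u))) \<and>
        (\<forall>W' \<phi>. open W' \<and> W' \<subseteq> W \<and> normal_section \<epsilon> Z W' \<phi> \<longrightarrow>
           smooth_on W' (\<lambda>q. T q (\<phi> q)) \<and>
           (\<forall>q\<in>W'. Dz \<epsilon> Z' (\<lambda>q. T q (\<phi> q)) q = cextend (T q) (Dz \<epsilon> Z \<phi> q)))"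
    by blast
qed

section \<open>Polar surfaces\<close>

lemma pd_scaleR:
  assumes "f differentiable (at p)" "g differentiable (at p)"
  shows "pd v (\<lambda>q. f q *\<^sub>R g q) p = f p *\<^sub>R pd v g p + pd v f p *\<^sub>R g p"
  by (rule pd_bilinear[OF bounded_bilinear_scaleR assms])

lemma smooth_on_continuous_on: "smooth_on U f \<Longrightarrow> continuous_on U f"
  using smooth_on_def Ck_on.simps(1) by blast

lemma canonical_lift_subset:
  "canonical_lift \<epsilon> W y Y \<Longrightarrow> open N \<Longrightarrow> N \<subseteq> W \<Longrightarrow> canonical_lift \<epsilon> N y Y"
  unfolding canonical_lift_def using smooth_on_subset by blast

text \<open>Two lifts of the same null lines are proportional; the normalised metric forces the
  square of the factor to be 1, and continuity makes the factor locally constant.\<close>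

lemma canonical_lift_unique:
  fixes Y Z :: "complex \<Rightarrow> real^'m::finite"
  assumes Y: "canonical_lift \<epsilon> W y Y" and Z: "canonical_lift \<epsilon> W' y Z" and p: "p \<in> W" "p \<in> W'"
  obtains \<sigma> N where "\<sigma> = 1 \<or> \<sigma> = (-1::real)" "open N" "p \<in> N" "N \<subseteq> W \<inter> W'" "\<And>q. q \<in> N \<Longrightarrow> Z q = \<sigma> *\<^sub>R Y q"
proof -
  interpret A: conformal_lift \<epsilon> W Y by (rule canonical_liftD[OF Y])
  interpret B: conformal_lift \<epsilon> W' Z by (rule canonical_liftD[OF Z])
  obtain i where i: "Y p $ i \<noteq> 0"
    using A.Y_nonzero[OF p(1)] by (auto simp: vec_eq_iff)
  define V where "V = W \<inter> W' \<inter> {q. Y q $ i \<noteq> 0}"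
  have coord: "smooth_on W (\<lambda>q. Y q $ i)" "smooth_on W' (\<lambda>q. Z q $ i)"
    by (auto intro!: smooth_on_linear[OF _ bounded_linear_vec_nth])
  have "open (W \<inter> (\<lambda>q. Y q $ i) -` (- {0}))"
    by (rule continuous_open_preimage[OF smooth_on_continuous_on[OF coord(1)] A.open_U]) auto
  moreover have "V = W' \<inter> (W \<inter> (\<lambda>q. Y q $ i) -` (- {0}))" by (auto simp: V_def)
  ultimately have V: "open V" using B.open_U by auto
  have pV: "p \<in> V" using p i by (simp add: V_def)
  \<comment> \<open>Reading the factor off a coordinate in which \<open>Y\<close> does not vanish
    makes it smooth.\<close>
  define \<tau> where "\<tau> q = Z q $ i * inverse (Y q $ i)" for q
  have sm: "smooth_on V \<tau>" unfolding \<tau>_def[abs_def]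
    by (intro smooth_on_mult V smooth_on_inverse smooth_on_subset[OF coord(1)] smooth_on_subset[OF coord(2)])
      (auto simp: V_def)
  have ZY: "Z q = \<tau> q *\<^sub>R Y q" if "q \<in> V" for q
  proof -
    have "Z q \<in> span {Y q}"
      using that Y Z span_base[of "Z q" "{Z q}"] by (auto simp: V_def canonical_lift_def)
    then obtain a where a: "Z q = a *\<^sub>R Y q" by (auto simp: span_singleton)
    then have "\<tau> q = a" using that by (simp add: \<tau>_def V_def)
    with a show ?thesis by simp
  qed
  have sq: "\<tau> q * \<tau> q = 1" if q: "q \<in> V" for q
  proof -
    have qW: "q \<in> W" "q \<in> W'" using q by (auto simp: V_def)
    have "pd 1 Z q = pd 1 (\<lambda>q. \<tau> q *\<^sub>R Y q) q"
      by (rule pd_cong_open[OF V q ZY])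
    also have "\<dots> = \<tau> q *\<^sub>R pd 1 Y q + pd 1 \<tau> q *\<^sub>R Y q"
      by (rule pd_scaleR[OF smooth_on_differentiable[OF sm q] smooth_on_differentiable[OF A.smooth_Y qW(1)]])
    finally show ?thesis
      using B.gram(6)[OF qW(2)] A.gram[OF qW(1)] by simp
  qed
  define N where "N = V \<inter> (\<lambda>q. \<tau> q * \<tau> p) -` {0<..}"
  have "open N" unfolding N_def
    by (intro continuous_open_preimage V continuous_intros smooth_on_continuous_on[OF sm])
  moreover have "p \<in> N" using pV sq by (simp add: N_def)
  moreover have "N \<subseteq> W \<inter> W'" by (auto simp: N_def V_def)
  moreover have "\<tau> p = 1 \<or> \<tau> p = -1" using sq[OF pV] by (simp add: square_eq_1_iff)
  moreover have "Z q = \<tau> p *\<^sub>R Y q" if q: "q \<in> N" for q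
  proof -
    have "q \<in> V" "\<tau> q * \<tau> p > 0" using q by (auto simp: N_def)
    then have "\<tau> q = \<tau> p"
      using sq[of q] sq[OF pV] by (auto simp: square_eq_1_iff)
    with ZY[OF \<open>q \<in> V\<close>] show ?thesis by simp
  qed
  ultimately show ?thesis using that by blast
qed

lemma pd_scaled_cong:
  fixes Y Z :: "complex \<Rightarrow> 'a::real_normed_vector"
  assumes N: "open N" and sm: "smooth_on N Y" and Z: "\<And>q. q \<in> N \<Longrightarrow> Z q = \<sigma> *\<^sub>R Y q" and p: "p \<in> N"
  shows "pd v Z p = \<sigma> *\<^sub>R pd v Y p" "pd w (pd v Z) p = \<sigma> *\<^sub>R pd w (pd v Y) p"
proof -
  have 1: "pd v Z q = \<sigma> *\<^sub>R pd v Y q" if "q \<in> N" for q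
    using pd_cong_open[OF N that Z] pd_scaleR_const[OF smooth_on_differentiable[OF sm that]] by simp
  show "pd v Z p = \<sigma> *\<^sub>R pd v Y p" by (rule 1[OF p])
  show "pd w (pd v Z) p = \<sigma> *\<^sub>R pd w (pd v Y) p"
    using pd_cong_open[OF N p 1] pd_scaleR_const[OF smooth_on_differentiable[OF smooth_on_pd[OF sm] p]] by simp
qed

context conformal_lift
begin

lemma isothermicD: 
  assumes "p \<in> U" "im_vec (hopf \<epsilon> Y p) = 0"
  shows "pd \<i> (pd 1 Y) p = s2 p *\<^sub>R Y p"
  using assms(2) by (simp add: hopf_parts[OF assms(1)] vec_eq_iff)

text \<open>The factor \<open>t\<close> may be arbitrary, since pairing with \<open>L\<close>
  identifies it with \<open>s2\<close>.\<close>

lemma isothermicI: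
  assumes p: "p \<in> U" and "pd \<i> (pd 1 Y) p = t *\<^sub>R Y p"
  shows "im_vec (hopf \<epsilon> Y p) = 0"
  by (simp add: hopf_parts[OF p] s2_def assms(2) gram_L[OF p])

text \<open>One lift suffices: any other agrees with it up to a sign near each point, and the
  condition on the mixed derivative is insensitive to that sign.\<close>

lemma isothermic_adaptedI:
  assumes y: "\<And>p. p \<in> U \<Longrightarrow> y p = span {Y p}"
    and iso: "\<And>p. p \<in> U \<Longrightarrow> \<exists>t. pd \<i> (pd 1 Y) p = t *\<^sub>R Y p"
  shows "isothermic_adapted \<epsilon> U y"
  unfolding isothermic_adapted_def
proof (intro conjI allI impI ballI)
  have "\<forall>q\<in>U. Y q \<noteq> 0 \<and> y q = span {Y q} \<and> (1::real) > 0 \<and>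
           (\<forall>v. sprod \<epsilon> (frechet_derivative Y (at q) v) (frechet_derivative Y (at q) v) = 1 * (norm v)\<^sup>2)"
    using Y_nonzero y Y_conformal by (simp add: pd_def)
  moreover have "y p \<in> quadric \<epsilon>" if "p \<in> U" for p
    unfolding quadric_def using y Y_nonzero Y_null that by blast
  ultimately show "spacelike_surface \<epsilon> U y"
    unfolding spacelike_surface_def
    by (intro conjI ballI open_U exI[of _ U] exI[of _ Y] exI[of _ "\<lambda>_. 1"]) auto
next
  fix W Z p assume "W \<subseteq> U \<and> canonical_lift \<epsilon> W y Z" and p: "p \<in> W"
  then have pU: "p \<in> U" and Z: "canonical_lift \<epsilon> W y Z" by auto
  interpret B: conformal_lift \<epsilon> W Z by (rule canonical_liftD[OF Z])
  obtain \<sigma> N where N: "\<sigma> = 1 \<or> \<sigma> = (-1::real)" "open N" "p \<in> N" "N \<subseteq> U \<inter> W" "\<And>q. q \<in> N \<Longrightarrow> Z q = \<sigma> *\<^sub>R Y q"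
    using canonical_lift_unique[OF canonical_liftI[OF y] Z pU p] by blast
  have "pd \<i> (pd 1 Z) p = \<sigma> *\<^sub>R pd \<i> (pd 1 Y) p"
    using pd_scaled_cong[OF N(2) smooth_on_subset[OF smooth_Y] N(5,3)] N(4) by blast
  moreover obtain t where "pd \<i> (pd 1 Y) p = t *\<^sub>R Y p" using iso pU by blast
  ultimately have "pd \<i> (pd 1 Z) p = t *\<^sub>R Z p" using N by auto
  then show "im_vec (hopf \<epsilon> Z p) = 0" using B.isothermicI[OF p] by blast
qed

end

text \<open>\<open>F\<close> stands for \<open>\<psi>\<close> if \<open>c = 0\<close> and for its
  image in the compactification otherwise. In both cases it is null and obeys the same equations, so
  the two cases share one computation.\<close>

locale polar_lift = conformal_lift \<epsilon> U Y
  for \<epsilon> :: "'m::finite \<Rightarrow> real" and U Y +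
  fixes F :: "complex \<Rightarrow> real^'m" and h :: "complex \<Rightarrow> real"
  assumes smooth_F [intro, simp]: "smooth_on U F" and smooth_h [intro, simp]: "smooth_on U h"
    and h_pos: "p \<in> U \<Longrightarrow> h p > 0"
    and F_nonzero: "p \<in> U \<Longrightarrow> F p \<noteq> 0"
    and F_null: "p \<in> U \<Longrightarrow> sprod \<epsilon> (F p) (F p) = 0"
    and F_Y: "p \<in> U \<Longrightarrow> sprod \<epsilon> (F p) (Y p) = 0"
    and F_pd1: "p \<in> U \<Longrightarrow> pd 1 F p = 2 *\<^sub>R (pd 1 h p *\<^sub>R Y p - h p *\<^sub>R pd 1 Y p)"
    and F_pd2: "p \<in> U \<Longrightarrow> pd \<i> F p = - 2 *\<^sub>R (pd \<i> h p *\<^sub>R Y p - h p *\<^sub>R pd \<i> Y p)"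
begin

lemma F_pd: "p \<in> U \<Longrightarrow> sprod \<epsilon> (F p) (pd 1 Y p) = 0" "p \<in> U \<Longrightarrow> sprod \<epsilon> (F p) (pd \<i> Y p) = 0"
  using sprod_const_pdU[OF smooth_F smooth_Y F_Y, of p 1] sprod_const_pdU[OF smooth_F smooth_Y F_Y, of p \<i>]
  by (simp_all add: F_pd1 F_pd2 gram)

text \<open>Both derivatives of \<open>F\<close> have square \<open>4 * (h p)\<^sup>2\<close>; this
  factor normalises the metric of \<open>F\<close>.\<close>

definition k :: "complex \<Rightarrow> real" where "k p = inverse (2 * h p)"

definition \<Psi> :: "complex \<Rightarrow> real^'m" where "\<Psi> p = k p *\<^sub>R F p"

lemma k_h: "p \<in> U \<Longrightarrow> k p * h p = 1/2"
  using h_pos[of p] by (simp add: k_def field_simps)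

lemma smooth_k [intro, simp]: "smooth_on U k"
  unfolding k_def[abs_def] using h_pos
  by (intro smooth_on_inverse smooth_on_mult smooth_on_const open_U smooth_h) (simp add: less_imp_neq[symmetric])

lemma smooth_\<Psi> [intro, simp]: "smooth_on U \<Psi>"
  unfolding \<Psi>_def[abs_def] by (intro smooth_intros) auto

lemma differentiable_frame:
  assumes p: "p \<in> U"
  shows "F differentiable (at p)" "h differentiable (at p)" "k differentiable (at p)" "Y differentiable (at p)"
    "pd v Y differentiable (at p)" "pd v h differentiable (at p)" "\<Psi> differentiable (at p)"
  by (rule smooth_on_differentiable[OF _ p], auto intro: smooth_on_pd)+

lemma pd_k: assumes p: "p \<in> U" shows "pd v k p = - 2 * pd v h p * (k p * k p)"
proof -
  note d = differentiable_frame[OF p]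
  have "pd v (\<lambda>q. 2 * h q) p = 2 * pd v h p"
    using pd_linear[OF bounded_linear_mult_right d(2)] by blast
  moreover have "2 * h p \<noteq> 0" using h_pos[OF p] by simp
  ultimately show ?thesis
    unfolding k_def[abs_def] using pd_inverse[of "\<lambda>q. 2 * h q" p v] d(2) by (simp add: mult_ac)
qed

text \<open>Modulo the null plane of \<open>Y\<close> and \<open>\<Psi>\<close>, passing to the
  polar surface reverses the derivative of the lift in direction \<open>1\<close> and keeps the one
  in direction \<open>\<i>\<close>. As that plane is orthogonal to both derivatives of
  \<open>Y\<close>, the orthonormality of the pair is inherited.\<close>

lemma \<Psi>_pd1: assumes p: "p \<in> U"
  shows "pd 1 \<Psi> p = (2 * (k p * pd 1 h p)) *\<^sub>R (Y p - \<Psi> p) - pd 1 Y p"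
proof -
  have "pd 1 \<Psi> p = k p *\<^sub>R (2 *\<^sub>R (pd 1 h p *\<^sub>R Y p - h p *\<^sub>R pd 1 Y p)) + (- 2 * pd 1 h p * (k p * k p)) *\<^sub>R F p"
    unfolding \<Psi>_def[abs_def]
    by (simp add: pd_scaleR[OF differentiable_frame(3,1)[OF p]] F_pd1[OF p] pd_k[OF p])
  also have "\<dots> = (2 * (k p * pd 1 h p)) *\<^sub>R (Y p - \<Psi> p) - (2 * (k p * h p)) *\<^sub>R pd 1 Y p"
    by (simp add: \<Psi>_def vec_eq_iff algebra_simps)
  finally show ?thesis by (simp add: k_h[OF p])
qed

lemma \<Psi>_pd2: assumes p: "p \<in> U"
  shows "pd \<i> \<Psi> p = pd \<i> Y p - (2 * (k p * pd \<i> h p)) *\<^sub>R (Y p + \<Psi> p)"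
proof -
  have "pd \<i> \<Psi> p = k p *\<^sub>R (- 2 *\<^sub>R (pd \<i> h p *\<^sub>R Y p - h p *\<^sub>R pd \<i> Y p)) + (- 2 * pd \<i> h p * (k p * k p)) *\<^sub>R F p"
    unfolding \<Psi>_def[abs_def]
    by (simp add: pd_scaleR[OF differentiable_frame(3,1)[OF p]] F_pd2[OF p] pd_k[OF p])
  also have "\<dots> = (2 * (k p * h p)) *\<^sub>R pd \<i> Y p - (2 * (k p * pd \<i> h p)) *\<^sub>R (Y p + \<Psi> p)"
    by (simp add: \<Psi>_def vec_eq_iff algebra_simps)
  finally show ?thesis by (simp add: k_h[OF p])
qed

lemma \<Psi>_gram: assumes p: "p \<in> U"
  shows "sprod \<epsilon> (\<Psi> p) (\<Psi> p) = 0" "sprod \<epsilon> (\<Psi> p) (Y p) = 0" "sprod \<epsilon> (Y p) (\<Psi> p) = 0"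
    "sprod \<epsilon> (\<Psi> p) (pd 1 Y p) = 0" "sprod \<epsilon> (pd 1 Y p) (\<Psi> p) = 0"
    "sprod \<epsilon> (\<Psi> p) (pd \<i> Y p) = 0" "sprod \<epsilon> (pd \<i> Y p) (\<Psi> p) = 0"
  using F_null[OF p] F_Y[OF p] F_pd[OF p] by (simp_all add: \<Psi>_def sprod_commute)

sublocale polar: conformal_lift \<epsilon> U \<Psi>
proof
  fix p v assume p: "p \<in> U"
  show "\<Psi> p \<noteq> 0" using F_nonzero[OF p] h_pos[OF p] by (simp add: \<Psi>_def k_def)
  show "sprod \<epsilon> (\<Psi> p) (\<Psi> p) = 0" by (simp add: \<Psi>_gram[OF p])
  have "v = Re v *\<^sub>R 1 + Im v *\<^sub>R \<i>" by (simp add: complex_eq_iff)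
  then have "pd v \<Psi> p = Re v *\<^sub>R pd 1 \<Psi> p + Im v *\<^sub>R pd \<i> \<Psi> p"
    using pd_add_direction[OF differentiable_frame(7)[OF p]] pd_scaleR_direction[OF differentiable_frame(7)[OF p]]
    by metis
  then show "sprod \<epsilon> (pd v \<Psi> p) (pd v \<Psi> p) = (norm v)\<^sup>2"
    by (simp add: \<Psi>_pd1[OF p] \<Psi>_pd2[OF p] \<Psi>_gram[OF p] gram[OF p] cmod_power2 flip: power2_eq_square)
qed auto

text \<open>The mixed derivative is computed in both orders from the first-order formulas. In the
  sum of the two results the mixed derivatives of \<open>Y\<close> and all multiples of
  \<open>Y\<close> cancel, and only a multiple of \<open>\<Psi>\<close> is left.\<close>

lemma \<Psi>_isothermic:
  assumes p: "p \<in> U" shows "\<exists>t. pd \<i> (pd 1 \<Psi>) p = t *\<^sub>R \<Psi> p"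
proof -
  note d = differentiable_frame[OF p]
  define a where "a q = 2 * (k q * pd 1 h q)" for q
  define b where "b q = 2 * (k q * pd \<i> h q)" for q
  have da: "a differentiable (at p)" "b differentiable (at p)"
    unfolding a_def[abs_def] b_def[abs_def] using d by simp_all
  have pa: "pd v (\<lambda>q. 2 * (k q * g q)) p = 2 * (k p * pd v g p + pd v k p * g p)" 
    if "g differentiable (at p)" for g v
    using pd_linear[OF bounded_linear_mult_right, of "\<lambda>q. k q * g q" p v 2]
      pd_bilinear[OF bounded_bilinear_mult d(3) that] d(3) that by simp
  \<comment> \<open>The functions \<open>a\<close> and \<open>b\<close> are the two derivatives of
    \<open>ln h\<close>, so their cross derivatives agree.\<close>
  have "pd \<i> (pd 1 h) p = pd 1 (pd \<i> h) p"
    by (rule pd_commute_real[OF open_U p smooth_h])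
  then have ab: "pd \<i> a p = pd 1 b p"
    unfolding a_def[abs_def] b_def[abs_def] by (simp add: pa d pd_k[OF p])
  have 12: "pd \<i> (pd 1 \<Psi>) p = pd \<i> a p *\<^sub>R (Y p - \<Psi> p) + (a p * b p) *\<^sub>R (Y p + \<Psi> p) - pd \<i> (pd 1 Y) p"
  proof -
    have "pd \<i> (pd 1 \<Psi>) p = pd \<i> (\<lambda>q. a q *\<^sub>R (Y q - \<Psi> q) - pd 1 Y q) p"
      by (rule pd_cong_open[OF open_U p]) (simp add: \<Psi>_pd1 a_def)
    also have "\<dots> = a p *\<^sub>R (pd \<i> Y p - pd \<i> \<Psi> p) + pd \<i> a p *\<^sub>R (Y p - \<Psi> p) - pd \<i> (pd 1 Y) p"
      by (simp add: pd_diff pd_scaleR d da)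
    finally show ?thesis by (simp add: \<Psi>_pd2[OF p] b_def)
  qed
  have 21: "pd 1 (pd \<i> \<Psi>) p = pd 1 (pd \<i> Y) p - (a p * b p) *\<^sub>R (Y p - \<Psi> p) - pd 1 b p *\<^sub>R (Y p + \<Psi> p)"
  proof -
    have "pd 1 (pd \<i> \<Psi>) p = pd 1 (\<lambda>q. pd \<i> Y q - b q *\<^sub>R (Y q + \<Psi> q)) p"
      by (rule pd_cong_open[OF open_U p]) (simp add: \<Psi>_pd2 b_def)
    also have "\<dots> = pd 1 (pd \<i> Y) p - (b p *\<^sub>R (pd 1 Y p + pd 1 \<Psi> p) + pd 1 b p *\<^sub>R (Y p + \<Psi> p))"
      by (simp add: pd_diff pd_add pd_scaleR d da)
    finally show ?thesis by (simp add: \<Psi>_pd1[OF p] a_def algebra_simps)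
  qed
  have "2 *\<^sub>R pd \<i> (pd 1 \<Psi>) p = pd \<i> (pd 1 \<Psi>) p + pd 1 (pd \<i> \<Psi>) p"
    using polar.Y12_commute[OF p] by (simp add: scaleR_2)
  also have "\<dots> = 2 *\<^sub>R ((a p * b p - pd \<i> a p) *\<^sub>R \<Psi> p)"
    unfolding 12 21 ab Y12_commute[OF p] by (simp add: vec_eq_iff algebra_simps)
  finally show ?thesis by (metis scaleR_left_imp_eq zero_neq_numeral)
qed

lemma span_\<Psi>: "p \<in> U \<Longrightarrow> span {F p} = span {\<Psi> p}"
proof -
  assume p: "p \<in> U"
  have "k p \<noteq> 0" using h_pos[OF p] by (simp add: k_def)
  then show ?thesis
    unfolding span_eq by (auto simp: \<Psi>_def span_singleton intro!: image_eqI[of _ _ "inverse (k p)"] rangeI)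
qed

lemma isothermic_polar: "isothermic_adapted \<epsilon> U (\<lambda>p. span {F p})"
  by (rule polar.isothermic_adaptedI[OF span_\<Psi> \<Psi>_isothermic])

end

locale polar_gauge_pair = gauge_pair \<epsilon> U Y Y' T c' + P: polar_lift \<epsilon> U Y F h
  for \<epsilon> :: "'m::finite \<Rightarrow> real" and U Y Y' T c' F h
begin

definition F' :: "complex \<Rightarrow> real^'m" where "F' p = T p (F p)"

text \<open>\<open>F'\<close> is orthogonal to \<open>Y'\<close> and its derivatives, so the
  connection form vanishes on it.\<close>

lemma F'_pd: assumes p: "p \<in> U" shows "pd 1 F' p = T p (pd 1 F p)" "pd \<i> F' p = T p (pd \<i> F p)"
proof -
  have z: "sprod \<epsilon> (T p (F p)) (Y' p) = 0" "sprod \<epsilon> (T p (F p)) (pd 1 Y' p) = 0"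
    "sprod \<epsilon> (T p (F p)) (pd \<i> Y' p) = 0"
    by (simp_all add: T_Y[OF p, symmetric] T_Y1[OF p] T_Y2[OF p] T_isometry[OF p] P.F_Y[OF p] P.F_pd[OF p])
  show "pd 1 F' p = T p (pd 1 F p)" "pd \<i> F' p = T p (pd \<i> F p)"
    unfolding F'_def[abs_def] pd_T[OF A.open_U order_refl P.smooth_F p] T_pd1[OF p] T_pd2[OF p] z by simp_all
qed

text \<open>Both polar surfaces share the same \<open>h\<close>, since \<open>T\<close> carries the
  structure equations of \<open>F\<close> over unchanged.\<close>

sublocale P': polar_lift \<epsilon> U Y' F' h
proof
  show "smooth_on U F'" unfolding F'_def[abs_def] by (rule smooth_T) auto
  fix p assume p: "p \<in> U"
  note lin = linear_diff[OF T_linear[OF p]] linear_scale[OF T_linear[OF p]] linear_neg[OF T_linear[OF p]]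
  show "F' p \<noteq> 0"
    using T_inj[OF p] P.F_nonzero[OF p] linear_0[OF T_linear[OF p]] unfolding F'_def by (metis injD)
  show "sprod \<epsilon> (F' p) (F' p) = 0" "sprod \<epsilon> (F' p) (Y' p) = 0"
    by (simp_all add: F'_def T_isometry[OF p] P.F_null[OF p] T_Y[OF p, symmetric] P.F_Y[OF p])
  show "pd 1 F' p = 2 *\<^sub>R (pd 1 h p *\<^sub>R Y' p - h p *\<^sub>R pd 1 Y' p)"
    by (simp add: F'_pd[OF p] P.F_pd1[OF p] T_Y1[OF p] T_Y[OF p, symmetric] lin)
  show "pd \<i> F' p = - 2 *\<^sub>R (pd \<i> h p *\<^sub>R Y' p - h p *\<^sub>R pd \<i> Y' p)"
    by (simp add: F'_pd[OF p] P.F_pd2[OF p] T_Y2[OF p] T_Y[OF p, symmetric] lin)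
qed (auto intro: P.h_pos)

lemma T_\<Psi>: "p \<in> U \<Longrightarrow> T p (P.\<Psi> p) = P'.\<Psi> p"
  by (simp add: P.\<Psi>_def P'.\<Psi>_def F'_def P.k_def P'.k_def linear_scale[OF T_linear])

text \<open>The correction of \<open>T p x\<close> is \<open>c'\<close> times
  \<open>Y' \<and> \<Psi>'\<close>, a map with square zero; hence the exponential series stops after
  the linear term.\<close>

definition S :: "complex \<Rightarrow> real^'m \<Rightarrow> real^'m" where
  "S p x = T p x - c' *\<^sub>R (sprod \<epsilon> (T p x) (P'.\<Psi> p) *\<^sub>R Y' p - sprod \<epsilon> (T p x) (Y' p) *\<^sub>R P'.\<Psi> p)"

lemma pd_S: assumes p: "p \<in> U"
  shows "pd v (\<lambda>q. S q x) p = (let t = T p x; t' = pd v (\<lambda>q. T q x) p in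
    t' - c' *\<^sub>R (sprod \<epsilon> t (P'.\<Psi> p) *\<^sub>R pd v Y' p + (sprod \<epsilon> t (pd v P'.\<Psi> p) + sprod \<epsilon> t' (P'.\<Psi> p)) *\<^sub>R Y' p
      - (sprod \<epsilon> t (Y' p) *\<^sub>R pd v P'.\<Psi> p + (sprod \<epsilon> t (pd v Y' p) + sprod \<epsilon> t' (Y' p)) *\<^sub>R P'.\<Psi> p)))"
proof -
  have d: "(\<lambda>q. T q x) differentiable (at p)" by (rule smooth_on_differentiable[OF T_smooth p])
  note d' = P'.differentiable_frame[OF p]
  note ds = differentiable_bilinear[OF bounded_bilinear_sprod]
  show ?thesis
    unfolding S_def[abs_def] Let_def
    by (simp add: pd_diff pd_scaleR_const pd_scaleR pd_bilinear[OF bounded_bilinear_sprod] d d' ds)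
qed

sublocale polar: gauge_pair \<epsilon> U P.\<Psi> P'.\<Psi> S c'
proof
  show "\<epsilon> i \<noteq> 0" for i by (rule sign_nonzero)
  show "smooth_on U (\<lambda>p. S p x)" for x
    unfolding S_def[abs_def] by (intro smooth_intros A.open_U T_smooth) auto
  fix p assume p: "p \<in> U"
  show "S p (x + y) = S p x + S p y" "S p (r *\<^sub>R x) = r *\<^sub>R S p x" for x y r
    by (simp_all add: S_def linear_add[OF T_linear[OF p]] linear_scale[OF T_linear[OF p]] algebra_simps)
  show "sprod \<epsilon> (S p u) (S p v) = sprod \<epsilon> u v" for u v
    using sprod_commute[of \<epsilon> "Y' p" "T p v"] sprod_commute[of \<epsilon> "P'.\<Psi> p" "T p v"]
    by (simp add: S_def T_isometry[OF p] B.gram(1)[OF p] P'.\<Psi>_gram[OF p] algebra_simps)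
  show "S p (P.\<Psi> p) = P'.\<Psi> p"
    by (simp add: S_def T_\<Psi>[OF p] P'.\<Psi>_gram[OF p])
  fix x
  show "pd 1 (\<lambda>q. S q x) p =
      c' *\<^sub>R (sprod \<epsilon> (S p x) (P'.\<Psi> p) *\<^sub>R pd 1 P'.\<Psi> p - sprod \<epsilon> (S p x) (pd 1 P'.\<Psi> p) *\<^sub>R P'.\<Psi> p)"
    \<comment> \<open>To first order in \<open>c'\<close> this is the identity
      \<open>pd 1 B = \<Psi>' \<and> pd 1 \<Psi>' - Y' \<and> pd 1 Y'\<close> for
      \<open>B = Y' \<and> \<Psi>'\<close>, a consequence of the formula for
      \<open>pd 1 \<Psi>'\<close>; the terms of higher order cancel.\<close>
    unfolding pd_S[OF p] Let_def T_pd1[OF p] P'.\<Psi>_pd1[OF p]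
    unfolding S_def
    by (simp add: P'.\<Psi>_gram[OF p] B.gram[OF p] vec_eq_iff algebra_simps)
  show "pd \<i> (\<lambda>q. S q x) p =
      - c' *\<^sub>R (sprod \<epsilon> (S p x) (P'.\<Psi> p) *\<^sub>R pd \<i> P'.\<Psi> p - sprod \<epsilon> (S p x) (pd \<i> P'.\<Psi> p) *\<^sub>R P'.\<Psi> p)"
    unfolding pd_S[OF p] Let_def T_pd2[OF p] P'.\<Psi>_pd2[OF p]
    unfolding S_def
    by (simp add: P'.\<Psi>_gram[OF p] B.gram[OF p] vec_eq_iff algebra_simps)
qed

theorem spectral_transform_polar:
  "spectral_transform \<epsilon> U c' (\<lambda>p. span {F p}) (\<lambda>p. span {F' p})"
  by (rule polar.spectral_transformI[OF P.isothermic_polar P'.isothermic_polar P.span_\<Psi> P'.span_\<Psi>])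

end

section \<open>From normal bundle isometries to gauge transformations\<close>

text \<open>By \<open>hopf_parts\<close> this says exactly that the imaginary part of the Hopf
  differential vanishes.\<close>

locale isothermic_lift = conformal_lift +
  assumes Y12: "p \<in> U \<Longrightarrow> pd \<i> (pd 1 Y) p = s2 p *\<^sub>R Y p"
begin

lemma Y21: "p \<in> U \<Longrightarrow> pd 1 (pd \<i> Y) p = s2 p *\<^sub>R Y p"
  using Y12 Y12_commute by simp

lemma second_derivatives:
  shows "pd 1 (pd 1 Y) p = 2 *\<^sub>R L p + 2 *\<^sub>R \<kappa> p - s1 p *\<^sub>R Y p"
    and "pd \<i> (pd \<i> Y) p = 2 *\<^sub>R L p - 2 *\<^sub>R \<kappa> p + s1 p *\<^sub>R Y p"
  by (simp_all add: L_def \<kappa>_def s1_def vec_eq_iff field_simps)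

text \<open>The Gauss equation of the flat metric. Differentiating two vanishing products with
  \<open>pd \<i> Y\<close> produces the same third derivative, and the mixed derivative, a multiple
  of the null vector \<open>Y\<close>, has square zero.\<close>

lemma gauss: assumes p: "p \<in> U" shows "sprod \<epsilon> (pd 1 (pd 1 Y) p) (pd \<i> (pd \<i> Y) p) = 0"
proof -
  have "sprod \<epsilon> (pd \<i> Y p) (pd \<i> (pd 1 (pd 1 Y)) p) = - sprod \<epsilon> (pd \<i> (pd \<i> Y) p) (pd 1 (pd 1 Y) p)"
    by (rule sprod_const_pdU[OF _ _ gram2(5) p]) auto
  moreover have "sprod \<epsilon> (pd \<i> Y p) (pd 1 (pd \<i> (pd 1 Y)) p) = - sprod \<epsilon> (pd 1 (pd \<i> Y) p) (pd \<i> (pd 1 Y) p)"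
    by (rule sprod_const_pdU[OF _ _ gram2(9) p]) auto
  moreover have "pd \<i> (pd 1 (pd 1 Y)) p = pd 1 (pd \<i> (pd 1 Y)) p"
    by (rule pd_commute[OF open_U p]) auto
  ultimately show ?thesis
    by (simp add: Y12[OF p] Y21[OF p] gram[OF p] sprod_commute[of \<epsilon> "pd 1 (pd 1 Y) p"])
qed

text \<open>This is \<open>gauss\<close> expanded in \<open>L\<close>, \<open>\<kappa>\<close> and
  \<open>Y\<close>. It expresses the only product of the frame that is not constant through
  \<open>\<kappa>\<close>, and so makes it comparable between the two surfaces.\<close>

lemma L_square: assumes p: "p \<in> U" shows "sprod \<epsilon> (L p) (L p) = sprod \<epsilon> (\<kappa> p) (\<kappa> p)"
proof -
  have n: "sprod \<epsilon> (\<kappa> p) (L p) = 0" "sprod \<epsilon> (L p) (\<kappa> p) = 0" "sprod \<epsilon> (\<kappa> p) (Y p) = 0" "sprod \<epsilon> (Y p) (\<kappa> p) = 0"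
    using \<kappa>_normal[OF p] by (simp_all add: normal_space_iff[OF p] sprod_commute)
  show ?thesis
    using gauss[OF p] unfolding second_derivatives
    by (simp add: n gram[OF p] gram_L[OF p] algebra_simps)
qed

text \<open>The Weingarten equations. The coefficients of the derivatives of \<open>Y\<close> come
  from pairing \<open>\<phi>\<close> with second derivatives. The coefficient of \<open>Y\<close>
  would involve the derivative of \<open>N\<close>, and is obtained from a Codazzi argument instead.
  The result uses only the normal derivative and products with \<open>\<kappa>\<close>, all of which
  a spectral transform preserves.\<close>

lemma normal_section_derivatives:
  assumes W: "open W" "W \<subseteq> U" and \<phi>: "normal_section \<epsilon> Y W \<phi>" and p: "p \<in> W"
  shows "pd 1 \<phi> p = nproj p (pd 1 \<phi> p)
      + (2 * pd 1 (\<lambda>q. sprod \<epsilon> (\<phi> q) (\<kappa> q)) p - 2 * sprod \<epsilon> (nproj p (pd 1 \<phi> p)) (\<kappa> p)) *\<^sub>R Y p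
      - (2 * sprod \<epsilon> (\<phi> p) (\<kappa> p)) *\<^sub>R pd 1 Y p" (is ?first)
    and "pd \<i> \<phi> p = nproj p (pd \<i> \<phi> p)
      - (2 * pd \<i> (\<lambda>q. sprod \<epsilon> (\<phi> q) (\<kappa> q)) p - 2 * sprod \<epsilon> (nproj p (pd \<i> \<phi> p)) (\<kappa> p)) *\<^sub>R Y p
      + (2 * sprod \<epsilon> (\<phi> p) (\<kappa> p)) *\<^sub>R pd \<i> Y p" (is ?second)
proof -
  have U: "q \<in> W \<Longrightarrow> q \<in> U" for q using W by auto
  have sm: "smooth_on W \<phi>" and n: "q \<in> W \<Longrightarrow> \<phi> q \<in> normal_space \<epsilon> Y q" for q
    using \<phi> by (auto simp: normal_section_def)
  have n0: "sprod \<epsilon> (\<phi> q) (Y q) = 0" "sprod \<epsilon> (\<phi> q) (pd 1 Y q) = 0" "sprod \<epsilon> (\<phi> q) (pd \<i> Y q) = 0"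
    "sprod \<epsilon> (\<phi> q) (L q) = 0" if "q \<in> W" for q
    using n[OF that] by (auto simp: normal_space_iff[OF U[OF that]])
  have smW: "smooth_on W Y" "smooth_on W (pd v Y)" "smooth_on W \<kappa>" for v
    using smooth_on_subset[OF _ W(2)] by auto
  have smp: "smooth_on W (pd v \<phi>)" for v using smooth_on_pd sm by blast
  define h where "h q = sprod \<epsilon> (\<phi> q) (\<kappa> q)" for q
  have smh: "smooth_on W h" unfolding h_def[abs_def] by (intro smooth_on_sprod W sm smW)
  have dY: "sprod \<epsilon> (pd v \<phi> q) (Y q) = 0" if "q \<in> W" "v = 1 \<or> v = \<i>" for q v
    using sprod_const_pd[OF W(1) sm smW(1) that(1) n0(1), of v] n0[OF that(1)] that(2) by auto
  have d1: "sprod \<epsilon> (pd v \<phi> q) (pd 1 Y q) = - sprod \<epsilon> (\<phi> q) (pd v (pd 1 Y) q)"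
    "sprod \<epsilon> (pd v \<phi> q) (pd \<i> Y q) = - sprod \<epsilon> (\<phi> q) (pd v (pd \<i> Y) q)" if "q \<in> W" for q v
    using sprod_const_pd[OF W(1) sm smW(2) that n0(2), of v] sprod_const_pd[OF W(1) sm smW(2) that n0(3), of v] by auto
  have f: "sprod \<epsilon> (pd 1 \<phi> q) (pd 1 Y q) = - 2 * h q" "sprod \<epsilon> (pd 1 \<phi> q) (pd \<i> Y q) = 0"
    "sprod \<epsilon> (pd \<i> \<phi> q) (pd 1 Y q) = 0" "sprod \<epsilon> (pd \<i> \<phi> q) (pd \<i> Y q) = 2 * h q" if q: "q \<in> W" for q
    unfolding d1[OF q] Y12[OF U[OF q]] Y21[OF U[OF q]] second_derivatives using n0[OF q] by (simp_all add: h_def)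
  have \<kappa>0: "sprod \<epsilon> (Y p) (\<kappa> p) = 0" "sprod \<epsilon> (pd 1 Y p) (\<kappa> p) = 0" "sprod \<epsilon> (pd \<i> Y p) (\<kappa> p) = 0"
    using \<kappa>_normal[OF U[OF p]] by (auto simp: normal_space_iff[OF U[OF p]] sprod_commute)
  define X where "X v = nproj p (pd v \<phi> p)" for v
  have X: "sprod \<epsilon> (X v) (Y p) = 0" "sprod \<epsilon> (X v) (L p) = 0" for v
    using nproj_normal[OF U[OF p], of "pd v \<phi> p"] by (auto simp: normal_space_iff[OF U[OF p]] X_def)
  have dec: "pd v \<phi> p = X v - sprod \<epsilon> (pd v \<phi> p) (N p) *\<^sub>R Y p
      + sprod \<epsilon> (pd v \<phi> p) (pd 1 Y p) *\<^sub>R pd 1 Y p + sprod \<epsilon> (pd v \<phi> p) (pd \<i> Y p) *\<^sub>R pd \<i> Y p" 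
      if "v = 1 \<or> v = \<i>" for v
    by (simp add: X_def nproj_def dY[OF p that])
  define \<alpha> where "\<alpha> = - sprod \<epsilon> (pd 1 \<phi> p) (N p)"
  define \<beta> where "\<beta> = - sprod \<epsilon> (pd \<i> \<phi> p) (N p)"
  have e1: "pd 1 \<phi> p = X 1 + \<alpha> *\<^sub>R Y p - (2 * h p) *\<^sub>R pd 1 Y p"
    using dec[of 1] f[OF p] by (simp add: \<alpha>_def)
  have e2: "pd \<i> \<phi> p = X \<i> + \<beta> *\<^sub>R Y p + (2 * h p) *\<^sub>R pd \<i> Y p"
    using dec[of \<i>] f[OF p] by (simp add: \<beta>_def)
  have comm: "pd \<i> (pd 1 \<phi>) p = pd 1 (pd \<i> \<phi>) p" by (rule pd_commute[OF W(1) p sm])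
  have hder: "pd v (\<lambda>q. c * h q) p = c * pd v h p" for v c
    using pd_linear[OF bounded_linear_mult_right smooth_on_differentiable[OF smh p]] .
  \<comment> \<open>\<open>\<alpha>\<close> and \<open>\<beta>\<close> are found by comparing the mixed derivatives of \<open>\<phi>\<close>.\<close>
  have "sprod \<epsilon> (pd 1 \<phi> p) (pd \<i> (pd \<i> Y) p) = - sprod \<epsilon> (pd \<i> (pd 1 \<phi>) p) (pd \<i> Y p)"
    by (rule sprod_const_pd[OF W(1) smp smW(2) p f(2)])
  moreover have "sprod \<epsilon> (pd 1 \<phi> p) (pd \<i> (pd \<i> Y) p) = - 2 * sprod \<epsilon> (X 1) (\<kappa> p) - \<alpha>"
    unfolding e1 second_derivatives by (simp add: X gram[OF U[OF p]] gram_L[OF U[OF p]] \<kappa>0)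
  moreover have "sprod \<epsilon> (pd \<i> \<phi> p) (pd 1 (pd \<i> Y) p) + sprod \<epsilon> (pd 1 (pd \<i> \<phi>) p) (pd \<i> Y p) = 2 * pd 1 h p"
    unfolding pd_sprod[OF smp smW(2) p, symmetric] hder[symmetric]
    by (rule pd_cong_open[OF W(1) p f(4)])
  moreover have "sprod \<epsilon> (pd \<i> \<phi> p) (pd 1 (pd \<i> Y) p) = 0"
    using dY[OF p, of \<i>] by (simp add: Y21[OF U[OF p]])
  ultimately have \<alpha>: "\<alpha> = 2 * pd 1 h p - 2 * sprod \<epsilon> (X 1) (\<kappa> p)" using comm by simp
  have "sprod \<epsilon> (pd \<i> \<phi> p) (pd 1 (pd 1 Y) p) = - sprod \<epsilon> (pd 1 (pd \<i> \<phi>) p) (pd 1 Y p)"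
    by (rule sprod_const_pd[OF W(1) smp smW(2) p f(3)])
  moreover have "sprod \<epsilon> (pd \<i> \<phi> p) (pd 1 (pd 1 Y) p) = 2 * sprod \<epsilon> (X \<i>) (\<kappa> p) - \<beta>"
    unfolding e2 second_derivatives by (simp add: X gram[OF U[OF p]] gram_L[OF U[OF p]] \<kappa>0)
  moreover have "sprod \<epsilon> (pd 1 \<phi> p) (pd \<i> (pd 1 Y) p) + sprod \<epsilon> (pd \<i> (pd 1 \<phi>) p) (pd 1 Y p) = - 2 * pd \<i> h p"
    unfolding pd_sprod[OF smp smW(2) p, symmetric] hder[symmetric]
    by (rule pd_cong_open[OF W(1) p f(1)])
  moreover have "sprod \<epsilon> (pd 1 \<phi> p) (pd \<i> (pd 1 Y) p) = 0"
    using dY[OF p, of 1] by (simp add: Y12[OF U[OF p]])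
  ultimately have \<beta>: "\<beta> = - (2 * pd \<i> h p - 2 * sprod \<epsilon> (X \<i>) (\<kappa> p))" using comm by simp
  show ?first ?second
    using e1 e2 unfolding \<alpha> \<beta> h_def[abs_def] X_def scaleR_minus_left by simp_all
qed

end

text \<open>The content of a spectral transform for one fixed pair of lifts on a common
  domain.\<close>

locale normal_isometry = A: isothermic_lift \<epsilon> U Y + B: isothermic_lift \<epsilon> U Y'
  for \<epsilon> :: "'m::finite \<Rightarrow> real" and U Y Y' +
  fixes \<Phi> :: "complex \<Rightarrow> real^'m \<Rightarrow> real^'m" and c' :: real
  assumes sign_nonzero: "\<epsilon> i \<noteq> 0"
    and schwarzian_shift: "p \<in> U \<Longrightarrow> schwarzian \<epsilon> Y' p = schwarzian \<epsilon> Y p + of_real c'"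
    and \<Phi>_bij: "p \<in> U \<Longrightarrow> bij_betw (\<Phi> p) (normal_space \<epsilon> Y p) (normal_space \<epsilon> Y' p)"
    and \<Phi>_lin: "p \<in> U \<Longrightarrow> u \<in> normal_space \<epsilon> Y p \<Longrightarrow> v \<in> normal_space \<epsilon> Y p \<Longrightarrow>
      \<Phi> p (a *\<^sub>R u + b *\<^sub>R v) = a *\<^sub>R \<Phi> p u + b *\<^sub>R \<Phi> p v"
    and \<Phi>_isometry: "p \<in> U \<Longrightarrow> u \<in> normal_space \<epsilon> Y p \<Longrightarrow> v \<in> normal_space \<epsilon> Y p \<Longrightarrow>
      sprod \<epsilon> (\<Phi> p u) (\<Phi> p v) = sprod \<epsilon> u v"
    and \<Phi>_hopf: "p \<in> U \<Longrightarrow> u \<in> normal_space \<epsilon> Y p \<Longrightarrow>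
      sprod \<epsilon> (hopf \<epsilon> Y' p) (cvec (\<Phi> p u)) = sprod \<epsilon> (hopf \<epsilon> Y p) (cvec u)"
    and \<Phi>_smooth: "open W \<Longrightarrow> W \<subseteq> U \<Longrightarrow> normal_section \<epsilon> Y W \<phi> \<Longrightarrow> smooth_on W (\<lambda>q. \<Phi> q (\<phi> q))"
    and \<Phi>_Dz: "open W \<Longrightarrow> W \<subseteq> U \<Longrightarrow> normal_section \<epsilon> Y W \<phi> \<Longrightarrow> p \<in> W \<Longrightarrow>
      Dz \<epsilon> Y' (\<lambda>q. \<Phi> q (\<phi> q)) p = cextend (\<Phi> p) (Dz \<epsilon> Y \<phi> p)"
begin

lemma \<Phi>_normal: "p \<in> U \<Longrightarrow> u \<in> normal_space \<epsilon> Y p \<Longrightarrow> \<Phi> p u \<in> normal_space \<epsilon> Y' p"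
  using \<Phi>_bij by (auto simp: bij_betw_def)

lemma \<Phi>_add: "p \<in> U \<Longrightarrow> u \<in> normal_space \<epsilon> Y p \<Longrightarrow> v \<in> normal_space \<epsilon> Y p \<Longrightarrow>
      \<Phi> p (u + v) = \<Phi> p u + \<Phi> p v"
  using \<Phi>_lin[of p u v 1 1] by simp

lemma \<Phi>_scale: "p \<in> U \<Longrightarrow> u \<in> normal_space \<epsilon> Y p \<Longrightarrow> \<Phi> p (a *\<^sub>R u) = a *\<^sub>R \<Phi> p u"
  using \<Phi>_lin[of p u u a 0] by simp

lemma zero_normal: "p \<in> U \<Longrightarrow> 0 \<in> normal_space \<epsilon> Y p"
  by (simp add: A.normal_space_iff)

lemma \<Phi>_zero: "p \<in> U \<Longrightarrow> \<Phi> p 0 = 0"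
  using \<Phi>_scale[OF _ zero_normal, of p 0] by simp

lemma \<Phi>_section: "open W \<Longrightarrow> W \<subseteq> U \<Longrightarrow> normal_section \<epsilon> Y W \<phi> \<Longrightarrow> normal_section \<epsilon> Y' W (\<lambda>q. \<Phi> q (\<phi> q))"
  using \<Phi>_smooth \<Phi>_normal by (auto simp: normal_section_def)

lemma \<Phi>_nproj:
  assumes W: "open W" "W \<subseteq> U" and \<phi>: "normal_section \<epsilon> Y W \<phi>" and p: "p \<in> W" and v: "v = 1 \<or> v = \<i>"
  shows "B.nproj p (pd v (\<lambda>q. \<Phi> q (\<phi> q)) p) = \<Phi> p (A.nproj p (pd v \<phi> p))"
proof -
  have pU: "p \<in> U" using p W by auto
  have d: "\<phi> differentiable (at p)" "(\<lambda>q. \<Phi> q (\<phi> q)) differentiable (at p)"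
    using smooth_on_differentiable[OF _ p] \<phi> \<Phi>_smooth[OF W \<phi>] by (auto simp: normal_section_def)
  have "re_vec (Dz \<epsilon> Y' (\<lambda>q. \<Phi> q (\<phi> q)) p) = \<Phi> p (re_vec (Dz \<epsilon> Y \<phi> p))"
    "im_vec (Dz \<epsilon> Y' (\<lambda>q. \<Phi> q (\<phi> q)) p) = \<Phi> p (im_vec (Dz \<epsilon> Y \<phi> p))"
    by (simp_all add: \<Phi>_Dz[OF W \<phi> p] cextend_def)
  then have "(1/2) *\<^sub>R B.nproj p (pd 1 (\<lambda>q. \<Phi> q (\<phi> q)) p) = (1/2) *\<^sub>R \<Phi> p (A.nproj p (pd 1 \<phi> p))"
    "(-(1/2)) *\<^sub>R B.nproj p (pd \<i> (\<lambda>q. \<Phi> q (\<phi> q)) p) = (-(1/2)) *\<^sub>R \<Phi> p (A.nproj p (pd \<i> \<phi> p))"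
    unfolding A.Dz_parts[OF pU d(1)] B.Dz_parts[OF pU d(2)]
    using \<Phi>_scale[OF pU A.nproj_normal[OF pU]] by metis+
  then show ?thesis using v by auto
qed

lemma hopf_real: "p \<in> U \<Longrightarrow> hopf \<epsilon> Y p = cvec (A.\<kappa> p)" "p \<in> U \<Longrightarrow> hopf \<epsilon> Y' p = cvec (B.\<kappa> p)"
  using A.isothermic_hopf B.isothermic_hopf A.isothermicI[OF _ A.Y12] B.isothermicI[OF _ B.Y12] by auto

lemma \<Phi>_\<kappa>_prod: "p \<in> U \<Longrightarrow> u \<in> normal_space \<epsilon> Y p \<Longrightarrow> sprod \<epsilon> (\<Phi> p u) (B.\<kappa> p) = sprod \<epsilon> u (A.\<kappa> p)"
  using \<Phi>_hopf[of p u] by (simp add: hopf_real sprod_cvec sprod_commute)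

text \<open>The extension of \<open>\<Phi>\<close> that sends the frame of \<open>Y\<close> to the
  frame of \<open>Y'\<close>; the minus signs undo the product -1 of \<open>Y\<close> and
  \<open>N\<close>, as in \<open>nproj\<close>.\<close>

definition T :: "complex \<Rightarrow> real^'m \<Rightarrow> real^'m" where
  "T p x = \<Phi> p (A.nproj p x) - sprod \<epsilon> x (A.N p) *\<^sub>R Y' p - sprod \<epsilon> x (Y p) *\<^sub>R B.N p
     + sprod \<epsilon> x (pd 1 Y p) *\<^sub>R pd 1 Y' p + sprod \<epsilon> x (pd \<i> Y p) *\<^sub>R pd \<i> Y' p"

lemma T_normal: "p \<in> U \<Longrightarrow> u \<in> normal_space \<epsilon> Y p \<Longrightarrow> T p u = \<Phi> p u"
  by (simp add: T_def A.nproj_id A.normal_space_N) (simp add: A.normal_space_iff)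

lemma T_add: assumes p: "p \<in> U" shows "T p (x + y) = T p x + T p y"
  by (simp add: T_def linear_add[OF A.linear_nproj] \<Phi>_add[OF p A.nproj_normal[OF p] A.nproj_normal[OF p]] algebra_simps)

lemma T_scale: assumes p: "p \<in> U" shows "T p (r *\<^sub>R x) = r *\<^sub>R T p x"
  by (simp add: T_def linear_scale[OF A.linear_nproj] \<Phi>_scale[OF p A.nproj_normal[OF p]] algebra_simps)

lemma T_linear: "p \<in> U \<Longrightarrow> linear (T p)"
  by (simp add: linearI T_add T_scale)

lemma T_frame: assumes p: "p \<in> U"
  shows "T p (Y p) = Y' p" "T p (pd 1 Y p) = pd 1 Y' p" "T p (pd \<i> Y p) = pd \<i> Y' p" "T p (A.N p) = B.N p"
  by (simp_all add: T_def A.nproj_frame[OF p] \<Phi>_zero[OF p] A.gram[OF p] A.gram_N[OF p])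

lemma T_isometry: assumes p: "p \<in> U" shows "sprod \<epsilon> (T p x) (T p w) = sprod \<epsilon> x w"
proof -
  let ?x = "A.nproj p x" and ?w = "A.nproj p w"
  have n: "?x \<in> normal_space \<epsilon> Y p" "?w \<in> normal_space \<epsilon> Y p" using A.nproj_normal[OF p] by auto
  have nx: "sprod \<epsilon> (\<Phi> p ?x) u = 0" "sprod \<epsilon> u (\<Phi> p ?w) = 0"
    if "u = Y' p \<or> u = pd 1 Y' p \<or> u = pd \<i> Y' p \<or> u = B.N p" for u
    using \<Phi>_normal[OF p n(1)] \<Phi>_normal[OF p n(2)] that B.normal_space_N[OF p]
    by (auto simp: B.normal_space_iff[OF p] sprod_commute[of \<epsilon> _ "\<Phi> p (A.nproj p w)"])
  have "sprod \<epsilon> (T p x) (T p w) = sprod \<epsilon> ?x ?w - sprod \<epsilon> x (A.N p) * sprod \<epsilon> w (Y p)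
      - sprod \<epsilon> x (Y p) * sprod \<epsilon> w (A.N p) + sprod \<epsilon> x (pd 1 Y p) * sprod \<epsilon> w (pd 1 Y p)
      + sprod \<epsilon> x (pd \<i> Y p) * sprod \<epsilon> w (pd \<i> Y p)"
    by (simp add: T_def nx \<Phi>_isometry[OF p n] B.gram[OF p] B.gram_N[OF p])
  also have "\<dots> = sprod \<epsilon> x w"
    by (simp add: A.nproj_def A.gram[OF p] A.gram_N[OF p] sprod_commute[of \<epsilon> "Y p" w]
      sprod_commute[of \<epsilon> "pd _ Y p" w] sprod_commute[of \<epsilon> "A.N p" w] algebra_simps)
  finally show ?thesis .
qed

text \<open>A normal vector is determined by its products with normal vectors, since any
  \<open>v\<close> pairs with it only through \<open>nproj\<close>. All normal vectors of
  \<open>Y'\<close> are images under \<open>\<Phi>\<close>, on which the Hopf condition settles the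
  products.\<close>

lemma T_\<kappa>: assumes p: "p \<in> U" shows "T p (A.\<kappa> p) = B.\<kappa> p"
proof -
  note n = A.\<kappa>_normal[OF p]
  have "\<Phi> p (A.\<kappa> p) - B.\<kappa> p = 0"
  proof (rule sprod_nondegenerate[OF sign_nonzero])
    fix v
    have diff: "\<Phi> p (A.\<kappa> p) - B.\<kappa> p \<in> normal_space \<epsilon> Y' p"
      using \<Phi>_normal[OF p n] B.\<kappa>_normal[OF p] by (simp add: B.normal_space_iff[OF p])
    obtain u where u: "u \<in> normal_space \<epsilon> Y p" "\<Phi> p u = B.nproj p v"
      using \<Phi>_bij[OF p] B.nproj_normal[OF p] by (metis bij_betw_iff_bijections)
    have "sprod \<epsilon> (\<Phi> p (A.\<kappa> p) - B.\<kappa> p) v = sprod \<epsilon> (\<Phi> p (A.\<kappa> p) - B.\<kappa> p) (B.nproj p v)"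
      using diff B.normal_space_N[OF p diff] unfolding B.nproj_def
      by (simp add: B.normal_space_iff[OF p])
    also have "\<dots> = 0"
      using u \<Phi>_isometry[OF p n u(1)] \<Phi>_\<kappa>_prod[OF p u(1)]
      by (simp add: sprod_commute[of \<epsilon> "B.\<kappa> p"] sprod_commute[of \<epsilon> "A.\<kappa> p"])
    finally show "sprod \<epsilon> (\<Phi> p (A.\<kappa> p) - B.\<kappa> p) v = 0" .
  qed
  then show ?thesis using T_normal[OF p n] by simp
qed

text \<open>\<open>T\<close> matches \<open>N\<close> by construction; \<open>L\<close> differs from
  half of \<open>N\<close> by a multiple of \<open>Y\<close> whose coefficient is the square of
  \<open>L\<close>, which by \<open>L_square\<close> is the square of
  \<open>\<kappa>\<close>.\<close>

lemma T_L: assumes p: "p \<in> U" shows "T p (A.L p) = B.L p"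
proof -
  have "sprod \<epsilon> (B.L p) (B.L p) = sprod \<epsilon> (A.L p) (A.L p)"
    unfolding A.L_square[OF p] B.L_square[OF p] T_\<kappa>[OF p, symmetric] T_isometry[OF p] ..
  moreover have "A.L p = (1/2) *\<^sub>R A.N p - sprod \<epsilon> (A.L p) (A.L p) *\<^sub>R Y p" by (simp add: A.N_def)
  moreover have "B.L p = (1/2) *\<^sub>R B.N p - sprod \<epsilon> (B.L p) (B.L p) *\<^sub>R Y' p" by (simp add: B.N_def)
  ultimately show ?thesis
    using linear_diff[OF T_linear[OF p]] T_scale[OF p] T_frame[OF p] by metis
qed

lemma T_smooth: "smooth_on U (\<lambda>p. T p x)"
proof -
  have "normal_section \<epsilon> Y U (\<lambda>q. A.nproj q x)"
    using A.smooth_nproj[OF order_refl A.open_U smooth_on_const] A.nproj_normal by (simp add: normal_section_def)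
  from \<Phi>_smooth[OF A.open_U order_refl this] show ?thesis
    unfolding T_def by (intro smooth_intros A.open_U) auto
qed

lemma schwarzian_parts: assumes p: "p \<in> U" shows "B.s1 p = A.s1 p + c'" "B.s2 p = A.s2 p"
  using schwarzian_shift[OF p] by (simp_all add: A.schwarzian_eq[OF p] B.schwarzian_eq[OF p] complex_eq_iff)

lemma pd_T_field: "open W \<Longrightarrow> W \<subseteq> U \<Longrightarrow> smooth_on W x \<Longrightarrow> p \<in> W \<Longrightarrow>
    pd v (\<lambda>q. T q (x p)) p = pd v (\<lambda>q. T q (x q)) p - T p (pd v x p)"
  using pd_linear_field[OF A.open_U T_linear T_smooth] by simp

text \<open>Extend \<open>u\<close> to the normal section \<open>A.nproj q u\<close>. Every term of
  its Weingarten equations is carried by \<open>T\<close> to the corresponding term for the image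
  section, so \<open>T\<close> commutes with differentiation of it, and the Leibniz rule leaves
  nothing for the derivative of \<open>T\<close> at \<open>u\<close>.\<close>

lemma pd_T_normal:
  assumes p: "p \<in> U" and u: "u \<in> normal_space \<epsilon> Y p" and v: "v = 1 \<or> v = \<i>"
  shows "pd v (\<lambda>q. T q u) p = 0"
proof -
  let ?\<phi> = "\<lambda>q. A.nproj q u" and ?\<phi>' = "\<lambda>q. \<Phi> q (A.nproj q u)"
  have \<phi>: "normal_section \<epsilon> Y U ?\<phi>"
    using A.smooth_nproj[OF order_refl A.open_U smooth_on_const] A.nproj_normal by (simp add: normal_section_def)
  have \<phi>': "normal_section \<epsilon> Y' U ?\<phi>'" by (rule \<Phi>_section[OF A.open_U order_refl \<phi>])
  have "pd v (\<lambda>q. T q (?\<phi> q)) p = pd v ?\<phi>' p"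
    by (rule pd_cong_open[OF A.open_U p]) (simp add: T_normal A.nproj_normal)
  moreover have "pd v ?\<phi>' p = T p (pd v ?\<phi> p)"
  proof -
    let ?X = "A.nproj p (pd v ?\<phi> p)"
    note X = A.nproj_normal[OF p, of "pd v ?\<phi> p"]
    note TX = T_normal[OF p X]
    have np: "B.nproj p (pd v ?\<phi>' p) = T p ?X"
      using \<Phi>_nproj[OF A.open_U order_refl \<phi> p v] TX by simp
    have k: "sprod \<epsilon> (T p ?X) (B.\<kappa> p) = sprod \<epsilon> ?X (A.\<kappa> p)"
      using \<Phi>_\<kappa>_prod[OF p X] TX by simp
    have h: "sprod \<epsilon> (?\<phi>' q) (B.\<kappa> q) = sprod \<epsilon> (?\<phi> q) (A.\<kappa> q)" if "q \<in> U" for q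
      using \<Phi>_\<kappa>_prod[OF that A.nproj_normal[OF that]] .
    have dh: "pd v (\<lambda>q. sprod \<epsilon> (?\<phi>' q) (B.\<kappa> q)) p = pd v (\<lambda>q. sprod \<epsilon> (?\<phi> q) (A.\<kappa> q)) p"
      by (rule pd_cong_open[OF A.open_U p h])
    note dA = A.normal_section_derivatives[OF A.open_U order_refl \<phi> p]
    note dB = B.normal_section_derivatives[OF A.open_U order_refl \<phi>' p]
    note lin = linear_add[OF T_linear[OF p]] linear_diff[OF T_linear[OF p]] T_scale[OF p] T_frame[OF p]
    from v show ?thesis
    proof
      assume v: "v = 1"
      have "pd 1 ?\<phi>' p = T p ?X + (2 * pd 1 (\<lambda>q. sprod \<epsilon> (?\<phi> q) (A.\<kappa> q)) p - 2 * sprod \<epsilon> ?X (A.\<kappa> p)) *\<^sub>R Y' p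
          - (2 * sprod \<epsilon> (?\<phi> p) (A.\<kappa> p)) *\<^sub>R pd 1 Y' p"
        by (rule trans[OF dB(1)]) (simp only: np[unfolded v] k[unfolded v] dh[unfolded v] h[OF p] v)
      also have "\<dots> = T p (?X + (2 * pd 1 (\<lambda>q. sprod \<epsilon> (?\<phi> q) (A.\<kappa> q)) p - 2 * sprod \<epsilon> ?X (A.\<kappa> p)) *\<^sub>R Y p
          - (2 * sprod \<epsilon> (?\<phi> p) (A.\<kappa> p)) *\<^sub>R pd 1 Y p)"
        by (simp only: lin)
      also have "\<dots> = T p (pd 1 ?\<phi> p)"
        unfolding v by (rule arg_cong[OF dA(1)[symmetric]])
      finally show ?thesis by (simp only: v)
    next
      assume v: "v = \<i>"
      have "pd \<i> ?\<phi>' p = T p ?X - (2 * pd \<i> (\<lambda>q. sprod \<epsilon> (?\<phi> q) (A.\<kappa> q)) p - 2 * sprod \<epsilon> ?X (A.\<kappa> p)) *\<^sub>R Y' p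
          + (2 * sprod \<epsilon> (?\<phi> p) (A.\<kappa> p)) *\<^sub>R pd \<i> Y' p"
        by (rule trans[OF dB(2)]) (simp only: np[unfolded v] k[unfolded v] dh[unfolded v] h[OF p] v)
      also have "\<dots> = T p (?X - (2 * pd \<i> (\<lambda>q. sprod \<epsilon> (?\<phi> q) (A.\<kappa> q)) p - 2 * sprod \<epsilon> ?X (A.\<kappa> p)) *\<^sub>R Y p
          + (2 * sprod \<epsilon> (?\<phi> p) (A.\<kappa> p)) *\<^sub>R pd \<i> Y p)"
        by (simp only: lin)
      also have "\<dots> = T p (pd \<i> ?\<phi> p)"
        unfolding v by (rule arg_cong[OF dA(2)[symmetric]])
      finally show ?thesis by (simp only: v)
    qed
  qed
  moreover have "smooth_on U ?\<phi>" using \<phi> by (simp add: normal_section_def)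
  ultimately show ?thesis
    using pd_T_field[OF A.open_U order_refl _ p, of ?\<phi> v] A.nproj_id[OF p u] by simp
qed

lemma pd_T_skew: assumes p: "p \<in> U"
  shows "sprod \<epsilon> (pd v (\<lambda>q. T q x) p) (T p w) = - sprod \<epsilon> (T p x) (pd v (\<lambda>q. T q w) p)"
  using sprod_const_pd[where f="\<lambda>q. T q x" and g="\<lambda>q. T q w" and v=v, OF A.open_U T_smooth T_smooth p T_isometry]
  by simp

lemma pd_T_linear: assumes p: "p \<in> U" shows "linear (\<lambda>x. pd v (\<lambda>q. T q x) p)"
proof (rule linearI)
  note d = smooth_on_differentiable[OF T_smooth p]
  show "pd v (\<lambda>q. T q (x + y)) p = pd v (\<lambda>q. T q x) p + pd v (\<lambda>q. T q y) p" for x y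
    unfolding pd_add[OF d d, symmetric] by (rule pd_cong_open[OF A.open_U p]) (rule T_add)
  show "pd v (\<lambda>q. T q (r *\<^sub>R x)) p = r *\<^sub>R pd v (\<lambda>q. T q x) p" for x r
    unfolding pd_scaleR_const[OF d, symmetric] by (rule pd_cong_open[OF A.open_U p]) (rule T_scale)
qed

lemma T_surj: assumes p: "p \<in> U" shows "surj (T p)"
proof -
  have "x = 0" if "T p x = 0" for x
    by (rule sprod_nondegenerate[OF sign_nonzero]) (use T_isometry[OF p, of x] that in simp)
  then have "inj (T p)" using linear_injective_0[OF T_linear[OF p]] by blast
  then show ?thesis using linear_injective_imp_surjective T_linear[OF p] by blast
qed

text \<open>The difference \<open>E\<close> of the two sides is skew relative to \<open>T\<close>
  and vanishes on all frame vectors except possibly \<open>A.N p\<close>; skewness then removes that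
  last value. Both directions are covered, with \<open>d\<close> equal to \<open>c'\<close> or to
  \<open>- c'\<close>.\<close>

lemma pd_T_eq:
  assumes p: "p \<in> U" and D: "D = (\<lambda>x. pd v (\<lambda>q. T q x) p)"
    and vw: "{v, w} = {1, \<i>}"
    and v: "D (pd v Y p) = - (d *\<^sub>R Y' p)" and w: "D (pd w Y p) = 0"
  shows "D x = d *\<^sub>R (sprod \<epsilon> (T p x) (Y' p) *\<^sub>R pd v Y' p - sprod \<epsilon> (T p x) (pd v Y' p) *\<^sub>R Y' p)"
proof -
  have v1: "v = 1 \<or> v = \<i>" and vw': "(v = 1 \<and> w = \<i>) \<or> (v = \<i> \<and> w = 1)"
    using vw by (auto simp: doubleton_eq_iff)
  define E where "E x = D x - d *\<^sub>R (sprod \<epsilon> (T p x) (Y' p) *\<^sub>R pd v Y' p - sprod \<epsilon> (T p x) (pd v Y' p) *\<^sub>R Y' p)" for x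
  have lin: "linear E"
    using linear_add[OF pd_T_linear[OF p]] linear_scale[OF pd_T_linear[OF p]]
    by (auto intro!: linearI simp: E_def D T_add[OF p] T_scale[OF p] algebra_simps)
  have skew: "sprod \<epsilon> (E x) (T p y) = - sprod \<epsilon> (T p x) (E y)" for x y
    using pd_T_skew[OF p, of v x y] sprod_commute[of \<epsilon> "Y' p" "T p y"] sprod_commute[of \<epsilon> "pd v Y' p" "T p y"]
    by (simp add: E_def D algebra_simps)
  have "D (Y p) = pd v (\<lambda>q. T q (Y q)) p - T p (pd v Y p)"
    unfolding D by (rule pd_T_field[OF A.open_U order_refl A.smooth_Y p])
  also have "pd v (\<lambda>q. T q (Y q)) p = pd v Y' p"
    by (rule pd_cong_open[OF A.open_U p]) (rule T_frame)
  finally have EY: "E (Y p) = 0"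
    using v1 by (auto simp: E_def T_frame[OF p] B.gram[OF p])
  have Ev: "E (pd v Y p) = 0" using v1 v by (auto simp: E_def T_frame[OF p] B.gram[OF p])
  have Ew: "E (pd w Y p) = 0" using vw' w by (auto simp: E_def T_frame[OF p] B.gram[OF p])
  have En: "E u = 0" if "u \<in> normal_space \<epsilon> Y p" for u
  proof -
    have "T p u \<in> normal_space \<epsilon> Y' p" using T_normal[OF p that] \<Phi>_normal[OF p that] by simp
    then show ?thesis using v1 pd_T_normal[OF p that v1] by (auto simp: E_def D B.normal_space_iff[OF p])
  qed
  have dec: "E x = - (sprod \<epsilon> x (Y p) *\<^sub>R E (A.N p))" for x
  proof -
    have "x = A.nproj p x - sprod \<epsilon> x (A.N p) *\<^sub>R Y p - sprod \<epsilon> x (Y p) *\<^sub>R A.N p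
     + sprod \<epsilon> x (pd v Y p) *\<^sub>R pd v Y p + sprod \<epsilon> x (pd w Y p) *\<^sub>R pd w Y p"
      using vw' by (auto simp: A.nproj_def)
    from arg_cong[OF this, of E] show ?thesis
      by (simp add: linear_add[OF lin] linear_diff[OF lin] linear_scale[OF lin] EY Ev Ew En[OF A.nproj_normal[OF p]])
  qed
  have "E (A.N p) = 0"
  proof (rule sprod_nondegenerate[OF sign_nonzero])
    fix y
    obtain x where x: "y = T p x" using T_surj[OF p] by (metis surjD)
    \<comment> \<open>Skewness with both arguments equal to \<open>A.N p\<close>; by
      \<open>dec\<close> this single product governs all products with the last value.\<close>
    have z: "sprod \<epsilon> (T p (A.N p)) (E (A.N p)) = 0"
      using skew[of "A.N p" "A.N p"] sprod_commute[of \<epsilon> "T p (A.N p)" "E (A.N p)"] by linarith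
    have "sprod \<epsilon> (E (A.N p)) y = - sprod \<epsilon> (T p (A.N p)) (E x)" unfolding x by (rule skew)
    also have "\<dots> = 0" unfolding dec[of x] by (simp add: z)
    finally show "sprod \<epsilon> (E (A.N p)) y = 0" .
  qed
  then have "E x = 0" unfolding dec[of x] by simp
  then show ?thesis by (simp add: E_def)
qed

sublocale gauge_pair \<epsilon> U Y Y' T c'
proof
  show "\<epsilon> i \<noteq> 0" for i by (rule sign_nonzero)
  show "smooth_on U (\<lambda>p. T p x)" for x by (rule T_smooth)
  fix p assume p: "p \<in> U"
  show "T p (x + y) = T p x + T p y" "T p (r *\<^sub>R x) = r *\<^sub>R T p x" for x y r
    by (rule T_add[OF p] T_scale[OF p])+
  show "sprod \<epsilon> (T p u) (T p v) = sprod \<epsilon> u v" for u v by (rule T_isometry[OF p])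
  show "T p (Y p) = Y' p" by (rule T_frame[OF p])
  have D: "pd v (\<lambda>q. T q (pd w Y p)) p = pd v (pd w Y') p - T p (pd v (pd w Y) p)"
    if "w = 1 \<or> w = \<i>" for v w
  proof -
    have "pd v (\<lambda>q. T q (pd w Y q)) p = pd v (pd w Y') p"
      by (rule pd_cong_open[OF A.open_U p]) (use that T_frame in auto)
    then show ?thesis using pd_T_field[OF A.open_U order_refl A.smooth_frame(1) p] by simp
  qed
  note lin = linear_add[OF T_linear[OF p]] linear_diff[OF T_linear[OF p]] T_scale[OF p]
    T_frame[OF p] T_L[OF p] T_\<kappa>[OF p]
  fix x
  show "pd 1 (\<lambda>q. T q x) p =
      c' *\<^sub>R (sprod \<epsilon> (T p x) (Y' p) *\<^sub>R pd 1 Y' p - sprod \<epsilon> (T p x) (pd 1 Y' p) *\<^sub>R Y' p)"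
  proof (rule pd_T_eq[OF p, of "\<lambda>x. pd 1 (\<lambda>q. T q x) p" 1 \<i>])
    have "pd 1 (\<lambda>q. T q (pd 1 Y p)) p = pd 1 (pd 1 Y') p - T p (pd 1 (pd 1 Y) p)"
      by (rule D) simp
    \<comment> \<open>\<open>L\<close> and \<open>\<kappa>\<close> are matched by \<open>T\<close>,
      so only the shift of the Schwarzian coefficient of \<open>Y\<close> survives.\<close>
    also have "\<dots> = - (c' *\<^sub>R Y' p)"
      unfolding A.second_derivatives B.second_derivatives lin schwarzian_parts[OF p] by (simp add: algebra_simps)
    finally show "pd 1 (\<lambda>q. T q (pd 1 Y p)) p = - (c' *\<^sub>R Y' p)" .
    show "pd 1 (\<lambda>q. T q (pd \<i> Y p)) p = 0"
      by (simp add: D A.Y21[OF p] B.Y21[OF p] lin schwarzian_parts[OF p])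
  qed auto
  show "pd \<i> (\<lambda>q. T q x) p =
      - c' *\<^sub>R (sprod \<epsilon> (T p x) (Y' p) *\<^sub>R pd \<i> Y' p - sprod \<epsilon> (T p x) (pd \<i> Y' p) *\<^sub>R Y' p)"
  proof (rule pd_T_eq[OF p, of "\<lambda>x. pd \<i> (\<lambda>q. T q x) p" \<i> 1])
    have "pd \<i> (\<lambda>q. T q (pd \<i> Y p)) p = pd \<i> (pd \<i> Y') p - T p (pd \<i> (pd \<i> Y) p)"
      by (rule D) simp
    \<comment> \<open>The Schwarzian enters this second derivative with the opposite sign, whence
      \<open>- c'\<close>.\<close>
    also have "\<dots> = - ((- c') *\<^sub>R Y' p)"
      unfolding A.second_derivatives B.second_derivatives lin schwarzian_parts[OF p] by (simp add: algebra_simps)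
    finally show "pd \<i> (\<lambda>q. T q (pd \<i> Y p)) p = - ((- c') *\<^sub>R Y' p)" .
    show "pd \<i> (\<lambda>q. T q (pd 1 Y p)) p = 0"
      by (simp add: D A.Y12[OF p] B.Y12[OF p] lin schwarzian_parts[OF p])
  qed auto
qed

end

section \<open>Global lifts and the compactification\<close>

locale lift_sign_change = A: conformal_lift \<epsilon> W Y + B: conformal_lift \<epsilon> W' Z
  for \<epsilon> :: "'m::finite \<Rightarrow> real" and W Y W' Z +
  fixes N \<sigma>
  assumes sign: "\<sigma> = 1 \<or> \<sigma> = (-1::real)" and N: "open N" "N \<subseteq> W \<inter> W'"
    and ZY: "q \<in> N \<Longrightarrow> Z q = \<sigma> *\<^sub>R Y q"
begin

lemma sign_square [simp]: "\<sigma> * \<sigma> = 1" "\<sigma> * (\<sigma> * x) = x"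
  using sign by auto

text \<open>What is linear in the lift takes the factor \<open>\<sigma>\<close>; what is quadratic
  takes its square and stays unchanged.\<close>

lemma scaled:
  assumes p: "p \<in> N"
  shows "pd v Z p = \<sigma> *\<^sub>R pd v Y p" "pd w (pd v Z) p = \<sigma> *\<^sub>R pd w (pd v Y) p"
    "B.L p = \<sigma> *\<^sub>R A.L p" "B.N p = \<sigma> *\<^sub>R A.N p" "B.\<kappa> p = \<sigma> *\<^sub>R A.\<kappa> p"
    "B.s1 p = A.s1 p" "B.s2 p = A.s2 p" "B.nproj p = A.nproj p"
proof -
  have sm: "smooth_on N Y" using N smooth_on_subset[OF A.smooth_Y] by blast
  show d: "pd v Z p = \<sigma> *\<^sub>R pd v Y p" "pd w (pd v Z) p = \<sigma> *\<^sub>R pd w (pd v Y) p" for v w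
    using pd_scaled_cong[OF N(1) sm ZY p] by blast+
  show L: "B.L p = \<sigma> *\<^sub>R A.L p" by (simp add: A.L_def B.L_def d scaleR_add_right)
  show N: "B.N p = \<sigma> *\<^sub>R A.N p" by (simp add: A.N_def B.N_def L ZY[OF p] algebra_simps)
  show "B.s1 p = A.s1 p" "B.s2 p = A.s2 p"
    by (simp_all add: A.s1_def B.s1_def A.s2_def B.s2_def d L algebra_simps)
  show "B.\<kappa> p = \<sigma> *\<^sub>R A.\<kappa> p"
    by (simp add: A.\<kappa>_def B.\<kappa>_def d L ZY[OF p] algebra_simps)
  show "B.nproj p = A.nproj p"
    using sign by (auto simp: fun_eq_iff A.nproj_def B.nproj_def d N ZY[OF p])
qed

lemma in_domains: "p \<in> N \<Longrightarrow> p \<in> W" "p \<in> N \<Longrightarrow> p \<in> W'"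
  using N by auto

lemma normal_space_same: "p \<in> N \<Longrightarrow> normal_space \<epsilon> Z p = normal_space \<epsilon> Y p"
  using sign by (auto simp: A.normal_space_iff B.normal_space_iff in_domains scaled ZY)

lemma schwarzian_same: "p \<in> N \<Longrightarrow> schwarzian \<epsilon> Z p = schwarzian \<epsilon> Y p"
  by (simp add: A.schwarzian_eq B.schwarzian_eq in_domains scaled)

lemma hopf_sign: "p \<in> N \<Longrightarrow> hopf \<epsilon> Z p = complex_of_real \<sigma> *s hopf \<epsilon> Y p"
  by (simp add: complex_vec_eq_iff A.hopf_parts B.hopf_parts in_domains scaled ZY algebra_simps)

lemma Dz_same: "p \<in> N \<Longrightarrow> Dz \<epsilon> Z \<phi> p = Dz \<epsilon> Y \<phi> p"
proof -
  assume p: "p \<in> N"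
  have "normal_proj \<epsilon> Z p = normal_proj \<epsilon> Y p"
    by (simp add: fun_eq_iff A.normal_proj_eq B.normal_proj_eq in_domains p scaled)
  then show ?thesis by (simp add: Dz_def)
qed

end

lemma lift_sign_changeE:
  fixes Y Z :: "complex \<Rightarrow> real^'m::finite"
  assumes Y: "canonical_lift \<epsilon> W y Y" and Z: "canonical_lift \<epsilon> W' y Z" and p: "p \<in> W" "p \<in> W'"
  obtains \<sigma> N where "lift_sign_change \<epsilon> W Y W' Z N \<sigma>" "p \<in> N"
proof -
  obtain \<sigma> N where *: "\<sigma> = 1 \<or> \<sigma> = (-1::real)" "open N" "p \<in> N" "N \<subseteq> W \<inter> W'" "\<And>q. q \<in> N \<Longrightarrow> Z q = \<sigma> *\<^sub>R Y q"
    by (rule canonical_lift_unique[OF Y Z p]) blast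
  interpret A: conformal_lift \<epsilon> W Y by (rule canonical_liftD[OF Y])
  interpret B: conformal_lift \<epsilon> W' Z by (rule canonical_liftD[OF Z])
  have "lift_sign_change \<epsilon> W Y W' Z N \<sigma>" by unfold_locales (use * in auto)
  then show ?thesis using that *(3) by blast
qed

section \<open>Gluing local canonical lifts\<close>

lemma canonical_lift_uminus:
  assumes "canonical_lift \<epsilon> W y Z" shows "canonical_lift \<epsilon> W y (\<lambda>q. - Z q)"
proof -
  interpret conformal_lift \<epsilon> W Z by (rule canonical_liftD[OF assms])
  have d: "pd v (\<lambda>q. - Z q) p = - pd v Z p" if "p \<in> W" for p v
    using pd_linear[OF bounded_linear_minus[OF bounded_linear_ident] smooth_on_differentiable[OF smooth_Y that]] .
  interpret M: conformal_lift \<epsilon> W "\<lambda>q. - Z q"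
    by unfold_locales (auto intro: smooth_on_minus simp: d Y_nonzero Y_null Y_conformal)
  have "span {- Z p} = span {Z p}" for p
    unfolding span_eq by (auto intro: span_base span_neg) (metis span_base span_neg add.inverse_inverse singletonI)
  then show ?thesis using assms by (intro M.canonical_liftI) (simp add: canonical_lift_def)
qed

lemma canonical_lift_local:
  assumes U: "open U" and loc: "\<And>p. p \<in> U \<Longrightarrow> \<exists>N Z. p \<in> N \<and> canonical_lift \<epsilon> N y Z \<and> (\<forall>q\<in>N. Y q = Z q)"
  shows "canonical_lift \<epsilon> U y Y"
  unfolding canonical_lift_def
proof (intro conjI U)
  show "smooth_on U Y"
  proof (rule smooth_on_local)
    fix p assume "p \<in> U"
    from loc[OF this] obtain N Z where "p \<in> N" "canonical_lift \<epsilon> N y Z" "\<forall>q\<in>N. Y q = Z q" by blast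
    then show "\<exists>W. open W \<and> p \<in> W \<and> smooth_on W Y"
      using smooth_on_cong[of N Y Z] by (auto simp: canonical_lift_def)
  qed
  show "\<forall>p\<in>U. Y p \<noteq> 0 \<and> sprod \<epsilon> (Y p) (Y p) = 0 \<and> y p = span {Y p} \<and>
    (\<forall>v. sprod \<epsilon> (frechet_derivative Y (at p) v) (frechet_derivative Y (at p) v) = (norm v)\<^sup>2)"
  proof
    fix p assume "p \<in> U"
    from loc[OF this] obtain N Z where N: "p \<in> N" "canonical_lift \<epsilon> N y Z" "\<forall>q\<in>N. Y q = Z q" by blast
    then have "frechet_derivative Y (at p) v = frechet_derivative Z (at p) v" for v
      using pd_cong_open[of N p Y Z v] by (simp add: pd_def canonical_lift_def)
    then show "Y p \<noteq> 0 \<and> sprod \<epsilon> (Y p) (Y p) = 0 \<and> y p = span {Y p} \<and>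
      (\<forall>v. sprod \<epsilon> (frechet_derivative Y (at p) v) (frechet_derivative Y (at p) v) = (norm v)\<^sup>2)"
      using N by (simp add: canonical_lift_def)
  qed
qed

text \<open>A function that does not vanish and changes sign with the lift singles out one of the two lifts,
  so that the local lifts fit together.\<close>

lemma global_lift:
  fixes \<psi> :: "complex \<Rightarrow> real^'m::finite"
  assumes U: "open U" and \<psi>: "smooth_on U \<psi>"
    and loc: "\<And>p. p \<in> U \<Longrightarrow> \<exists>W Z. p \<in> W \<and> W \<subseteq> U \<and> canonical_lift \<epsilon> W y Z \<and> sprod \<epsilon> (\<psi> p) (pd 1 (pd 1 Z) p) \<noteq> 0"
  obtains Y where "canonical_lift \<epsilon> U y Y" "\<And>p. p \<in> U \<Longrightarrow> sprod \<epsilon> (\<psi> p) (pd 1 (pd 1 Y) p) > 0"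
proof -
  define pos where "pos p W Z \<longleftrightarrow> p \<in> W \<and> W \<subseteq> U \<and> canonical_lift \<epsilon> W y Z \<and> sprod \<epsilon> (\<psi> p) (pd 1 (pd 1 Z) p) > 0" for p W Z
  have ex: "\<exists>W Z. pos p W Z" if p: "p \<in> U" for p
  proof -
    obtain W Z where Z: "p \<in> W" "W \<subseteq> U" "canonical_lift \<epsilon> W y Z" "sprod \<epsilon> (\<psi> p) (pd 1 (pd 1 Z) p) \<noteq> 0"
      using loc[OF p] by blast
    interpret conformal_lift \<epsilon> W Z by (rule canonical_liftD[OF Z(3)])
    have "pd 1 (pd 1 (\<lambda>q. - Z q)) p = (-1) *\<^sub>R pd 1 (pd 1 Z) p"
      by (rule pd_scaled_cong[OF open_U smooth_Y _ Z(1)]) simp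
    then have "sprod \<epsilon> (\<psi> p) (pd 1 (pd 1 (\<lambda>q. - Z q)) p) = - sprod \<epsilon> (\<psi> p) (pd 1 (pd 1 Z) p)" by simp
    then have "pos p W Z \<or> pos p W (\<lambda>q. - Z q)"
      unfolding pos_def using Z canonical_lift_uminus[OF Z(3)] by auto
    then show ?thesis by blast
  qed
  have uniq: "Z p = Z' p" if "pos p W Z" "pos p W' Z'" for p W W' Z Z'
  proof -
    have "canonical_lift \<epsilon> W y Z" "canonical_lift \<epsilon> W' y Z'" "p \<in> W" "p \<in> W'"
      using that by (auto simp: pos_def)
    then obtain \<sigma> N where change: "lift_sign_change \<epsilon> W Z W' Z' N \<sigma>" "p \<in> N"
      by (rule lift_sign_changeE)
    interpret lift_sign_change \<epsilon> W Z W' Z' N \<sigma> by (rule change)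
    show ?thesis using sign that by (auto simp: pos_def scaled[OF change(2)] ZY[OF change(2)])
  qed
  \<comment> \<open>The chosen object is a value, not a lift; by \<open>uniq\<close> all positive
    lifts share it.\<close>
  define Y where "Y p = (SOME v. \<exists>W Z. pos p W Z \<and> v = Z p)" for p
  have Y: "Y p = Z p" if "pos p W Z" for p W Z
    unfolding Y_def by (rule some_equality) (use that uniq in blast)+
  have near: "\<exists>N Z. p \<in> N \<and> canonical_lift \<epsilon> N y Z \<and> (\<forall>q\<in>N. Y q = Z q) \<and> sprod \<epsilon> (\<psi> p) (pd 1 (pd 1 Z) p) > 0"
    if p: "p \<in> U" for p
  proof -
    obtain W Z where Z: "pos p W Z" using ex[OF p] by blast
    then interpret conformal_lift \<epsilon> W Z by (auto simp: pos_def intro: canonical_liftD)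
    have W: "W \<subseteq> U" using Z by (simp add: pos_def)
    \<comment> \<open>On this smaller set \<open>Z\<close> stays positive and therefore is the
      selected lift at every point, not only at \<open>p\<close>.\<close>
    define N where "N = W \<inter> (\<lambda>q. sprod \<epsilon> (\<psi> q) (pd 1 (pd 1 Z) q)) -` {0<..}"
    have "smooth_on W (\<lambda>q. sprod \<epsilon> (\<psi> q) (pd 1 (pd 1 Z) q))"
      by (intro smooth_on_sprod open_U smooth_on_subset[OF \<psi> W] smooth_frame)
    then have "open N" unfolding N_def
      by (intro continuous_open_preimage open_U smooth_on_continuous_on) auto
    moreover have "N \<subseteq> W" by (auto simp: N_def)
    ultimately have "canonical_lift \<epsilon> N y Z" using Z canonical_lift_subset by (auto simp: pos_def)
    moreover have "p \<in> N" using Z by (simp add: pos_def N_def)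
    moreover have "\<forall>q\<in>N. Y q = Z q" using Z Y unfolding pos_def N_def by blast
    ultimately show ?thesis using Z by (auto simp: pos_def)
  qed
  show ?thesis
  proof (rule that)
    show "canonical_lift \<epsilon> U y Y" by (rule canonical_lift_local[OF U]) (use near in blast)
    fix p assume "p \<in> U"
    then obtain N Z where N: "p \<in> N" "canonical_lift \<epsilon> N y Z" "\<forall>q\<in>N. Y q = Z q" "sprod \<epsilon> (\<psi> p) (pd 1 (pd 1 Z) p) > 0"
      using near by blast
    then interpret conformal_lift \<epsilon> N Z by (auto intro: canonical_liftD)
    have "pd 1 (pd 1 Y) p = 1 *\<^sub>R pd 1 (pd 1 Z) p"
      by (rule pd_scaled_cong[OF open_U smooth_Y _ N(1)]) (use N in simp)
    then show "sprod \<epsilon> (\<psi> p) (pd 1 (pd 1 Y) p) > 0" using N by simp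
  qed
qed

section \<open>Unpacking the hypotheses on local domains\<close>

lemma isothermic_liftI:
  assumes "isothermic_adapted \<epsilon> U y" "canonical_lift \<epsilon> W y Y" "W \<subseteq> U"
  shows "isothermic_lift \<epsilon> W Y"
proof -
  interpret conformal_lift \<epsilon> W Y by (rule canonical_liftD[OF assms(2)])
  show ?thesis
    by unfold_locales (use assms isothermicD in \<open>auto simp: isothermic_adapted_def\<close>)
qed

lemma spectral_transform_local:
  fixes y y' :: "complex \<Rightarrow> (real^'m::finite) set"
  assumes "spectral_transform \<epsilon> U c' y y'" and sign: "\<And>i. \<epsilon> i \<noteq> 0"
  obtains \<Phi> where "\<And>p. p \<in> U \<Longrightarrow> \<exists>W Z Z'. p \<in> W \<and> W \<subseteq> U \<and> canonical_lift \<epsilon> W y Z \<and> canonical_lift \<epsilon> W y' Z' \<and>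
    normal_isometry \<epsilon> W Z Z' \<Phi> c'"
proof -
  have iso: "isothermic_adapted \<epsilon> U y" "isothermic_adapted \<epsilon> U y'"
    using assms(1) by (simp_all add: spectral_transform_def)
  obtain \<Phi> :: "complex \<Rightarrow> real ^ 'm \<Rightarrow> real ^ 'm" where \<Phi>: "\<forall>p\<in>U. \<exists>W Y Y'.
        p \<in> W \<and> W \<subseteq> U \<and> canonical_lift \<epsilon> W y Y \<and> canonical_lift \<epsilon> W y' Y' \<and>
        (\<forall>q\<in>W. schwarzian \<epsilon> Y' q = schwarzian \<epsilon> Y q + of_real c' \<and>
           bij_betw (\<Phi> q) (normal_space \<epsilon> Y q) (normal_space \<epsilon> Y' q) \<and>
           (\<forall>u\<in>normal_space \<epsilon> Y q. \<forall>v\<in>normal_space \<epsilon> Y q.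
              (\<forall>a b. \<Phi> q (a *\<^sub>R u + b *\<^sub>R v) = a *\<^sub>R \<Phi> q u + b *\<^sub>R \<Phi> q v) \<and>
              sprod \<epsilon> (\<Phi> q u) (\<Phi> q v) = sprod \<epsilon> u v) \<and>
           (\<forall>u\<in>normal_space \<epsilon> Y q.
              sprod \<epsilon> (hopf \<epsilon> Y' q) (cvec (\<Phi> q u)) = sprod \<epsilon> (hopf \<epsilon> Y q) (cvec u))) \<and>
        (\<forall>W' \<phi>. open W' \<and> W' \<subseteq> W \<and> normal_section \<epsilon> Y W' \<phi> \<longrightarrow>
           smooth_on W' (\<lambda>q. \<Phi> q (\<phi> q)) \<and>
           (\<forall>q\<in>W'. Dz \<epsilon> Y' (\<lambda>q. \<Phi> q (\<phi> q)) q = cextend (\<Phi> q) (Dz \<epsilon> Y \<phi> q)))"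
    using assms(1) unfolding spectral_transform_def by blast
  show ?thesis
  proof (rule that[of \<Phi>])
    fix p assume "p \<in> U"
    from \<Phi>[rule_format, OF this] obtain W Y Y' where W: "p \<in> W" "W \<subseteq> U"
      and lifts: "canonical_lift \<epsilon> W y Y" "canonical_lift \<epsilon> W y' Y'"
      and pt: "\<forall>q\<in>W. schwarzian \<epsilon> Y' q = schwarzian \<epsilon> Y q + of_real c' \<and>
           bij_betw (\<Phi> q) (normal_space \<epsilon> Y q) (normal_space \<epsilon> Y' q) \<and>
           (\<forall>u\<in>normal_space \<epsilon> Y q. \<forall>v\<in>normal_space \<epsilon> Y q.
              (\<forall>a b. \<Phi> q (a *\<^sub>R u + b *\<^sub>R v) = a *\<^sub>R \<Phi> q u + b *\<^sub>R \<Phi> q v) \<and>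
              sprod \<epsilon> (\<Phi> q u) (\<Phi> q v) = sprod \<epsilon> u v) \<and>
           (\<forall>u\<in>normal_space \<epsilon> Y q.
              sprod \<epsilon> (hopf \<epsilon> Y' q) (cvec (\<Phi> q u)) = sprod \<epsilon> (hopf \<epsilon> Y q) (cvec u))"
      and sec: "\<forall>W' \<phi>. open W' \<and> W' \<subseteq> W \<and> normal_section \<epsilon> Y W' \<phi> \<longrightarrow>
           smooth_on W' (\<lambda>q. \<Phi> q (\<phi> q)) \<and>
           (\<forall>q\<in>W'. Dz \<epsilon> Y' (\<lambda>q. \<Phi> q (\<phi> q)) q = cextend (\<Phi> q) (Dz \<epsilon> Y \<phi> q))"
      by (elim exE conjE) (rule that; assumption)
    have "normal_isometry \<epsilon> W Y Y' \<Phi> c'"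
      unfolding normal_isometry_def normal_isometry_axioms_def
      using isothermic_liftI[OF iso(1) lifts(1) W(2)] isothermic_liftI[OF iso(2) lifts(2) W(2)] sign pt sec
      by blast
    then show "\<exists>W Z Z'. p \<in> W \<and> W \<subseteq> U \<and> canonical_lift \<epsilon> W y Z \<and> canonical_lift \<epsilon> W y' Z' \<and>
      normal_isometry \<epsilon> W Z Z' \<Phi> c'" using W lifts by blast
  qed
qed

locale polar_section = isothermic_lift \<epsilon> U Y
  for \<epsilon> :: "'m::finite \<Rightarrow> real" and U Y +
  fixes \<psi> :: "complex \<Rightarrow> real^'m"
  assumes section_\<psi>: "normal_section \<epsilon> Y U \<psi>"
    and parallel_\<psi>: "p \<in> U \<Longrightarrow> Dz \<epsilon> Y \<psi> p = 0"
begin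

lemma smooth_\<psi> [simp, intro]: "smooth_on U \<psi>" and \<psi>_normal: "p \<in> U \<Longrightarrow> \<psi> p \<in> normal_space \<epsilon> Y p"
  using section_\<psi> by (simp_all add: normal_section_def)

definition h :: "complex \<Rightarrow> real" where "h p = sprod \<epsilon> (\<psi> p) (\<kappa> p)"

lemma smooth_h: "smooth_on U h"
  unfolding h_def[abs_def] by (intro smooth_on_sprod) auto

text \<open>\<open>L\<close> and \<open>Y\<close> are orthogonal to \<open>\<psi>\<close>. Thus the
  sign of \<open>h\<close> can be read from a plain second derivative of the lift, the form in which
  \<open>global_lift\<close> uses it.\<close>

lemma h_eq: "p \<in> U \<Longrightarrow> sprod \<epsilon> (\<psi> p) (pd 1 (pd 1 Y) p) = 2 * h p"
  using \<psi>_normal[of p] by (simp add: second_derivatives normal_space_iff h_def)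

lemma nproj_pd_\<psi>: assumes p: "p \<in> U" shows "nproj p (pd 1 \<psi> p) = 0" "nproj p (pd \<i> \<psi> p) = 0"
  using Dz_parts[OF p smooth_on_differentiable[OF smooth_\<psi> p]] parallel_\<psi>[OF p] by simp_all

lemma pd_\<psi>: assumes p: "p \<in> U"
  shows "pd 1 \<psi> p = 2 *\<^sub>R (pd 1 h p *\<^sub>R Y p - h p *\<^sub>R pd 1 Y p)"
    "pd \<i> \<psi> p = - 2 *\<^sub>R (pd \<i> h p *\<^sub>R Y p - h p *\<^sub>R pd \<i> Y p)"
  using normal_section_derivatives[OF open_U order_refl section_\<psi> p]
  by (simp_all add: nproj_pd_\<psi>[OF p] h_def[symmetric] algebra_simps)

text \<open>By \<open>pd_\<psi>\<close> the product in the hypothesis is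
  \<open>4 * (h p)\<^sup>2\<close>.\<close>

lemma nondegenerate_h: 
  assumes p: "p \<in> U" and "sprod \<epsilon> (pd 1 \<psi> p) (pd 1 \<psi> p) > 0"
  shows "h p \<noteq> 0"
  using assms(2) by (auto simp: pd_\<psi>[OF p] gram[OF p])

end

lemma polar_sectionI:
  assumes "polar_transform \<epsilon> U y c \<psi>" "canonical_lift \<epsilon> W y Y" "W \<subseteq> U"
  shows "polar_section \<epsilon> W Y \<psi>"
proof -
  interpret isothermic_lift \<epsilon> W Y
    using isothermic_liftI assms by (auto simp: polar_transform_def)
  show ?thesis by unfold_locales (use assms in \<open>auto simp: polar_transform_def\<close>)
qed

section \<open>Passage to the compactification\<close>

context gauge_pair
begin

text \<open>\<open>T\<close> is extended by the identity on the kernel of \<open>\<pi>\<close>,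
  which by \<open>adj\<close> is orthogonal to the image of \<open>\<iota>\<close>. The lifts lie in
  that image, so the connection form annihilates the kernel and the equation persists.\<close>

lemma gauge_pair_embed:
  fixes \<eta> :: "'k::finite \<Rightarrow> real" and \<iota> :: "real^'m \<Rightarrow> real^'k" and \<pi> :: "real^'k \<Rightarrow> real^'m"
  assumes \<eta>: "\<And>j. \<eta> j \<noteq> 0" and \<iota>: "linear \<iota>" and \<pi>: "linear \<pi>"
    and retract: "\<And>u. \<pi> (\<iota> u) = u" and adj: "\<And>x u. sprod \<eta> x (\<iota> u) = sprod \<epsilon> (\<pi> x) u"
  shows "gauge_pair \<eta> U (\<lambda>p. \<iota> (Y p)) (\<lambda>p. \<iota> (Y' p)) (\<lambda>p x. \<iota> (T p (\<pi> x)) + (x - \<iota> (\<pi> x))) c'"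
proof -
  have bl: "bounded_linear \<iota>" using \<iota> by (simp add: linear_conv_bounded_linear)
  have adj': "sprod \<eta> (\<iota> u) x = sprod \<epsilon> u (\<pi> x)" for u x
    using adj[of x u] sprod_commute by metis
  have pd\<iota>: "pd v (\<lambda>q. \<iota> (f q)) p = \<iota> (pd v f p)" if "smooth_on U f" "p \<in> U" for v f p
    by (rule pd_linear[OF bl smooth_on_differentiable[OF that]])
  have nz: "\<iota> u \<noteq> 0" if "u \<noteq> 0" for u using that retract linear_0[OF \<pi>] by metis
  interpret E: conformal_lift \<eta> U "\<lambda>p. \<iota> (Y p)"
    by unfold_locales (auto simp: pd\<iota> adj retract A.Y_null A.Y_conformal A.Y_nonzero nz intro: smooth_on_linear bl)
  interpret E': conformal_lift \<eta> U "\<lambda>p. \<iota> (Y' p)"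
    by unfold_locales (auto simp: pd\<iota> adj retract B.Y_null B.Y_conformal B.Y_nonzero nz intro: smooth_on_linear bl)
  note lin = linear_add[OF \<iota>] linear_add[OF \<pi>] linear_diff[OF \<iota>] linear_diff[OF \<pi>] linear_scale[OF \<iota>] linear_scale[OF \<pi>]
    linear_neg[OF \<iota>]
  show ?thesis
  proof
    show "\<eta> j \<noteq> 0" for j by (rule \<eta>)
    show "smooth_on U (\<lambda>p. \<iota> (T p (\<pi> x)) + (x - \<iota> (\<pi> x)))" for x
      by (intro smooth_intros A.open_U smooth_on_linear[OF A.open_U bl] T_smooth)
    fix p assume p: "p \<in> U"
    note Tlin = linear_add[OF T_linear[OF p]] linear_scale[OF T_linear[OF p]]
    show "\<iota> (T p (\<pi> (x + y))) + (x + y - \<iota> (\<pi> (x + y)))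
        = \<iota> (T p (\<pi> x)) + (x - \<iota> (\<pi> x)) + (\<iota> (T p (\<pi> y)) + (y - \<iota> (\<pi> y)))" for x y
      by (simp add: lin Tlin)
    show "\<iota> (T p (\<pi> (r *\<^sub>R x))) + (r *\<^sub>R x - \<iota> (\<pi> (r *\<^sub>R x))) = r *\<^sub>R (\<iota> (T p (\<pi> x)) + (x - \<iota> (\<pi> x)))" for r x
      by (simp add: lin Tlin algebra_simps)
    show "sprod \<eta> (\<iota> (T p (\<pi> u)) + (u - \<iota> (\<pi> u))) (\<iota> (T p (\<pi> v)) + (v - \<iota> (\<pi> v))) = sprod \<eta> u v" for u v
      by (simp add: adj adj' retract lin T_isometry[OF p])
    show "\<iota> (T p (\<pi> (\<iota> (Y p)))) + (\<iota> (Y p) - \<iota> (\<pi> (\<iota> (Y p)))) = \<iota> (Y' p)"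
      by (simp add: retract T_Y[OF p])
    fix x
    have d: "pd v (\<lambda>q. \<iota> (T q (\<pi> x)) + (x - \<iota> (\<pi> x))) p = \<iota> (pd v (\<lambda>q. T q (\<pi> x)) p)" for v
      using smooth_on_differentiable[OF T_smooth p]
      by (subst pd_add) (auto simp: pd\<iota>[OF T_smooth p] intro!: differentiable_linear[OF bl])
    show "pd 1 (\<lambda>q. \<iota> (T q (\<pi> x)) + (x - \<iota> (\<pi> x))) p =
      c' *\<^sub>R (sprod \<eta> (\<iota> (T p (\<pi> x)) + (x - \<iota> (\<pi> x))) (\<iota> (Y' p)) *\<^sub>R pd 1 (\<lambda>p. \<iota> (Y' p)) p
        - sprod \<eta> (\<iota> (T p (\<pi> x)) + (x - \<iota> (\<pi> x))) (pd 1 (\<lambda>p. \<iota> (Y' p)) p) *\<^sub>R \<iota> (Y' p))"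
      unfolding d T_pd1[OF p] pd\<iota>[OF B.smooth_Y p] by (simp add: adj lin retract)
    show "pd \<i> (\<lambda>q. \<iota> (T q (\<pi> x)) + (x - \<iota> (\<pi> x))) p =
      - c' *\<^sub>R (sprod \<eta> (\<iota> (T p (\<pi> x)) + (x - \<iota> (\<pi> x))) (\<iota> (Y' p)) *\<^sub>R pd \<i> (\<lambda>p. \<iota> (Y' p)) p
        - sprod \<eta> (\<iota> (T p (\<pi> x)) + (x - \<iota> (\<pi> x))) (pd \<i> (\<lambda>p. \<iota> (Y' p)) p) *\<^sub>R \<iota> (Y' p))"
      unfolding d T_pd2[OF p] pd\<iota>[OF B.smooth_Y p] by (simp add: adj lin retract)
  qed
qed

end

definition opt_embed :: "real^'m::finite \<Rightarrow> real^'m option" where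
  "opt_embed x = (\<chi> j. case j of None \<Rightarrow> 0 | Some i \<Rightarrow> x $ i)"

definition opt_restrict :: "real^'m option \<Rightarrow> real^'m::finite" where
  "opt_restrict x = (\<chi> i. x $ Some i)"

lemma opt_embed: "linear opt_embed" "linear opt_restrict" "opt_restrict (opt_embed u) = u"
  "opt_restrict (ext_vec c u) = u"
  by (auto intro!: linearI simp: opt_embed_def opt_restrict_def ext_vec_def vec_eq_iff split: option.splits)

lemma sum_option: "(\<Sum>j\<in>UNIV. f j) = f None + (\<Sum>i\<in>(UNIV::'m::finite set). f (Some i))"
  by (simp add: UNIV_option_conv sum.reindex)

lemma sprod_opt_embed: "sprod (ext_sign c \<epsilon>) x (opt_embed u) = sprod \<epsilon> (opt_restrict x) u"
  by (simp add: sprod_real sum_option opt_embed_def opt_restrict_def ext_sign_def)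

lemma sprod_ext_vec: "sprod (ext_sign c \<epsilon>) (ext_vec c x) (ext_vec c x) = sprod \<epsilon> x x - c"
  by (simp add: sprod_real sum_option ext_vec_def ext_sign_def) (simp add: sgn_mult_abs mult.assoc)

text \<open>The extra coordinate of \<open>ext_vec\<close> is constant, so it disappears from all
  derivatives.\<close>

lemma ext_vec_eq: "ext_vec c x = opt_embed x + ext_vec c 0"
  by (simp add: vec_eq_iff ext_vec_def opt_embed_def split: option.splits)

locale polar_isometry = normal_isometry \<epsilon> U Y Y' \<Phi> c' + P: polar_section \<epsilon> U Y \<psi>
  for \<epsilon> :: "'m::finite \<Rightarrow> real" and U Y Y' \<Phi> c' \<psi> +
  fixes c :: real
  assumes \<psi>_nonzero: "p \<in> U \<Longrightarrow> \<psi> p \<noteq> 0" and \<psi>_square: "p \<in> U \<Longrightarrow> sprod \<epsilon> (\<psi> p) (\<psi> p) = c"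
    and h_pos: "p \<in> U \<Longrightarrow> P.h p > 0"
begin

lemma polar_spectral: "polar_spectral_transform \<epsilon> U c c' \<psi> (\<lambda>p. T p (\<psi> p))"
proof (cases "c = 0")
  case True
  interpret Q: polar_gauge_pair \<epsilon> U Y Y' T c' \<psi> P.h
    by unfold_locales
      (use True \<psi>_nonzero \<psi>_square h_pos P.smooth_h P.pd_\<psi> P.\<psi>_normal in \<open>auto simp: A.normal_space_iff\<close>)
  show ?thesis using Q.spectral_transform_polar unfolding Q.F'_def
    by (simp add: polar_spectral_transform_def True)
next
  case False
  let ?\<eta> = "ext_sign c \<epsilon>"
  have \<eta>: "?\<eta> j \<noteq> 0" for j
    using False sign_nonzero by (auto simp: ext_sign_def sgn_zero_iff split: option.splits)
  let ?T = "\<lambda>p x. opt_embed (T p (opt_restrict x)) + (x - opt_embed (opt_restrict x))"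
  interpret E: gauge_pair ?\<eta> U "\<lambda>p. opt_embed (Y p)" "\<lambda>p. opt_embed (Y' p)" ?T c'
    by (rule gauge_pair_embed[OF \<eta>]) (simp_all add: opt_embed sprod_opt_embed)
  have bl: "bounded_linear (opt_embed :: real^'m \<Rightarrow> _)" using opt_embed(1) by (simp add: linear_conv_bounded_linear)
  have pdE: "pd v (\<lambda>q. opt_embed (f q)) p = opt_embed (pd v f p)" if "smooth_on U f" "p \<in> U" for v p and f :: "complex \<Rightarrow> real^'m"
    by (rule pd_linear[OF bl smooth_on_differentiable[OF that]])
  have sm: "smooth_on U (\<lambda>q. opt_embed (\<psi> q))" by (rule smooth_on_linear[OF A.open_U bl P.smooth_\<psi>])
  have ext: "(\<lambda>q. ext_vec c (\<psi> q)) = (\<lambda>q. opt_embed (\<psi> q) + ext_vec c 0)" by (metis ext_vec_eq)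
  have pdF: "pd v (\<lambda>q. ext_vec c (\<psi> q)) p = opt_embed (pd v \<psi> p)" if "p \<in> U" for v p
    unfolding ext using pd_add[OF smooth_on_differentiable[OF sm that] differentiable_const] pdE[OF P.smooth_\<psi> that] by simp
  note lin = linear_add[OF opt_embed(1)] linear_diff[OF opt_embed(1)] linear_scale[OF opt_embed(1)] linear_neg[OF opt_embed(1)]
  interpret Q: polar_gauge_pair ?\<eta> U "\<lambda>p. opt_embed (Y p)" "\<lambda>p. opt_embed (Y' p)" ?T c' "\<lambda>p. ext_vec c (\<psi> p)" P.h
  proof
    show "smooth_on U (\<lambda>p. ext_vec c (\<psi> p))" unfolding ext by (intro smooth_intros A.open_U sm)
    show "smooth_on U P.h" by (rule P.smooth_h)
    fix p assume p: "p \<in> U"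
    show "P.h p > 0" by (rule h_pos[OF p])
    show "ext_vec c (\<psi> p) \<noteq> 0" using False by (auto simp: ext_vec_def vec_eq_iff intro!: exI[of _ None])
    show "sprod ?\<eta> (ext_vec c (\<psi> p)) (ext_vec c (\<psi> p)) = 0" by (simp add: sprod_ext_vec \<psi>_square[OF p])
    show "sprod ?\<eta> (ext_vec c (\<psi> p)) (opt_embed (Y p)) = 0"
      using P.\<psi>_normal[OF p] by (simp add: sprod_opt_embed opt_embed A.normal_space_iff[OF p])
    show "pd 1 (\<lambda>p. ext_vec c (\<psi> p)) p = 2 *\<^sub>R (pd 1 P.h p *\<^sub>R opt_embed (Y p) - P.h p *\<^sub>R pd 1 (\<lambda>p. opt_embed (Y p)) p)"
      "pd \<i> (\<lambda>p. ext_vec c (\<psi> p)) p = - 2 *\<^sub>R (pd \<i> P.h p *\<^sub>R opt_embed (Y p) - P.h p *\<^sub>R pd \<i> (\<lambda>p. opt_embed (Y p)) p)"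
      unfolding pdF[OF p] P.pd_\<psi>[OF p] pdE[OF A.smooth_Y p] by (simp_all add: lin)
  qed
  \<comment> \<open>The extended isometry fixes the extra coordinate, so the new surface is again
    the image of a map into the same quadric.\<close>
  have "Q.F' p = ext_vec c (T p (\<psi> p))" for p
    unfolding Q.F'_def by (simp add: opt_embed ext_vec_eq[of c "\<psi> p"] ext_vec_eq[of c "T p (\<psi> p)"])
       (simp add: ext_vec_eq[of c "\<psi> p", symmetric] opt_embed)
  then show ?thesis using Q.spectral_transform_polar False by (simp add: polar_spectral_transform_def)
qed

text \<open>The conditions hold for the lift \<open>Y'\<close>, and every other lift differs from it
  near each point by a sign, which changes neither normal spaces nor \<open>Dz\<close>.\<close>

lemma polar_transform:
  assumes iso: "isothermic_adapted \<epsilon> U y'" and lift: "canonical_lift \<epsilon> U y' Y'"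
  shows "polar_transform \<epsilon> U y' c (\<lambda>p. T p (\<psi> p))"
  unfolding polar_transform_def
proof (intro conjI iso ballI allI impI)
  fix p assume p: "p \<in> U"
  show "T p (\<psi> p) \<noteq> 0" using \<psi>_nonzero[OF p] T_inj[OF p] linear_0[OF T_linear[OF p]] by (metis injD)
  show "sprod \<epsilon> (T p (\<psi> p)) (T p (\<psi> p)) = c" using T_isometry \<psi>_square p by simp
next
  fix W Z assume "W \<subseteq> U \<and> canonical_lift \<epsilon> W y' Z"
  then have W: "W \<subseteq> U" and Z: "canonical_lift \<epsilon> W y' Z" by auto
  have T0: "cextend (T p) 0 = 0" if "p \<in> U" for p
    using linear_0[OF T_linear[OF that]] by (simp add: cextend_def)
  have *: "T p (\<psi> p) \<in> normal_space \<epsilon> Z p \<and> Dz \<epsilon> Z (\<lambda>p. T p (\<psi> p)) p = 0" if p: "p \<in> W" for p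
  proof -
    have pU: "p \<in> U" using p W by auto
    obtain \<sigma> N where N: "lift_sign_change \<epsilon> U Y' W Z N \<sigma>" "p \<in> N"
      by (rule lift_sign_changeE[OF lift Z pU p])
    interpret S: lift_sign_change \<epsilon> U Y' W Z N \<sigma> by (rule N)
    show ?thesis
      using S.normal_space_same[OF N(2)] S.Dz_same[OF N(2)] T_normal_iff[OF pU] P.\<psi>_normal[OF pU]
        Dz_T[OF A.open_U order_refl P.section_\<psi> pU] P.parallel_\<psi>[OF pU] T0[OF pU] by simp
  qed
  have "smooth_on W (\<lambda>p. T p (\<psi> p))"
    using smooth_on_subset[OF smooth_T[OF A.open_U order_refl P.smooth_\<psi>] W] .
  then show "normal_section \<epsilon> Z W (\<lambda>p. T p (\<psi> p))" using * by (simp add: normal_section_def)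
  show "Dz \<epsilon> Z (\<lambda>p. T p (\<psi> p)) p = 0" if "p \<in> W" for p using * that by simp
qed

end

theorem theorem4p1:
  fixes \<epsilon> :: "'m::finite \<Rightarrow> real"
    and n r :: nat
    and U :: "complex set"
    and y y' :: "complex \<Rightarrow> (real ^ 'm) set"
    and \<psi> :: "complex \<Rightarrow> real ^ 'm"
    and c c' :: real
  assumes "n \<ge> r + 2"
    and "signature \<epsilon> (n + 2) (r + 1)"
    and "isothermic_adapted \<epsilon> U y"
    and "isothermic_adapted \<epsilon> U y'"
    and "spectral_transform \<epsilon> U c' y y'"
    and "polar_transform \<epsilon> U y c \<psi>"
    and "nondegenerate \<epsilon> U \<psi>"
  shows "\<exists>\<psi>'. polar_transform \<epsilon> U y' c \<psi>' \<and> polar_spectral_transform \<epsilon> U c c' \<psi> \<psi>'"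
proof -
  have sign: "\<epsilon> i \<noteq> 0" for i
    using assms(2) unfolding signature_def by (metis zero_neq_neg_one zero_neq_one)
  have U: "open U" using assms(3) by (simp add: isothermic_adapted_def spacelike_surface_def)
  obtain \<Phi> where loc: "\<And>p. p \<in> U \<Longrightarrow> \<exists>W Z Z'. p \<in> W \<and> W \<subseteq> U \<and> canonical_lift \<epsilon> W y Z \<and>
      canonical_lift \<epsilon> W y' Z' \<and> normal_isometry \<epsilon> W Z Z' \<Phi> c'"
    using spectral_transform_local[OF assms(5) sign] by blast
  \<comment> \<open>This involves no choice of lifts and can therefore be used to select one for
    \<open>y'\<close>. At the end it agrees with \<open>T p (\<psi> p)\<close>, as
    \<open>\<psi> p\<close> is normal.\<close>
  define \<psi>' where "\<psi>' p = \<Phi> p (\<psi> p)" for p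
  have loc\<psi>: "smooth_on W \<psi> \<and> smooth_on W \<psi>' \<and> (\<forall>q\<in>W. sprod \<epsilon> (\<psi> q) (pd 1 (pd 1 Z) q) \<noteq> 0 \<and>
      sprod \<epsilon> (\<psi>' q) (pd 1 (pd 1 Z') q) = sprod \<epsilon> (\<psi> q) (pd 1 (pd 1 Z) q))"
    if W: "W \<subseteq> U" and Z: "canonical_lift \<epsilon> W y Z" and "normal_isometry \<epsilon> W Z Z' \<Phi> c'" for W Z Z'
  proof -
    interpret M: normal_isometry \<epsilon> W Z Z' \<Phi> c' by fact
    interpret P: polar_section \<epsilon> W Z \<psi> by (rule polar_sectionI[OF assms(6) Z W])
    have "smooth_on W \<psi>'" unfolding \<psi>'_def by (rule M.\<Phi>_smooth[OF M.A.open_U order_refl P.section_\<psi>])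
    moreover have "sprod \<epsilon> (\<psi> q) (pd 1 (pd 1 Z) q) \<noteq> 0 \<and>
      sprod \<epsilon> (\<psi>' q) (pd 1 (pd 1 Z') q) = sprod \<epsilon> (\<psi> q) (pd 1 (pd 1 Z) q)" if q: "q \<in> W" for q
    proof
      have "sprod \<epsilon> (pd 1 \<psi> q) (pd 1 \<psi> q) > 0"
        using assms(7) W q unfolding nondegenerate_def pd_def by (metis subsetD zero_neq_one)
      then show "sprod \<epsilon> (\<psi> q) (pd 1 (pd 1 Z) q) \<noteq> 0"
        using P.nondegenerate_h[OF q] by (simp add: P.h_eq[OF q])
      have "\<psi>' q \<in> normal_space \<epsilon> Z' q" unfolding \<psi>'_def by (rule M.\<Phi>_normal[OF q P.\<psi>_normal[OF q]])
      then show "sprod \<epsilon> (\<psi>' q) (pd 1 (pd 1 Z') q) = sprod \<epsilon> (\<psi> q) (pd 1 (pd 1 Z) q)"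
        using M.\<Phi>_\<kappa>_prod[OF q P.\<psi>_normal[OF q]]
        by (simp add: P.h_eq[OF q] P.h_def M.B.second_derivatives M.B.normal_space_iff[OF q] \<psi>'_def)
    qed
    ultimately show ?thesis by auto
  qed
  have loc_smooth: "\<exists>W. open W \<and> p \<in> W \<and> smooth_on W \<psi> \<and> smooth_on W \<psi>'" if p: "p \<in> U" for p
  proof -
    obtain W Z Z' where "p \<in> W" "W \<subseteq> U" "canonical_lift \<epsilon> W y Z"
      "canonical_lift \<epsilon> W y' Z'" "normal_isometry \<epsilon> W Z Z' \<Phi> c'" using loc[OF p] by blast
    then show ?thesis using loc\<psi>[of W Z Z'] by (auto simp: canonical_lift_def)
  qed
  have smooth: "smooth_on U \<psi>" "smooth_on U \<psi>'"
    by (rule smooth_on_local, use loc_smooth in blast)+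
  obtain Y where Y: "canonical_lift \<epsilon> U y Y" "\<And>p. p \<in> U \<Longrightarrow> sprod \<epsilon> (\<psi> p) (pd 1 (pd 1 Y) p) > 0"
  proof (rule global_lift[OF U smooth(1), of \<epsilon> y])
    fix p assume "p \<in> U"
    then obtain W Z Z' where "p \<in> W" "W \<subseteq> U" "canonical_lift \<epsilon> W y Z"
      "canonical_lift \<epsilon> W y' Z'" "normal_isometry \<epsilon> W Z Z' \<Phi> c'" using loc by blast
    then show "\<exists>W Z. p \<in> W \<and> W \<subseteq> U \<and> canonical_lift \<epsilon> W y Z \<and> sprod \<epsilon> (\<psi> p) (pd 1 (pd 1 Z) p) \<noteq> 0"
      using loc\<psi>[of W Z Z'] by (intro exI[of _ W] exI[of _ Z]) simp
  qed blast
  obtain Y' where Y': "canonical_lift \<epsilon> U y' Y'" "\<And>p. p \<in> U \<Longrightarrow> sprod \<epsilon> (\<psi>' p) (pd 1 (pd 1 Y') p) > 0"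
  proof (rule global_lift[OF U smooth(2), of \<epsilon> y'])
    fix p assume "p \<in> U"
    then obtain W Z Z' where "p \<in> W" "W \<subseteq> U" "canonical_lift \<epsilon> W y Z"
      "canonical_lift \<epsilon> W y' Z'" "normal_isometry \<epsilon> W Z Z' \<Phi> c'" using loc by meson
    then show "\<exists>W Z. p \<in> W \<and> W \<subseteq> U \<and> canonical_lift \<epsilon> W y' Z \<and> sprod \<epsilon> (\<psi>' p) (pd 1 (pd 1 Z) p) \<noteq> 0"
      using loc\<psi>[of W Z Z'] by (intro exI[of _ W] exI[of _ Z']) simp
  qed blast
  \<comment> \<open>One sign \<open>\<sigma>\<close> has to serve both surfaces: with different
    signs the Hopf condition on the local lifts would not pass to the global ones.\<close>
  have near: "\<exists>N \<sigma> W Z Z'. p \<in> N \<and> N \<subseteq> U \<and> normal_isometry \<epsilon> W Z Z' \<Phi> c' \<and>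
      lift_sign_change \<epsilon> U Y W Z N \<sigma> \<and> lift_sign_change \<epsilon> U Y' W Z' N \<sigma>" if p: "p \<in> U" for p
  proof -
    obtain W Z Z' where W: "p \<in> W" "W \<subseteq> U" "canonical_lift \<epsilon> W y Z"
      "canonical_lift \<epsilon> W y' Z'" "normal_isometry \<epsilon> W Z Z' \<Phi> c'" using loc[OF p] by meson
    obtain \<sigma> N where N: "lift_sign_change \<epsilon> U Y W Z N \<sigma>" "p \<in> N"
      by (rule lift_sign_changeE[OF Y(1) W(3) p W(1)])
    obtain \<sigma>' N' where N': "lift_sign_change \<epsilon> U Y' W Z' N' \<sigma>'" "p \<in> N'"
      by (rule lift_sign_changeE[OF Y'(1) W(4) p W(1)])
    interpret S: lift_sign_change \<epsilon> U Y W Z N \<sigma> by (rule N)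
    interpret S': lift_sign_change \<epsilon> U Y' W Z' N' \<sigma>' by (rule N')
    have "sprod \<epsilon> (\<psi>' p) (pd 1 (pd 1 Z') p) = sprod \<epsilon> (\<psi> p) (pd 1 (pd 1 Z) p)"
      using loc\<psi>[OF W(2,3,5)] W(1) by blast
    then have "\<sigma>' * sprod \<epsilon> (\<psi>' p) (pd 1 (pd 1 Y') p) = \<sigma> * sprod \<epsilon> (\<psi> p) (pd 1 (pd 1 Y) p)"
      by (simp add: S.scaled[OF N(2)] S'.scaled[OF N'(2)])
    \<comment> \<open>Both global lifts were selected by positivity of the products that occur here,
      so the signs agree.\<close>
    then have "\<sigma>' = \<sigma>" using S.sign S'.sign Y(2)[OF p] Y'(2)[OF p] by auto
    have "lift_sign_change \<epsilon> U Y W Z (N \<inter> N') \<sigma>"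
      by unfold_locales (use S.sign S.N S'.N S.ZY in auto)
    moreover have "lift_sign_change \<epsilon> U Y' W Z' (N \<inter> N') \<sigma>"
      by unfold_locales (use S.sign S.N S'.N S'.ZY \<open>\<sigma>' = \<sigma>\<close> in auto)
    moreover have "N \<inter> N' \<subseteq> U" using S.N by auto
    ultimately show ?thesis using N(2) N'(2) W(5) by blast
  qed
  interpret A: isothermic_lift \<epsilon> U Y by (rule isothermic_liftI[OF assms(3) Y(1) order_refl])
  interpret B: isothermic_lift \<epsilon> U Y' by (rule isothermic_liftI[OF assms(4) Y'(1) order_refl])
  interpret M: normal_isometry \<epsilon> U Y Y' \<Phi> c'
  proof
    show "\<epsilon> i \<noteq> 0" for i by (rule sign)
    fix p assume "p \<in> U"
    then obtain N \<sigma> W Z Z' where N: "p \<in> N" "N \<subseteq> U" and iso: "normal_isometry \<epsilon> W Z Z' \<Phi> c'"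
      and S: "lift_sign_change \<epsilon> U Y W Z N \<sigma>" and S': "lift_sign_change \<epsilon> U Y' W Z' N \<sigma>" using near by meson
    interpret L: normal_isometry \<epsilon> W Z Z' \<Phi> c' by (rule iso)
    interpret S: lift_sign_change \<epsilon> U Y W Z N \<sigma> by (rule S)
    interpret S': lift_sign_change \<epsilon> U Y' W Z' N \<sigma> by (rule S')
    have pW: "p \<in> W" using S.in_domains N by auto
    note same = S.normal_space_same[OF N(1), symmetric] S'.normal_space_same[OF N(1), symmetric]
    show "schwarzian \<epsilon> Y' p = schwarzian \<epsilon> Y p + of_real c'"
      using L.schwarzian_shift[OF pW] S.schwarzian_same[OF N(1)] S'.schwarzian_same[OF N(1)] by simp
    show "bij_betw (\<Phi> p) (normal_space \<epsilon> Y p) (normal_space \<epsilon> Y' p)"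
      unfolding same by (rule L.\<Phi>_bij[OF pW])
    fix u assume u: "u \<in> normal_space \<epsilon> Y p"
    show "sprod \<epsilon> (hopf \<epsilon> Y' p) (cvec (\<Phi> p u)) = sprod \<epsilon> (hopf \<epsilon> Y p) (cvec u)"
      \<comment> \<open>Both Hopf differentials carry the common factor \<open>\<sigma>\<close>,
        which cancels.\<close>
      using L.\<Phi>_hopf[OF pW u[unfolded same]] S.sign
      by (auto simp: S.hopf_sign[OF N(1)] S'.hopf_sign[OF N(1)] sprod_cvec complex_eq_iff)
    fix v assume v: "v \<in> normal_space \<epsilon> Y p"
    show "\<Phi> p (a *\<^sub>R u + b *\<^sub>R v) = a *\<^sub>R \<Phi> p u + b *\<^sub>R \<Phi> p v" for a b
      by (rule L.\<Phi>_lin[OF pW u[unfolded same] v[unfolded same]])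
    show "sprod \<epsilon> (\<Phi> p u) (\<Phi> p v) = sprod \<epsilon> u v"
      by (rule L.\<Phi>_isometry[OF pW u[unfolded same] v[unfolded same]])
  next
    fix V \<phi> assume V: "open V" "V \<subseteq> U" and \<phi>: "normal_section \<epsilon> Y V \<phi>"
    have *: "\<exists>N. open N \<and> p \<in> N \<and> smooth_on N (\<lambda>q. \<Phi> q (\<phi> q)) \<and>
        Dz \<epsilon> Y' (\<lambda>q. \<Phi> q (\<phi> q)) p = cextend (\<Phi> p) (Dz \<epsilon> Y \<phi> p)" if p: "p \<in> V" for p
    proof -
      obtain N \<sigma> W Z Z' where N: "p \<in> N" "N \<subseteq> U" and iso: "normal_isometry \<epsilon> W Z Z' \<Phi> c'"
        and S: "lift_sign_change \<epsilon> U Y W Z N \<sigma>" and S': "lift_sign_change \<epsilon> U Y' W Z' N \<sigma>"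
        using near p V(2) by (meson subsetD)
      interpret L: normal_isometry \<epsilon> W Z Z' \<Phi> c' by (rule iso)
      interpret S: lift_sign_change \<epsilon> U Y W Z N \<sigma> by (rule S)
      interpret S': lift_sign_change \<epsilon> U Y' W Z' N \<sigma> by (rule S')
      have VN: "open (V \<inter> N)" "V \<inter> N \<subseteq> W" "p \<in> V \<inter> N" using V S.N N p by auto
      have sec: "normal_section \<epsilon> Z (V \<inter> N) \<phi>"
        using \<phi> smooth_on_subset[of V \<phi> "V \<inter> N"] by (auto simp: normal_section_def S.normal_space_same)
      show ?thesis
        using L.\<Phi>_smooth[OF VN(1,2) sec] L.\<Phi>_Dz[OF VN(1,2) sec VN(3)] VN
          S.Dz_same[OF N(1)] S'.Dz_same[OF N(1)] by (intro exI[of _ "V \<inter> N"]) simp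
    qed
    \<comment> \<open>Smoothness is a local property, so it is inherited from the domains of the
      local lifts.\<close>
    show "smooth_on V (\<lambda>q. \<Phi> q (\<phi> q))" by (rule smooth_on_local) (use * in blast)
    show "Dz \<epsilon> Y' (\<lambda>q. \<Phi> q (\<phi> q)) p = cextend (\<Phi> p) (Dz \<epsilon> Y \<phi> p)" if "p \<in> V" for p
      using *[OF that] by blast
  qed
  interpret P: polar_section \<epsilon> U Y \<psi> by (rule polar_sectionI[OF assms(6) Y(1) order_refl])
  interpret R: polar_isometry \<epsilon> U Y Y' \<Phi> c' \<psi> c
    by unfold_locales (use assms(6) Y(2) P.h_eq in \<open>auto simp: polar_transform_def\<close>)
  show ?thesis
    using R.polar_transform[OF assms(4) Y'(1)] R.polar_spectral by blast
qed

end
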